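(* Let $\mathcal{M}$ denote the collection of meager subsets of $2^\omega$. Suppose $Q$ is a partially ordered set such that every countable subset of $Q$ has a strict upper bound in $Q$. Then in the forcing extension by $\mathbb{P}_Q$ (a ccc forcing notion), $(\mathcal{M},\subseteq)$ contains a cofinal subset $\{E_a: a\in Q\}$ which is order-isomorphic to $Q$, that is: (1) for every $X\in\mathcal{M}$ there is $a\in Q$ such that $X\subseteq E_a$; and (2) for $a,b\in Q$, $E_a\subseteq E_b$ if and only if $a\leq b$.
   Context: Notation: $\omega^{\uparrow\omega}$ ($\omega^{\uparrow<\omega}$) is the set of strictly increasing functions $\omega\to\omega$ (strictly increasing finite sequences of naturals); $\mathbb{C}=2^{<\omega}$ is Cohen forcing. For $x\in 2^\omega$ and $f\in\omega^{\uparrow\omega}$, $E_{x,f}=\{z\in 2^\omega: \exists m<\omega\,\forall n\geq m\,\exists j\in[f(n),f(n+1))\,(z(j)\neq x(j))\}$. Construction: Let $Q^*=Q\cup\{Q\}$, with $a<Q$ for all $a\in Q$. Fix a well-founded cofinal subset $R\subseteq Q$; define the usual rank function on the well-founded set $R^*=R\cup\{Q\}$, and for $a\in Q\setminus R$ let $\mathrm{rank}(a)=\min\{\mathrm{rank}(b): b\in R^*, a<b\}$. For $x,y\in Q^*$, $x\ll y$ means $x<y$ and $\mathrm{rank}(x)<\mathrm{rank}(y)$. For $x\in Q^*$ let $Q_x=\{y\in Q: y\ll x\}$, and for $F\subseteq Q^*$ let $\bar F=\{\mathrm{rank}(x): x\in F\}$. By induction on $\mathrm{rank}(a)$ for $a\in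 Q^*$, define $\mathbb{P}_a$: a condition is $p=(\{s^p_\alpha:\alpha\in\bar{F^p}\},\{(t^p_b,\dot f^p_b):b\in F^p\})$ where $F^p$ is a finite subset of $Q_a$, each $s^p_\alpha\in\mathbb{C}$, and for $b\in F^p$, $t^p_b\in\omega^{\uparrow<\omega}$ and $\dot f^p_b$ is a $\mathbb{P}_b*\mathbb{C}$-name for an element of $\omega^{\uparrow\omega}$. For $b<a$, $p\restriction b=(\{s^p_\alpha:\alpha\in\bar{F_b}\},\{(t^p_c,\dot f^p_c):c\in F_b\})$ with $F_b=F^p\cap Q_b$. For $p,q\in\mathbb{P}_a$, $p\leq q$ iff: (1) $F^q\subseteq F^p$; (2) $s^q_\alpha\subseteq s^p_\alpha$ for $\alpha\in\bar{F^q}$; (3) for $b\in F^q$, $t^q_b\subseteq t^p_b$ and, with $\beta=\mathrm{rank}(b)$, the condition $\langle p\restriction b,s^p_\beta\rangle\in\mathbb{P}_b*\mathbb{C}$ forces (a) for all $n$ there is $k$ with $[\dot f^q_b(k),\dot f^q_b(k+1))\subseteq[\dot f^p_b(n),\dot f^p_b(n+1))$, and (b) for all $n\in|t^p_b|\setminus|t^q_b|$ there is $k$ with $[\dot f^q_b(k),\dot f^q_b(k+1))\subseteq[t^p_b(n-1),t^p_b(n))$; (4) for $b,c\in F^q$ with $b<c$ and $\mathrm{rank}(b)=\mathrm{rank}(c)$, for all $n\in|t^p_c|\setminus|t^q_c|$ there is $k<|t^p_b|$ with $[t^p_b(k-1),t^p_b(k))\subseteq[t^p_c(n-1),t^p_c(n))$.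 For a $\mathbb{P}_Q$-generic $G$: for $\alpha<\mathrm{rank}(Q)$, $c_\alpha=\bigcup\{s^p_\alpha: p\in G,\ \alpha\in\bar{F^p}\}\in 2^\omega$; for $a\in Q$, $d_a=\bigcup\{t^p_a: p\in G,\ a\in F^p\}\in\omega^{\uparrow\omega}$; and $E_a=E_{c_\alpha,d_a}$ where $\alpha=\mathrm{rank}(a)$. *)

theory Defs
  imports Complex_Main "HOL-Library.Countable_Set" "HOL-Library.Sublist"
begin

section \<open>Forcing notions and the forcing relation\<close>

record 'p forcing =
  conds :: "'p set"
  leq :: "'p \<Rightarrow> 'p \<Rightarrow> bool"

definition forcing_notion :: "'p forcing \<Rightarrow> bool" where
  "forcing_notion P \<longleftrightarrow> conds P \<noteq> {} \<and> reflp_on (conds P) (leq P) \<and> transp_on (conds P) (leq P)"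

definition compat :: "'p forcing \<Rightarrow> 'p \<Rightarrow> 'p \<Rightarrow> bool" where
  "compat P p q \<longleftrightarrow> (\<exists>r\<in>conds P. leq P r p \<and> leq P r q)"

definition ccc :: "'p forcing \<Rightarrow> bool" where
  "ccc P \<longleftrightarrow> (\<forall>A\<subseteq>conds P. (\<forall>p\<in>A. \<forall>q\<in>A. p \<noteq> q \<longrightarrow> \<not> compat P p q) \<longrightarrow> countable A)"

text \<open>A statement about the forcing extension is represented by the conditions of \<open>P\<close>
  that force it.  The connectives below are the recursive clauses of the (strong) forcing relation.
  Ground-model objects, in particular natural numbers and finite sequences, range over HOL types;
  objects of the extension range over names.\<close>

type_synonym 'p formula = "'p forcing \<Rightarrow> 'p \<Rightarrow> bool"

definition forces :: "'p forcing \<Rightarrow> 'p \<Rightarrow> 'p formula \<Rightarrow> bool" where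
  "forces P p \<phi> \<longleftrightarrow> \<phi> P p"

text \<open>Truth in the forcing extension: every condition (equivalently, the largest one) forces it.\<close>

definition forced :: "'p forcing \<Rightarrow> 'p formula \<Rightarrow> bool" where
  "forced P \<phi> \<longleftrightarrow> (\<forall>p\<in>conds P. forces P p \<phi>)"

definition dense_below :: "('p \<Rightarrow> bool) \<Rightarrow> 'p formula" where
  "dense_below D P p \<longleftrightarrow>
     (\<forall>q\<in>conds P. leq P q p \<longrightarrow> (\<exists>r\<in>conds P. leq P r q \<and> D r))"

text \<open>\<open>ground \<phi>\<close> is for an absolute statement about the ground model.\<close>

definition ground :: "bool \<Rightarrow> 'p formula" where
  "ground \<phi> P p \<longleftrightarrow> \<phi>"

definition fneg :: "'p formula \<Rightarrow> 'p formula" ("\<^bold>\<not> _" [40] 40) where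
  "(\<^bold>\<not> \<phi>) P p \<longleftrightarrow> (\<forall>q\<in>conds P. leq P q p \<longrightarrow> \<not> \<phi> P q)"

definition fconj :: "'p formula \<Rightarrow> 'p formula \<Rightarrow> 'p formula" (infixr "\<^bold>\<and>" 35) where
  "(\<phi> \<^bold>\<and> \<psi>) P p \<longleftrightarrow> \<phi> P p \<and> \<psi> P p"

definition fimp :: "'p formula \<Rightarrow> 'p formula \<Rightarrow> 'p formula" (infixr "\<^bold>\<longrightarrow>" 25) where
  "(\<phi> \<^bold>\<longrightarrow> \<psi>) P p \<longleftrightarrow> (\<forall>q\<in>conds P. leq P q p \<longrightarrow> \<phi> P q \<longrightarrow> \<psi> P q)"

definition fiff :: "'p formula \<Rightarrow> 'p formula \<Rightarrow> 'p formula" (infixr "\<^bold>\<longleftrightarrow>" 25) where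
  "(\<phi> \<^bold>\<longleftrightarrow> \<psi>) = ((\<phi> \<^bold>\<longrightarrow> \<psi>) \<^bold>\<and> (\<psi> \<^bold>\<longrightarrow> \<phi>))"

definition fall :: "('x \<Rightarrow> 'p formula) \<Rightarrow> 'p formula" (binder "\<^bold>\<forall>" 10) where
  "(\<^bold>\<forall>x. \<phi> x) P p \<longleftrightarrow> (\<forall>x. \<phi> x P p)"

definition fex :: "('x \<Rightarrow> 'p formula) \<Rightarrow> 'p formula" (binder "\<^bold>\<exists>" 10) where
  "(\<^bold>\<exists>x. \<phi> x) P p \<longleftrightarrow> dense_below (\<lambda>r. \<exists>x. \<phi> x P r) P p"

section \<open>Names for reals and for sets of reals\<close>

text \<open>A name for a subset of \<open>\<omega> \<times> 'v\<close>; names for elements of \<open>2\<^sup>\<omega>\<close> and of \<open>\<omega>\<^sup>\<omega>\<close> are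
  those forced to be functions, with \<open>'v\<close> being \<open>bool\<close> and \<open>nat\<close>.\<close>

type_synonym ('p, 'v) fun_name = "('p \<times> nat \<times> 'v) set"
type_synonym 'p real_name = "('p, bool) fun_name"
type_synonym 'p set_name = "('p real_name \<times> 'p) set"

definition val :: "('p, 'v) fun_name \<Rightarrow> nat \<Rightarrow> 'v \<Rightarrow> 'p formula" where
  "val \<tau> n v P p \<longleftrightarrow> dense_below (\<lambda>r. \<exists>q\<in>conds P. (q, n, v) \<in> \<tau> \<and> leq P r q) P p"

definition is_fun :: "('p, 'v) fun_name \<Rightarrow> 'p formula" where
  "is_fun \<tau> =
     ((\<^bold>\<forall>n. \<^bold>\<exists>v. val \<tau> n v) \<^bold>\<and> (\<^bold>\<forall>n v w. (val \<tau> n v \<^bold>\<and> val \<tau> n w) \<^bold>\<longrightarrow> ground (v = w)))"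

text \<open>Membership in \<open>2\<^sup>\<omega>\<close> and in \<open>\<omega>\<^bsup>\<up>\<omega>\<^esup>\<close>.\<close>

definition in_Cantor :: "'p real_name \<Rightarrow> 'p formula" where
  "in_Cantor z = is_fun z"

definition in_incr :: "('p, nat) fun_name \<Rightarrow> 'p formula" where
  "in_incr f = (is_fun f \<^bold>\<and>
     (\<^bold>\<forall>m n k l. ground (m < n) \<^bold>\<longrightarrow> val f m k \<^bold>\<longrightarrow> val f n l \<^bold>\<longrightarrow> ground (k < l)))"

definition eq_at :: "('p, 'v) fun_name \<Rightarrow> ('p, 'v) fun_name \<Rightarrow> nat \<Rightarrow> 'p formula" where
  "eq_at x y n = (\<^bold>\<exists>v. val x n v \<^bold>\<and> val y n v)"

definition same_fun :: "('p, 'v) fun_name \<Rightarrow> ('p, 'v) fun_name \<Rightarrow> 'p formula" where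
  "same_fun x y = (\<^bold>\<forall>n v. val x n v \<^bold>\<longleftrightarrow> val y n v)"

definition mem :: "'p real_name \<Rightarrow> 'p set_name \<Rightarrow> 'p formula" where
  "mem z X P p \<longleftrightarrow>
     dense_below (\<lambda>r. \<exists>(y, q)\<in>X. q \<in> conds P \<and> leq P r q \<and> same_fun z y P r) P p"

definition sub :: "'p set_name \<Rightarrow> 'p set_name \<Rightarrow> 'p formula" where
  "sub X Y = (\<^bold>\<forall>z. mem z X \<^bold>\<longrightarrow> mem z Y)"

definition sub_Cantor :: "'p set_name \<Rightarrow> 'p formula" where
  "sub_Cantor X = (\<^bold>\<forall>z. mem z X \<^bold>\<longrightarrow> in_Cantor z)"

definition extends :: "'p real_name \<Rightarrow> bool list \<Rightarrow> 'p formula" where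
  "extends z s = (\<^bold>\<forall>j. ground (j < length s) \<^bold>\<longrightarrow> val z j (s ! j))"

definition in_closure :: "'p real_name \<Rightarrow> 'p set_name \<Rightarrow> 'p formula" where
  "in_closure z A = (in_Cantor z \<^bold>\<and>
     (\<^bold>\<forall>s. extends z s \<^bold>\<longrightarrow> (\<^bold>\<exists>y. mem y A \<^bold>\<and> extends y s)))"

text \<open>The closure has empty interior: it includes no basic open set \<open>[s]\<close>.\<close>

definition nowhere_dense :: "'p set_name \<Rightarrow> 'p formula" where
  "nowhere_dense A = (sub_Cantor A \<^bold>\<and>
     (\<^bold>\<forall>s. \<^bold>\<not> (\<^bold>\<forall>z. (in_Cantor z \<^bold>\<and> extends z s) \<^bold>\<longrightarrow> in_closure z A)))"

text \<open>A sequence of sets in the extension is given by a ground-model sequence of names.\<close>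

definition meager :: "'p set_name \<Rightarrow> 'p formula" where
  "meager X = (sub_Cantor X \<^bold>\<and>
     (\<^bold>\<exists>A. (\<^bold>\<forall>n::nat. nowhere_dense (A n)) \<^bold>\<and> (\<^bold>\<forall>z. mem z X \<^bold>\<longleftrightarrow> (\<^bold>\<exists>n. mem z (A n)))))"

text \<open>\<open>j \<in> [f(n), f(n+1))\<close>\<close>

definition in_interval :: "nat \<Rightarrow> ('p, nat) fun_name \<Rightarrow> nat \<Rightarrow> 'p formula" where
  "in_interval j f n = (\<^bold>\<exists>k l. val f n k \<^bold>\<and> val f (Suc n) l \<^bold>\<and> ground (k \<le> j \<and> j < l))"

definition in_E :: "'p real_name \<Rightarrow> 'p real_name \<Rightarrow> ('p, nat) fun_name \<Rightarrow> 'p formula" where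
  "in_E z x f = (in_Cantor z \<^bold>\<and>
     (\<^bold>\<exists>m. \<^bold>\<forall>n. ground (m \<le> n) \<^bold>\<longrightarrow> (\<^bold>\<exists>j. in_interval j f n \<^bold>\<and> (\<^bold>\<not> eq_at z x j))))"

text \<open>The canonical name for \<open>E\<^bsub>x,f\<^esub>\<close>.\<close>

definition E_name :: "'p forcing \<Rightarrow> 'p real_name \<Rightarrow> ('p, nat) fun_name \<Rightarrow> 'p set_name" where
  "E_name P x f = {(z, p). p \<in> conds P \<and> forces P p (in_E z x f)}"

section \<open>The partial order \<open>Q\<^sup>*\<close> and its rank function\<close>

text \<open>The poset \<open>Q\<close> is the whole of a type \<open>'a\<close> of class \<open>order\<close>, and
  \<open>Whole\<close> is the additional point \<open>Q\<close> of \<open>Q\<^sup>* = Q \<union> {Q}\<close>.\<close>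

datatype 'a ext = El 'a | Whole

instantiation ext :: (order) order
begin

fun less_eq_ext :: "'a ext \<Rightarrow> 'a ext \<Rightarrow> bool" where
  "less_eq_ext (El a) (El b) \<longleftrightarrow> a \<le> b"
| "less_eq_ext _ Whole \<longleftrightarrow> True"
| "less_eq_ext Whole (El b) \<longleftrightarrow> False"

definition less_ext :: "'a ext \<Rightarrow> 'a ext \<Rightarrow> bool" where
  "less_ext x y \<longleftrightarrow> x \<le> y \<and> \<not> y \<le> x"

instance
proof
  fix x y z :: "'a ext"
  show "x < y \<longleftrightarrow> x \<le> y \<and> \<not> y \<le> x" by (rule less_ext_def)
  show "x \<le> x" by (cases x) auto
  show "x \<le> y \<Longrightarrow> y \<le> z \<Longrightarrow> x \<le> z" by (cases x; cases y; cases z) auto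
  show "x \<le> y \<Longrightarrow> y \<le> x \<Longrightarrow> x = y" by (cases x; cases y) auto
qed

end

text \<open>Ordinals below an initial ordinal of cardinality greater than that of \<open>Q\<^sup>*\<close>;
  they suffice as values of the rank function, which is verified below.\<close>

typedef 'a ordi = "UNIV :: 'a ext set set" by simp

instantiation ordi :: (type) wellorder
begin

definition less_eq_ordi :: "'a ordi \<Rightarrow> 'a ordi \<Rightarrow> bool" where
  "less_eq_ordi \<alpha> \<beta> \<longleftrightarrow> (Rep_ordi \<alpha>, Rep_ordi \<beta>) \<in> card_of (UNIV :: 'a ext set set)"

definition less_ordi :: "'a ordi \<Rightarrow> 'a ordi \<Rightarrow> bool" where
  "less_ordi \<alpha> \<beta> \<longleftrightarrow> \<alpha> \<le> \<beta> \<and> \<alpha> \<noteq> \<beta>"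

instance
proof -
  let ?r = "card_of (UNIV :: 'a ext set set)"
  have wo: "well_order_on UNIV ?r" by (rule card_of_well_order_on)
  then have lin: "linear_order_on UNIV ?r" and wf: "wf (?r - Id)"
    by (auto simp: well_order_on_def)
  then have tot: "total ?r" and refl: "refl ?r" and trans: "trans ?r" and anti: "antisym ?r"
    by (auto simp: linear_order_on_def partial_order_on_def preorder_on_def)
  show "OFCLASS('a ordi, wellorder_class)"
  proof (intro_classes)
    fix x y z :: "'a ordi"
    show refl': "x \<le> x"
      using refl by (auto simp: less_eq_ordi_def refl_on_def)
    show "x \<le> y \<Longrightarrow> y \<le> z \<Longrightarrow> x \<le> z"
      using trans by (auto simp: less_eq_ordi_def elim: transE)
    show anti': "x \<le> y \<Longrightarrow> y \<le> x \<Longrightarrow> x = y"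
      using anti by (auto simp: less_eq_ordi_def Rep_ordi_inject dest: antisymD)
    show "x \<le> y \<or> y \<le> x"
      using tot refl by (cases "x = y")
        (auto simp: less_eq_ordi_def total_on_def refl_on_def Rep_ordi_inject)
    show "x < y \<longleftrightarrow> x \<le> y \<and> \<not> y \<le> x"
      using refl' anti' by (auto simp: less_ordi_def)
  next
    fix A :: "'a ordi \<Rightarrow> bool" and a
    assume step: "\<And>x. (\<And>y. y < x \<Longrightarrow> A y) \<Longrightarrow> A x"
    have "wf (inv_image (?r - Id) Rep_ordi)" using wf by (rule wf_inv_image)
    moreover have "inv_image (?r - Id) Rep_ordi = {(y, x). y < x}"
      by (auto simp: inv_image_def less_ordi_def less_eq_ordi_def Rep_ordi_inject)
    ultimately have "wf {(y, x :: 'a ordi). y < x}" by simp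
    then show "A a" by (rule wf_induct_rule) (use step in blast)
  qed
qed

end

definition Rstar :: "'a set \<Rightarrow> 'a ext set" where
  "Rstar R = insert Whole (El ` R)"

definition rankR :: "('a::order) set \<Rightarrow> 'a ext \<Rightarrow> 'a ordi" where
  "rankR R = wfrec {(y, x). y \<in> Rstar R \<and> x \<in> Rstar R \<and> y < x}
     (\<lambda>rk x. LEAST \<alpha>. \<forall>y\<in>Rstar R. y < x \<longrightarrow> rk y < \<alpha>)"

lemma wf_Rstar:
  fixes R :: "('a::order) set"
  assumes R: "wfp_on R (<)"
  shows "wf {(y, x). y \<in> Rstar R \<and> x \<in> Rstar R \<and> y < x}" (is "wf ?r")
  unfolding wf_def
proof (intro allI impI)
  fix A :: "'a ext \<Rightarrow> bool" and x
  assume step: "\<forall>x. (\<forall>y. (y, x) \<in> ?r \<longrightarrow> A y) \<longrightarrow> A x"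
  have El_less: "El b < El a \<longleftrightarrow> b < a" and Whole_less: "\<not> Whole < y" for a b :: 'a and y :: "'a ext"
    by (cases y) (auto simp: less_ext_def)
  have in_R: "A (El a)" if "a \<in> R" for a
  proof (induct rule: wfp_on_induct[OF R that])
    case (1 a)
    show ?case
    proof (rule step[rule_format])
      fix y assume "(y, El a) \<in> ?r"
      then show "A y"
        using 1 by (cases y) (auto simp: Rstar_def El_less Whole_less)
    qed
  qed
  have El: "A (El a)" for a
    using in_R step[rule_format, of "El a"] by (cases "a \<in> R") (auto simp: Rstar_def)
  have "A Whole"
  proof (rule step[rule_format])
    fix y assume "(y, Whole) \<in> ?r"
    then show "A y" using El by (cases y) (auto simp: Whole_less)
  qed
  with El show "A x" by (cases x) auto
qed

lemma rankR_eq: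
  fixes R :: "('a::order) set"
  assumes R: "wfp_on R (<)" and x: "x \<in> Rstar R"
  shows "rankR R x = (LEAST \<alpha>. \<forall>y\<in>Rstar R. y < x \<longrightarrow> rankR R y < \<alpha>)"
proof -
  let ?r = "{(y, x). y \<in> Rstar R \<and> x \<in> Rstar R \<and> y < x}"
  have "rankR R x = (LEAST \<alpha>. \<forall>y\<in>Rstar R. y < x \<longrightarrow> cut (rankR R) ?r x y < \<alpha>)"
    by (rule def_wfrec[OF rankR_def[THEN eq_reflection] wf_Rstar[OF R]])
  moreover have "(\<forall>y\<in>Rstar R. y < x \<longrightarrow> cut (rankR R) ?r x y < \<alpha>) \<longleftrightarrow>
      (\<forall>y\<in>Rstar R. y < x \<longrightarrow> rankR R y < \<alpha>)" for \<alpha>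
    using x by (auto simp: cut_def)
  ultimately show ?thesis by (simp only:)
qed

lemma rankR_less:
  fixes R :: "('a::order) set"
  assumes R: "wfp_on R (<)" and x: "x \<in> Rstar R" and y: "y \<in> Rstar R" "y < x"
  shows "rankR R y < rankR R x"
proof -
  let ?B = "\<lambda>x \<alpha>. \<forall>y\<in>Rstar R. y < x \<longrightarrow> rankR R y < \<alpha>"
  have initial: "x \<in> Rstar R \<longrightarrow> (\<forall>\<alpha><rankR R x. \<alpha> \<in> range (rankR R))" for x
  proof (induction x rule: wf_induct_rule[OF wf_Rstar[OF R]])
    case (1 x)
    show ?case
    proof (intro impI allI)
      fix \<alpha> assume x: "x \<in> Rstar R" and "\<alpha> < rankR R x"
      then have "\<alpha> < (LEAST \<alpha>. ?B x \<alpha>)" by (simp only: rankR_eq[OF R x])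
      then have "\<not> ?B x \<alpha>" by (rule not_less_Least)
      then obtain y where y: "y \<in> Rstar R" "y < x" "\<alpha> \<le> rankR R y"
        by (meson not_less)
      show "\<alpha> \<in> range (rankR R)"
      proof (cases "\<alpha> = rankR R y")
        case False
        with y have "\<alpha> < rankR R y" by simp
        with 1[of y] x y show ?thesis by blast
      qed simp
    qed
  qed
  have "\<exists>\<alpha>. \<alpha> \<notin> range (rankR R)"
  proof (rule ccontr)
    assume "\<nexists>\<alpha>. \<alpha> \<notin> range (rankR R)"
    then have "surj (rankR R)" by blast
    moreover have "surj (Rep_ordi :: 'a ordi \<Rightarrow> _)"
      by (metis Abs_ordi_inverse UNIV_I surjI)
    ultimately have "surj (Rep_ordi \<circ> rankR R)" by (rule comp_surj)
    then show False using Cantors_theorem[of "UNIV :: 'a ext set"] by auto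
  qed
  then obtain \<alpha> where \<alpha>: "\<alpha> \<notin> range (rankR R)" by blast
  have "?B x \<alpha>"
  proof (intro ballI impI)
    fix y assume "y \<in> Rstar R"
    with initial[of y] \<alpha> have "\<not> \<alpha> < rankR R y" by blast
    moreover have "\<alpha> \<noteq> rankR R y" using \<alpha> by blast
    ultimately show "rankR R y < \<alpha>" by simp
  qed
  then have "?B x (LEAST \<alpha>. ?B x \<alpha>)" by (rule LeastI)
  then have "rankR R y < (LEAST \<alpha>. ?B x \<alpha>)" using y by blast
  then show ?thesis by (simp only: rankR_eq[OF R x, symmetric])
qed

definition rank :: "('a::order) set \<Rightarrow> 'a ext \<Rightarrow> 'a ordi" where
  "rank R x = (if x \<in> Rstar R then rankR R x
     else (LEAST \<alpha>. \<alpha> \<in> rankR R ` {y\<in>Rstar R. x < y}))"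

definition ll :: "('a::order) set \<Rightarrow> 'a ext \<Rightarrow> 'a ext \<Rightarrow> bool" where
  "ll R x y \<longleftrightarrow> x < y \<and> rank R x < rank R y"

definition Qbelow :: "('a::order) set \<Rightarrow> 'a ext \<Rightarrow> 'a set" where
  "Qbelow R x = {y. ll R (El y) x}"

definition ranks :: "('a::order) set \<Rightarrow> 'a set \<Rightarrow> 'a ordi set" where
  "ranks R F = (\<lambda>b. rank R (El b)) ` F"

section \<open>The forcing notions \<open>P\<^sub>a\<close>\<close>

text \<open>A condition consists of the finite partial functions \<open>\<alpha> \<mapsto> s\<^sub>\<alpha>\<close> and \<open>b \<mapsto> (t\<^sub>b, f\<^sub>b)\<close>.
  All names for a real form a proper class, so conditions need a set of representatives:
  \<open>f\<^sub>b\<close> is a name for a subset of \<open>\<omega> \<times> \<omega>\<close> with elements of the form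
  (condition, check name of a pair), whose (nonempty) set of elements is enumerated by an
  index type \<open>'i\<close>.  For infinite \<open>'i\<close> and ccc forcing, every name for an element of \<open>\<omega>\<^sup>\<omega>\<close> is
  forced to be equal to such a name.  Without a bound on its size a name could not be a
  constituent of a condition, for reasons of cardinality.

  The conditions of \<open>P\<^sub>b * \<C>\<close> are the pairs \<open>(p, s)\<close> with \<open>s\<close> in the ground-model poset \<open>\<C>\<close>
  (check names in the second coordinate).\<close>

datatype ('a, 'i) cond = Cond
  (side: "'a ordi \<rightharpoonup> bool list")
  (main: "'a \<rightharpoonup> nat list \<times> ('i \<Rightarrow> (('a, 'i) cond \<times> bool list) \<times> nat \<times> nat)")

definition supp :: "('a, 'i) cond \<Rightarrow> 'a set" where
  "supp p = dom (main p)"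

definition s_part :: "('a, 'i) cond \<Rightarrow> 'a ordi \<Rightarrow> bool list" where
  "s_part p \<alpha> = the (side p \<alpha>)"

definition t_part :: "('a, 'i) cond \<Rightarrow> 'a \<Rightarrow> nat list" where
  "t_part p b = fst (the (main p b))"

definition f_part :: "('a, 'i) cond \<Rightarrow> 'a \<Rightarrow> (('a, 'i) cond \<times> bool list, nat) fun_name" where
  "f_part p b = range (snd (the (main p b)))"

definition restr :: "('a::order) set \<Rightarrow> ('a, 'i) cond \<Rightarrow> 'a ext \<Rightarrow> ('a, 'i) cond" where
  "restr R p x = (let F = supp p \<inter> Qbelow R x in Cond (side p |` ranks R F) (main p |` F))"

definition with_Cohen :: "'p forcing \<Rightarrow> ('p \<times> bool list) forcing" where
  "with_Cohen P =
     \<lparr>conds = conds P \<times> UNIV, leq = (\<lambda>(p, s) (q, t). leq P p q \<and> prefix t s)\<rparr>"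

definition incr_name :: "'p forcing \<Rightarrow> ('p, nat) fun_name \<Rightarrow> bool" where
  "incr_name P f \<longleftrightarrow> fst ` f \<subseteq> conds P \<and> forced P (in_incr f)"

text \<open>\<open>stage R x B\<close> is \<open>P\<^sub>x\<close>, given \<open>B b = P\<^sub>b\<close> for \<open>b \<in> Q\<^sub>x\<close>.  In clauses (3b) and (4), intervals
  \<open>[t(n-1), t(n))\<close> are
  considered for \<open>n \<ge> 1\<close> only, where both end points exist.  (Reading \<open>t(-1)\<close> as 0 would produce the
  empty interval \<open>[0, t(0))\<close> for \<open>t(0) = 0\<close> and trivialize (4).)\<close>

definition stage_conds ::
  "('a::order) set \<Rightarrow> 'a ext \<Rightarrow> ('a \<Rightarrow> ('a, 'i) cond forcing) \<Rightarrow> ('a, 'i) cond set" where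
  "stage_conds R x B = {p. finite (supp p) \<and> supp p \<subseteq> Qbelow R x \<and> dom (side p) = ranks R (supp p) \<and>
     (\<forall>b\<in>supp p. sorted_wrt (<) (t_part p b) \<and> incr_name (with_Cohen (B b)) (f_part p b))}"

definition stage_leq ::
  "('a::order) set \<Rightarrow> ('a \<Rightarrow> ('a, 'i) cond forcing) \<Rightarrow> ('a, 'i) cond \<Rightarrow> ('a, 'i) cond \<Rightarrow> bool" where
  "stage_leq R B p q \<longleftrightarrow>
     supp q \<subseteq> supp p \<and>
     (\<forall>\<alpha>\<in>ranks R (supp q). prefix (s_part q \<alpha>) (s_part p \<alpha>)) \<and>
     (\<forall>b\<in>supp q. prefix (t_part q b) (t_part p b) \<and>
        forces (with_Cohen (B b)) (restr R p (El b), s_part p (rank R (El b)))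
          ((\<^bold>\<forall>n. \<^bold>\<exists>k. \<^bold>\<forall>j. in_interval j (f_part q b) k \<^bold>\<longrightarrow> in_interval j (f_part p b) n) \<^bold>\<and>
           (\<^bold>\<forall>n. ground (1 \<le> n \<and> length (t_part q b) \<le> n \<and> n < length (t_part p b)) \<^bold>\<longrightarrow>
             (\<^bold>\<exists>k. \<^bold>\<forall>j. in_interval j (f_part q b) k \<^bold>\<longrightarrow>
                ground (t_part p b ! (n - 1) \<le> j \<and> j < t_part p b ! n))))) \<and>
     (\<forall>b\<in>supp q. \<forall>c\<in>supp q. b < c \<and> rank R (El b) = rank R (El c) \<longrightarrow>
        (\<forall>n. 1 \<le> n \<and> length (t_part q c) \<le> n \<and> n < length (t_part p c) \<longrightarrow>
          (\<exists>k. 1 \<le> k \<and> k < length (t_part p b) \<and>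
             {t_part p b ! (k - 1)..<t_part p b ! k} \<subseteq> {t_part p c ! (n - 1)..<t_part p c ! n})))"

definition stage ::
  "('a::order) set \<Rightarrow> 'a ext \<Rightarrow> ('a \<Rightarrow> ('a, 'i) cond forcing) \<Rightarrow> ('a, 'i) cond forcing" where
  "stage R x B = \<lparr>conds = stage_conds R x B, leq = stage_leq R B\<rparr>"

function \<P> :: "('a::order) set \<Rightarrow> 'a ext \<Rightarrow> ('a, 'i) cond forcing" where
  "\<P> R x = stage R x (\<lambda>b. if b \<in> Qbelow R x then \<P> R (El b) else undefined)"
  by pat_completeness auto
termination
  by (relation "inv_image {(\<alpha>, \<beta>). \<alpha> < \<beta>} (\<lambda>(R, x). rank R x)")
    (auto simp: wf Qbelow_def ll_def)

declare \<P>.simps [simp del]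

section \<open>The generic objects\<close>

definition c_name :: "('a::order) set \<Rightarrow> ('a, 'i) cond forcing \<Rightarrow> 'a ordi \<Rightarrow> ('a, 'i) cond real_name" where
  "c_name R P \<alpha> = {(p, n, i). p \<in> conds P \<and> \<alpha> \<in> ranks R (supp p) \<and>
     n < length (s_part p \<alpha>) \<and> i = s_part p \<alpha> ! n}"

definition d_name :: "('a, 'i) cond forcing \<Rightarrow> 'a \<Rightarrow> (('a, 'i) cond, nat) fun_name" where
  "d_name P a = {(p, n, k). p \<in> conds P \<and> a \<in> supp p \<and>
     n < length (t_part p a) \<and> k = t_part p a ! n}"

definition E_gen :: "('a::order) set \<Rightarrow> ('a, 'i) cond forcing \<Rightarrow> 'a \<Rightarrow> ('a, 'i) cond set_name" where
  "E_gen R P a = E_name P (c_name R P (rank R (El a))) (d_name P a)"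

end

(*
Forcing statements about countably many reals are evaluated along sufficiently generic descending
sequences of conditions: a regular formula is forced by p iff it is true along all sequences that
pass below p and meet countably many suitable dense sets.  This reduces the forcing arguments to
facts about actual reals, and, under ccc, every real that is definable along generic sequences
has a countable name.

P_x is ccc because two conditions that agree as finite functions (in the s- and t-parts) can be
amalgamated, the names f_b being merged into a slower one.  For b << x a generic sequence of P_x
projects to one of P_b * C, so c_b is Cohen over the extension by P_b, and d_b dominates all
interval partitions of the extension by P_b * C.  If a real (x, f) has a name in P_b, the Cohen real
c_b agrees with x on infinitely many intervals of f; grouping the intervals of f so that each
group contains such an interval gives a partition dominated by d_b, whence E_{x,f} is included in
E_b.  A meager set is included in some E_{x,f}, whose countable name involves countably many
elements of Q, so it is bounded in Q.  If a is not below b, then t_b can be prolonged by two values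
beyond the end of t_a, and then t_a by a still larger one, so infinitely many intervals of d_b
contain no interval of d_a; a real equal to c_b on a sparse set of these intervals and to the
complement of c_a elsewhere lies in E_a but not in E_b.
*)

theory Submission
  imports Defs
begin

text \<open>Evaluation along sequences covers connectives and quantifiers over countable types.
  Quantifiers over names and over sets of reals are not of this kind; for them the forcing clauses
  are unfolded by hand. The main obstacle is that a condition contains names, which must have
  bounded size. Every new name has to be cut down to a countable one, and this needs ccc of
  \<open>P_b * C\<close>. So ccc is proved by induction on the rank, and the amalgamation behind it
  already uses ccc at smaller ranks. Two features of the order shape the extension lemmas. Elements
  of \<open>Q\<close> of equal rank share one Cohen real, so a rank may occur in a condition only
  outside \<open>Q_b\<close> although \<open>Q_b\<close> has elements of that rank; it must be
  realized inside \<open>Q_b\<close> before anything is grafted there. And a new interval of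
  \<open>t_c\<close> must contain intervals of \<open>t_b\<close> for all \<open>b < c\<close> of
  the same rank in the support, so a single sequence cannot be prolonged on its own.\<close>

definition dense_in :: "'p forcing \<Rightarrow> 'p set \<Rightarrow> bool" where
  "dense_in P D \<longleftrightarrow> (\<forall>p\<in>conds P. \<exists>q\<in>conds P. leq P q p \<and> q \<in> D)"

definition descending :: "'p forcing \<Rightarrow> (nat \<Rightarrow> 'p) \<Rightarrow> bool" where
  "descending P G \<longleftrightarrow> (\<forall>i. G i \<in> conds P \<and> leq P (G (Suc i)) (G i))"

text \<open>Generic filters are replaced by descending sequences: \<open>eventually \<Psi> (gen P)\<close> means that
  \<open>\<Psi>\<close> holds along all descending sequences that meet countably many suitable dense sets.\<close>

definition gen :: "'p forcing \<Rightarrow> (nat \<Rightarrow> 'p) filter" where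
  "gen P = Abs_filter (\<lambda>\<Psi>. \<exists>\<D>. countable \<D> \<and> (\<forall>D\<in>\<D>. dense_in P D) \<and>
     (\<forall>G. descending P G \<and> (\<forall>D\<in>\<D>. \<exists>i. G i \<in> D) \<longrightarrow> \<Psi> G))"

definition met :: "'p forcing \<Rightarrow> (nat \<Rightarrow> 'p) \<Rightarrow> 'p \<Rightarrow> bool" where
  "met P G p \<longleftrightarrow> (\<exists>i. leq P (G i) p)"

definition holds :: "'p forcing \<Rightarrow> (nat \<Rightarrow> 'p) \<Rightarrow> 'p formula \<Rightarrow> bool" where
  "holds P G \<phi> \<longleftrightarrow> (\<exists>i. \<phi> P (G i))"

text \<open>The conditions with \<open>\<phi>\<close> form a regular open set. Downward closure is
  included, since density below \<open>p\<close> is inherited by all stronger conditions.\<close>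

definition regular :: "'p forcing \<Rightarrow> 'p formula \<Rightarrow> bool" where
  "regular P \<phi> \<longleftrightarrow> (\<forall>p\<in>conds P. \<phi> P p \<longleftrightarrow> dense_below (\<phi> P) P p)"

text \<open>The truth lemma as a property of a pair: \<open>\<phi>\<close> is the statement as
  forced, \<open>\<Psi>\<close> its actual truth value along a sequence. It is established for one
  connective after another.\<close>

definition repr :: "'p forcing \<Rightarrow> 'p formula \<Rightarrow> ((nat \<Rightarrow> 'p) \<Rightarrow> bool) \<Rightarrow> bool" where
  "repr P \<phi> \<Psi> \<longleftrightarrow> regular P \<phi> \<and> (\<forall>\<^sub>F G in gen P. holds P G \<phi> \<longleftrightarrow> \<Psi> G)"

text \<open>A counterpart of the property of Baire. Its closure under countable operations is what allows
  names to be given by recursive definitions in HOL, see \<open>name_exists\<close>.\<close>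

definition bp :: "'p forcing \<Rightarrow> ((nat \<Rightarrow> 'p) \<Rightarrow> bool) \<Rightarrow> bool" where
  "bp P \<Psi> \<longleftrightarrow> (\<exists>\<phi>. repr P \<phi> \<Psi>)"

definition meas :: "'p forcing \<Rightarrow> ((nat \<Rightarrow> 'p) \<Rightarrow> 'v) \<Rightarrow> bool" where
  "meas P V \<longleftrightarrow> (\<forall>v. bp P (\<lambda>G. V G = v))"

definition ev :: "'p forcing \<Rightarrow> (nat \<Rightarrow> 'p) \<Rightarrow> ('p, 'v) fun_name \<Rightarrow> nat \<Rightarrow> 'v \<Rightarrow> bool" where
  "ev P G \<tau> n v \<longleftrightarrow> (\<exists>i. \<exists>q\<in>conds P. (q, n, v) \<in> \<tau> \<and> leq P (G i) q)"

definition total_name :: "'p forcing \<Rightarrow> (nat \<Rightarrow> 'p) \<Rightarrow> ('p, 'v) fun_name \<Rightarrow> bool" where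
  "total_name P G \<tau> \<longleftrightarrow> (\<forall>n. \<exists>!v. ev P G \<tau> n v)"

definition fn :: "'p forcing \<Rightarrow> (nat \<Rightarrow> 'p) \<Rightarrow> ('p, 'v) fun_name \<Rightarrow> nat \<Rightarrow> 'v" where
  "fn P G \<tau> n = (THE v. ev P G \<tau> n v)"

lemma fn_iff: "total_name P G \<tau> \<Longrightarrow> ev P G \<tau> n v \<longleftrightarrow> fn P G \<tau> n = v"
  unfolding total_name_def fn_def by (metis theI)

lemma fn_eqI: "(\<And>v. ev P G \<tau> n v \<longleftrightarrow> V n = v) \<Longrightarrow> fn P G \<tau> n = V n"
  unfolding fn_def by (rule the_equality) auto

section \<open>The filter of generic sequences\<close>

lemma eventually_gen: "eventually \<Psi> (gen P) \<longleftrightarrow> (\<exists>\<D>. countable \<D> \<and> (\<forall>D\<in>\<D>. dense_in P D) \<and>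
     (\<forall>G. descending P G \<and> (\<forall>D\<in>\<D>. \<exists>i. G i \<in> D) \<longrightarrow> \<Psi> G))"
  unfolding gen_def
proof (rule eventually_Abs_filter, rule is_filter.intro, goal_cases)
  case 1
  show ?case by (rule exI[of _ "{}"]) auto
next
  case (2 \<Phi> \<Psi>)
  from 2(1) obtain A where A: "countable A" "\<forall>D\<in>A. dense_in P D"
      "\<forall>G. descending P G \<and> (\<forall>D\<in>A. \<exists>i. G i \<in> D) \<longrightarrow> \<Phi> G" by (elim exE conjE)
  from 2(2) obtain B where B: "countable B" "\<forall>D\<in>B. dense_in P D"
      "\<forall>G. descending P G \<and> (\<forall>D\<in>B. \<exists>i. G i \<in> D) \<longrightarrow> \<Psi> G" by (elim exE conjE)
  show ?case
    by (rule exI[of _ "A \<union> B"]) (simp add: A B ball_Un)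
next
  case (3 \<Phi> \<Psi>)
  from 3(2) obtain A where "countable A" "\<forall>D\<in>A. dense_in P D"
      "\<forall>G. descending P G \<and> (\<forall>D\<in>A. \<exists>i. G i \<in> D) \<longrightarrow> \<Phi> G" by (elim exE conjE)
  then show ?case using 3(1) by (intro exI[of _ A]) simp
qed

lemma eventually_descending: "eventually (descending P) (gen P)"
  unfolding eventually_gen by (rule exI[of _ "{}"]) auto

lemma eventually_dense: "dense_in P D \<Longrightarrow> \<forall>\<^sub>F G in gen P. \<exists>i. G i \<in> D"
  unfolding eventually_gen by (rule exI[of _ "{D}"]) auto

text \<open>Countably many countable families of dense sets form one countable family. This closure
  is what admits quantifiers over countable types later.\<close>

lemma eventually_gen_ball:
  assumes "countable X" and "\<And>x. x \<in> X \<Longrightarrow> eventually (\<Psi> x) (gen P)"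
  shows "\<forall>\<^sub>F G in gen P. \<forall>x\<in>X. \<Psi> x G"
proof -
  have "\<forall>x\<in>X. \<exists>\<D>. countable \<D> \<and> (\<forall>D\<in>\<D>. dense_in P D) \<and>
     (\<forall>G. descending P G \<and> (\<forall>D\<in>\<D>. \<exists>i. G i \<in> D) \<longrightarrow> \<Psi> x G)"
    using assms(2) unfolding eventually_gen by blast
  then obtain \<D> where "\<forall>x\<in>X. countable (\<D> x) \<and> (\<forall>D\<in>\<D> x. dense_in P D) \<and>
     (\<forall>G. descending P G \<and> (\<forall>D\<in>\<D> x. \<exists>i. G i \<in> D) \<longrightarrow> \<Psi> x G)"
    using bchoice[of X "\<lambda>x \<D>. countable \<D> \<and> (\<forall>D\<in>\<D>. dense_in P D) \<and> (\<forall>G. descending P G \<and> (\<forall>D\<in>\<D>. \<exists>i. G i \<in> D) \<longrightarrow> \<Psi> x G)"] by blast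
  note \<D> = this
  show ?thesis
    unfolding eventually_gen
  proof (intro exI[of _ "\<Union>x\<in>X. \<D> x"] conjI allI impI ballI)
    fix G x assume "descending P G \<and> (\<forall>D\<in>\<Union>x\<in>X. \<D> x. \<exists>i. G i \<in> D)" "x \<in> X"
    then show "\<Psi> x G" using \<D> by (metis UN_I)
  qed (use \<D> assms(1) in auto)
qed

lemma eventually_gen_all:
  fixes \<Psi> :: "'c::countable \<Rightarrow> _"
  assumes "\<And>x. eventually (\<Psi> x) (gen P)"
  shows "\<forall>\<^sub>F G in gen P. \<forall>x. \<Psi> x G"
  using eventually_gen_ball[of "UNIV :: 'c set" \<Psi> P] assms by simp

text \<open>A monotone map that pulls dense sets back to dense sets carries generic sequences to
  generic sequences; it acts as a projection of forcing notions.\<close>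

lemma eventually_gen_proj:
  assumes "eventually \<Psi> (gen P')"
    and "\<And>p. p \<in> conds P \<Longrightarrow> \<pi> p \<in> conds P'"
    and "\<And>p q. p \<in> conds P \<Longrightarrow> q \<in> conds P \<Longrightarrow> leq P p q \<Longrightarrow> leq P' (\<pi> p) (\<pi> q)"
    and "\<And>D. dense_in P' D \<Longrightarrow> dense_in P {p. \<pi> p \<in> D}"
  shows "\<forall>\<^sub>F G in gen P. \<Psi> (\<pi> \<circ> G)"
proof -
  obtain \<D> where \<D>: "countable \<D>" "\<forall>D\<in>\<D>. dense_in P' D"
     "\<forall>G. descending P' G \<and> (\<forall>D\<in>\<D>. \<exists>i. G i \<in> D) \<longrightarrow> \<Psi> G"
    using assms(1) unfolding eventually_gen by (elim exE conjE)
  show ?thesis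
    unfolding eventually_gen
  proof (intro exI[of _ "(\<lambda>D. {p. \<pi> p \<in> D}) ` \<D>"] conjI allI impI)
    fix G assume *: "descending P G \<and> (\<forall>D\<in>(\<lambda>D. {p. \<pi> p \<in> D}) ` \<D>. \<exists>i. G i \<in> D)"
    show "\<Psi> (\<pi> \<circ> G)"
    proof (rule \<D>(3)[rule_format], intro conjI)
      show "descending P' (\<pi> \<circ> G)" using * assms(2,3) by (auto simp: descending_def)
      show "\<forall>D\<in>\<D>. \<exists>i. (\<pi> \<circ> G) i \<in> D" using * by auto
    qed
  qed (use \<D> assms(4) in auto)
qed

section \<open>Sequences meeting countably many dense sets\<close>

context
  fixes P :: "'p forcing"
  assumes P: "forcing_notion P"
begin

lemma leq_refl: "p \<in> conds P \<Longrightarrow> leq P p p"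
  using P by (auto simp: forcing_notion_def reflp_on_def)

lemma leq_trans: "leq P p q \<Longrightarrow> leq P q r \<Longrightarrow> p \<in> conds P \<Longrightarrow> q \<in> conds P \<Longrightarrow> r \<in> conds P \<Longrightarrow> leq P p r"
  using P unfolding forcing_notion_def transp_on_def by blast

lemma descending_le:
  assumes "descending P G" "i \<le> j" shows "leq P (G j) (G i)"
  using assms(2)
proof (induction rule: dec_induct)
  case base
  then show ?case using assms(1) leq_refl by (auto simp: descending_def)
next
  case (step n)
  then show ?case using assms(1) leq_trans unfolding descending_def by blast
qed

lemma met_common:
  assumes G: "descending P G" and "met P G p" "met P G q" "p \<in> conds P" "q \<in> conds P"
  obtains i where "\<And>j. i \<le> j \<Longrightarrow> leq P (G j) p \<and> leq P (G j) q"
proof -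
  obtain a b where ab: "leq P (G a) p" "leq P (G b) q" using assms by (auto simp: met_def)
  have "leq P (G j) p \<and> leq P (G j) q" if "max a b \<le> j" for j
    using leq_trans[OF descending_le[OF G, of a j] ab(1)] leq_trans[OF descending_le[OF G, of b j] ab(2)]
      that G assms by (auto simp: descending_def)
  then show ?thesis by (rule that)
qed

lemma met_self: "descending P G \<Longrightarrow> met P G (G i)"
  unfolding met_def by (rule exI[of _ i]) (auto simp: descending_def leq_refl)

text \<open>Rasiowa-Sikorski: the dense sets are enumerated, and step \<open>n\<close> enters the
  \<open>n\<close>-th one.\<close>

lemma generic_exists:
  assumes "p \<in> conds P" "eventually \<Psi> (gen P)"
  shows "\<exists>G. descending P G \<and> G 0 = p \<and> \<Psi> G"
proof -
  obtain \<D> where \<D>: "countable \<D>" "\<forall>D\<in>\<D>. dense_in P D"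
     "\<forall>G. descending P G \<and> (\<forall>D\<in>\<D>. \<exists>i. G i \<in> D) \<longrightarrow> \<Psi> G"
    using assms(2) unfolding eventually_gen by (elim exE conjE)
  \<comment> \<open>\<open>from_nat_into\<close> enumerates nonempty sets only, hence the proviso
    \<open>\<D> \<noteq> {}\<close>.\<close>
  have nxt: "\<exists>y. y \<in> conds P \<and> leq P y x \<and> (\<D> \<noteq> {} \<longrightarrow> y \<in> from_nat_into \<D> n)" if x: "x \<in> conds P" for x n
  proof (cases "\<D> = {}")
    case True
    then show ?thesis using that leq_refl[OF that] by (intro exI[of _ x]) simp
  next
    case False
    then have "dense_in P (from_nat_into \<D> n)" using \<D>(2) from_nat_into[OF False] by simp
    then obtain y where "y \<in> conds P" "leq P y x" "y \<in> from_nat_into \<D> n"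
      using x by (auto simp: dense_in_def)
    then show ?thesis by (intro exI[of _ y]) simp
  qed
  define nx where "nx x n = (SOME y. y \<in> conds P \<and> leq P y x \<and> (\<D> \<noteq> {} \<longrightarrow> y \<in> from_nat_into \<D> n))" for x n
  have nx: "nx x n \<in> conds P \<and> leq P (nx x n) x \<and> (\<D> \<noteq> {} \<longrightarrow> nx x n \<in> from_nat_into \<D> n)"
    if "x \<in> conds P" for x n
    unfolding nx_def by (rule someI_ex) (rule nxt[OF that])
  define G where "G = rec_nat p (\<lambda>n x. nx x n)"
  have G_simps: "G 0 = p" "G (Suc n) = nx (G n) n" for n by (simp_all add: G_def)
  have c: "G n \<in> conds P" for n
    by (induction n) (simp_all add: G_simps assms(1) nx)
  then have G: "G 0 = p" "\<And>n. leq P (G (Suc n)) (G n)"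
      "\<And>n. \<D> \<noteq> {} \<Longrightarrow> G (Suc n) \<in> from_nat_into \<D> n"
    by (simp_all add: G_simps nx)
  have "\<forall>D\<in>\<D>. \<exists>i. G i \<in> D"
  proof
    fix D assume "D \<in> \<D>"
    then have "\<D> \<noteq> {}" by blast
    moreover obtain n where "from_nat_into \<D> n = D" using from_nat_into_surj[OF \<D>(1) \<open>D \<in> \<D>\<close>] ..
    ultimately have "G (Suc n) \<in> D" using G(3)[of n] by simp
    then show "\<exists>i. G i \<in> D" ..
  qed
  then have "\<Psi> G" using G c by (intro \<D>(3)[rule_format] conjI) (simp_all add: descending_def)
  then show ?thesis using G c by (intro exI[of _ G]) (simp add: descending_def)
qed

lemma generic_below:
  assumes "p \<in> conds P" "\<forall>\<^sub>F G in gen P. met P G p \<longrightarrow> \<Psi> G"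
  shows "\<exists>G. descending P G \<and> G 0 = p \<and> \<Psi> G"
  using generic_exists[OF assms] met_self by metis

lemma dense_inI:
  assumes "\<And>p. p \<in> conds P \<Longrightarrow> \<exists>q\<in>conds P. leq P q p \<and> q \<in> D" shows "dense_in P D"
  using assms by (auto simp: dense_in_def)

text \<open>Together with the conditions incompatible with \<open>p\<close>, the set
  \<open>D\<close> is dense everywhere, and a sequence that passes below \<open>p\<close> cannot
  enter the added part.\<close>

lemma eventually_dense_below:
  assumes p: "p \<in> conds P"
    and D: "\<And>q. q \<in> conds P \<Longrightarrow> leq P q p \<Longrightarrow> \<exists>r\<in>conds P. leq P r q \<and> r \<in> D"
  shows "\<forall>\<^sub>F G in gen P. met P G p \<longrightarrow> (\<exists>i. G i \<in> D)"
proof -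
  let ?D = "D \<union> {q. \<not> compat P q p}"
  have "dense_in P ?D"
  proof (rule dense_inI)
    fix q assume q: "q \<in> conds P"
    show "\<exists>r\<in>conds P. leq P r q \<and> r \<in> ?D"
    proof (cases "compat P q p")
      case True
      then obtain r where "r \<in> conds P" "leq P r q" "leq P r p" by (auto simp: compat_def)
      then show ?thesis using D[of r] q leq_trans by blast
    qed (use q leq_refl in auto)
  qed
  from eventually_dense[OF this] eventually_descending show ?thesis
  proof eventually_elim
    case (elim G)
    show ?case
    proof
      assume m: "met P G p"
      obtain i where i: "G i \<in> ?D" using elim by blast
      have "G i \<in> conds P" using elim by (auto simp: descending_def)
      then have "compat P (G i) p"
        using met_common[OF elim(2) m met_self[OF elim(2), of i]] p elim(2)
        unfolding compat_def descending_def by (metis le_refl)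
      then show "\<exists>i. G i \<in> D" using i by auto
    qed
  qed
qed

section \<open>Regular formulas and the truth lemma\<close>

lemma regular_mono: "regular P \<phi> \<Longrightarrow> \<phi> P p \<Longrightarrow> leq P q p \<Longrightarrow> p \<in> conds P \<Longrightarrow> q \<in> conds P \<Longrightarrow> \<phi> P q"
  unfolding regular_def dense_below_def using leq_trans by blast

lemma regularI:
  assumes "\<And>p q. p \<in> conds P \<Longrightarrow> q \<in> conds P \<Longrightarrow> leq P q p \<Longrightarrow> \<phi> P p \<Longrightarrow> \<phi> P q"
    and "\<And>p. p \<in> conds P \<Longrightarrow> dense_below (\<phi> P) P p \<Longrightarrow> \<phi> P p"
  shows "regular P \<phi>"
  unfolding regular_def using assms leq_refl unfolding dense_below_def by metis

lemma regular_dense_below: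
  "(\<And>p. p \<in> conds P \<Longrightarrow> \<phi> P p \<longleftrightarrow> dense_below D P p) \<Longrightarrow> regular P \<phi>"
proof (rule regularI, goal_cases)
  case (1 p q)
  show ?case unfolding 1(1)[OF 1(3)] dense_below_def
  proof (intro ballI impI)
    fix r assume r: "r \<in> conds P" "leq P r q"
    have "leq P r p" by (rule leq_trans[OF r(2) 1(4) r(1) 1(3) 1(2)])
    then show "\<exists>s\<in>conds P. leq P s r \<and> D s" using r(1) 1(5) 1(1)[OF 1(2)] by (simp add: dense_below_def)
  qed
next
  case (2 p)
  show ?case unfolding 2(1)[OF 2(2)] dense_below_def
  proof (intro ballI impI)
    fix q assume q: "q \<in> conds P" "leq P q p"
    then obtain r where r: "r \<in> conds P" "leq P r q" "\<phi> P r" using 2(3) by (auto simp: dense_below_def)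
    then obtain s where s: "s \<in> conds P" "leq P s r" "D s"
      using 2(1)[OF r(1)] leq_refl[OF r(1)] by (auto simp: dense_below_def)
    then show "\<exists>s\<in>conds P. leq P s q \<and> D s" using leq_trans[OF s(2) r(2) s(1) r(1) q(1)] by blast
  qed
qed

lemma holds_common:
  assumes "descending P G" "regular P \<phi>" "regular P \<psi>" "holds P G \<phi>" "holds P G \<psi>"
  obtains i where "\<phi> P (G i)" "\<psi> P (G i)"
proof -
  obtain a b where ab: "\<phi> P (G a)" "\<psi> P (G b)" using assms by (auto simp: holds_def)
  have c: "G i \<in> conds P" for i using assms by (auto simp: descending_def)
  show ?thesis
    using that[of "max a b"] regular_mono[OF assms(2) ab(1) descending_le[OF assms(1), of a "max a b"]]
      regular_mono[OF assms(3) ab(2) descending_le[OF assms(1), of b "max a b"]] c by auto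
qed

lemma holds_met:
  assumes "descending P G" "regular P \<phi>" "met P G p" "p \<in> conds P" "\<phi> P p"
  shows "holds P G \<phi>"
  using assms regular_mono[OF assms(2,5)] unfolding met_def holds_def descending_def by blast

text \<open>If \<open>\<phi>\<close> fails at \<open>p\<close>, regularity yields an extension
  \<open>q\<close> below which \<open>\<phi>\<close> never holds. A generic sequence starting at
  \<open>q\<close> passes below \<open>p\<close>, so \<open>\<Psi>\<close> is true along it and some
  member satisfies \<open>\<phi>\<close>, a contradiction.\<close>

lemma repr_forces:
  assumes "repr P \<phi> \<Psi>" "p \<in> conds P"
  shows "\<phi> P p \<longleftrightarrow> (\<forall>\<^sub>F G in gen P. met P G p \<longrightarrow> \<Psi> G)"
proof
  have reg: "regular P \<phi>" and ae: "\<forall>\<^sub>F G in gen P. holds P G \<phi> \<longleftrightarrow> \<Psi> G"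
    using assms by (auto simp: repr_def)
  show "\<forall>\<^sub>F G in gen P. met P G p \<longrightarrow> \<Psi> G" if "\<phi> P p"
    using ae eventually_descending
    by eventually_elim (use holds_met[OF _ reg _ assms(2) that] in auto)
  assume *: "\<forall>\<^sub>F G in gen P. met P G p \<longrightarrow> \<Psi> G"
  show "\<phi> P p"
  proof (rule ccontr)
    assume "\<not> \<phi> P p"
    then have "\<not> dense_below (\<phi> P) P p" using bspec[OF reg[unfolded regular_def] assms(2)] by blast
    then obtain q where q: "q \<in> conds P" "leq P q p" "\<And>r. r \<in> conds P \<Longrightarrow> leq P r q \<Longrightarrow> \<not> \<phi> P r"
      by (auto simp: dense_below_def)
    obtain G where G: "descending P G" "G 0 = q" "met P G p \<longrightarrow> \<Psi> G" "holds P G \<phi> \<longleftrightarrow> \<Psi> G"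
      using generic_exists[OF q(1) eventually_conj[OF * ae]] by blast
    then have "holds P G \<phi>" using q(2) by (auto simp: met_def)
    then obtain i where "\<phi> P (G i)" by (auto simp: holds_def)
    then show False using q(3)[of "G i"] G descending_le[OF G(1), of 0 i] by (auto simp: descending_def)
  qed
qed

lemma repr_forced: "repr P \<phi> \<Psi> \<Longrightarrow> forced P \<phi> \<longleftrightarrow> (\<forall>\<^sub>F G in gen P. \<Psi> G)"
proof
  assume r: "repr P \<phi> \<Psi>"
  show "forced P \<phi>" if "\<forall>\<^sub>F G in gen P. \<Psi> G"
    using that repr_forces[OF r] unfolding forced_def forces_def by (auto elim: eventually_mono)
  assume "forced P \<phi>"
  then have "\<forall>p\<in>conds P. \<phi> P p" by (auto simp: forced_def forces_def)
  moreover have "\<forall>\<^sub>F G in gen P. holds P G \<phi> \<longleftrightarrow> \<Psi> G" using r by (auto simp: repr_def)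
  ultimately show "\<forall>\<^sub>F G in gen P. \<Psi> G" 
    by (elim eventually_elim2[OF _ eventually_descending[of P]]) (auto simp: holds_def descending_def)
qed

lemma repr_cong:
  assumes "repr P \<phi> \<Psi>" "\<And>p. p \<in> conds P \<Longrightarrow> \<phi>' P p \<longleftrightarrow> \<phi> P p" "\<forall>\<^sub>F G in gen P. \<Psi> G \<longleftrightarrow> \<Psi>' G"
  shows "repr P \<phi>' \<Psi>'"
proof -
  have "dense_below (\<phi>' P) P p \<longleftrightarrow> dense_below (\<phi> P) P p" for p
    by (auto simp: dense_below_def assms(2))
  then have "regular P \<phi>'" using assms(1) by (simp add: repr_def regular_def assms(2))
  moreover have "\<forall>\<^sub>F G in gen P. holds P G \<phi> \<longleftrightarrow> \<Psi> G" using assms(1) by (auto simp: repr_def)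
  from this assms(3) eventually_descending have "\<forall>\<^sub>F G in gen P. holds P G \<phi>' \<longleftrightarrow> \<Psi>' G"
    by eventually_elim (auto simp: holds_def descending_def assms(2))
  ultimately show ?thesis by (auto simp: repr_def)
qed

text \<open>The conditions that satisfy \<open>D\<close> or have no extension satisfying
  \<open>D\<close> are dense. Once a sequence has entered this set, \<open>D\<close> is either
  reached or excluded for good.\<close>

lemma repr_open:
  assumes mono: "\<And>p q. p \<in> conds P \<Longrightarrow> q \<in> conds P \<Longrightarrow> leq P q p \<Longrightarrow> D p \<Longrightarrow> D q"
  shows "repr P (\<lambda>P. dense_below D P) (\<lambda>G. \<exists>i. D (G i))"
proof -
  have "dense_in P {q. D q \<or> (\<forall>r\<in>conds P. leq P r q \<longrightarrow> \<not> D r)}"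
    by (rule dense_inI) (use leq_refl in blast)
  from eventually_dense[OF this] eventually_descending
  have "\<forall>\<^sub>F G in gen P. holds P G (\<lambda>P. dense_below D P) \<longleftrightarrow> (\<exists>i. D (G i))"
  proof eventually_elim
    case (elim G)
    then have c: "G i \<in> conds P" for i by (auto simp: descending_def)
    show ?case
    proof
      assume "\<exists>i. D (G i)"
      then obtain i where "D (G i)" by blast
      then have "dense_below D P (G i)" using mono c leq_refl unfolding dense_below_def by blast
      then show "holds P G (\<lambda>P. dense_below D P)" by (auto simp: holds_def)
    next
      assume "holds P G (\<lambda>P. dense_below D P)"
      then obtain i where i: "dense_below D P (G i)" by (auto simp: holds_def)
      obtain j where j: "D (G j) \<or> (\<forall>r\<in>conds P. leq P r (G j) \<longrightarrow> \<not> D r)" using elim by blast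
      have le: "leq P (G (max i j)) (G i)" "leq P (G (max i j)) (G j)"
        using descending_le[OF elim(2)] by auto
      obtain r where "r \<in> conds P" "leq P r (G (max i j))" "D r"
        using i c le unfolding dense_below_def by blast
      then have "leq P r (G j)" using leq_trans le c by blast
      then show "\<exists>i. D (G i)" using j \<open>D r\<close> \<open>r \<in> conds P\<close> by blast
    qed
  qed
  moreover have "regular P (\<lambda>P. dense_below D P)" by (rule regular_dense_below) simp
  ultimately show ?thesis by (auto simp: repr_def)
qed

lemma repr_val: "repr P (val \<tau> n v) (\<lambda>G. ev P G \<tau> n v)"
proof (rule repr_cong)
  show "repr P (\<lambda>P'. dense_below (\<lambda>r. \<exists>q\<in>conds P. (q, n, v) \<in> \<tau> \<and> leq P r q) P')
     (\<lambda>G. \<exists>i. \<exists>q\<in>conds P. (q, n, v) \<in> \<tau> \<and> leq P (G i) q)"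
    by (rule repr_open) (use leq_trans in blast)
qed (auto simp: val_def ev_def)

lemma repr_ground: "repr P (ground b) (\<lambda>_. b)"
proof -
  have "\<forall>\<^sub>F G in gen P. holds P G (ground b) \<longleftrightarrow> b" by (simp add: holds_def ground_def)
  moreover have "regular P (ground b)"
    by (rule regularI) (use leq_refl in \<open>auto simp: ground_def dense_below_def\<close>)
  ultimately show ?thesis by (simp add: repr_def)
qed

lemma repr_neg:
  assumes "repr P \<phi> \<Psi>" shows "repr P (\<^bold>\<not> \<phi>) (\<lambda>G. \<not> \<Psi> G)"
proof -
  have reg: "regular P \<phi>" and ae: "\<forall>\<^sub>F G in gen P. holds P G \<phi> \<longleftrightarrow> \<Psi> G"
    using assms by (auto simp: repr_def)
  have reg': "regular P (\<^bold>\<not> \<phi>)"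
  proof (rule regularI, goal_cases)
    case (1 p q)
    then show ?case unfolding fneg_def using leq_trans by blast
  next
    case (2 p)
    show ?case unfolding fneg_def
    proof (intro ballI impI notI)
      fix q assume q: "q \<in> conds P" "leq P q p" "\<phi> P q"
      then obtain r where "r \<in> conds P" "leq P r q" "(\<^bold>\<not> \<phi>) P r"
        using 2 by (auto simp: dense_below_def)
      then show False using regular_mono[OF reg q(3)] q leq_refl unfolding fneg_def by blast
    qed
  qed
  have "dense_in P {q. \<phi> P q \<or> (\<^bold>\<not> \<phi>) P q}"
    by (rule dense_inI) (use leq_refl in \<open>unfold fneg_def, blast\<close>)
  from eventually_dense[OF this] eventually_descending ae
  have "\<forall>\<^sub>F G in gen P. holds P G (\<^bold>\<not> \<phi>) \<longleftrightarrow> \<not> \<Psi> G"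
  proof eventually_elim
    case (elim G)
    have "\<not> (holds P G \<phi> \<and> holds P G (\<^bold>\<not> \<phi>))"
      using holds_common[OF elim(2) reg reg'] leq_refl elim(2)
      unfolding fneg_def descending_def by metis
    then show ?case using elim by (auto simp: holds_def)
  qed
  then show ?thesis using reg' by (auto simp: repr_def)
qed

lemma repr_conj:
  assumes "repr P \<phi> \<Psi>" "repr P \<phi>' \<Psi>'" shows "repr P (\<phi> \<^bold>\<and> \<phi>') (\<lambda>G. \<Psi> G \<and> \<Psi>' G)"
proof -
  have reg: "regular P \<phi>" "regular P \<phi>'" and ae: "\<forall>\<^sub>F G in gen P. holds P G \<phi> \<longleftrightarrow> \<Psi> G"
    "\<forall>\<^sub>F G in gen P. holds P G \<phi>' \<longleftrightarrow> \<Psi>' G"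
    using assms by (auto simp: repr_def)
  have reg': "regular P (\<phi> \<^bold>\<and> \<phi>')"
  proof (rule regularI, goal_cases)
    case (1 p q)
    then show ?case using regular_mono[OF reg(1)] regular_mono[OF reg(2)] unfolding fconj_def by blast
  next
    case (2 p)
    then have "dense_below (\<phi> P) P p" "dense_below (\<phi>' P) P p"
      unfolding dense_below_def fconj_def by blast+
    then show ?case
      using bspec[OF reg(1)[unfolded regular_def] 2(1)] bspec[OF reg(2)[unfolded regular_def] 2(1)]
      by (simp add: fconj_def)
  qed
  from ae eventually_descending
  have "\<forall>\<^sub>F G in gen P. holds P G (\<phi> \<^bold>\<and> \<phi>') \<longleftrightarrow> \<Psi> G \<and> \<Psi>' G"
  proof eventually_elim
    case (elim G)
    have "holds P G (\<phi> \<^bold>\<and> \<phi>') \<longleftrightarrow> holds P G \<phi> \<and> holds P G \<phi>'"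
      using holds_common[OF elim(3) reg] unfolding holds_def fconj_def by blast
    then show ?case using elim by auto
  qed
  then show ?thesis using reg' by (auto simp: repr_def)
qed

text \<open>Reduced to negation and conjunction. The two formulas are forced by the same conditions
  because regularity of \<open>\<phi>'\<close> removes a double negation.\<close>

lemma repr_imp:
  assumes "repr P \<phi> \<Psi>" "repr P \<phi>' \<Psi>'" shows "repr P (\<phi> \<^bold>\<longrightarrow> \<phi>') (\<lambda>G. \<Psi> G \<longrightarrow> \<Psi>' G)"
proof (rule repr_cong)
  show "repr P (\<^bold>\<not> (\<phi> \<^bold>\<and> (\<^bold>\<not> \<phi>'))) (\<lambda>G. \<not> (\<Psi> G \<and> \<not> \<Psi>' G))"
    by (intro repr_neg repr_conj assms)
  fix p assume p: "p \<in> conds P"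
  have reg: "regular P \<phi>" "regular P \<phi>'" using assms by (auto simp: repr_def)
  show "(\<phi> \<^bold>\<longrightarrow> \<phi>') P p \<longleftrightarrow> (\<^bold>\<not> (\<phi> \<^bold>\<and> (\<^bold>\<not> \<phi>'))) P p"
  proof
    assume "(\<phi> \<^bold>\<longrightarrow> \<phi>') P p"
    then show "(\<^bold>\<not> (\<phi> \<^bold>\<and> (\<^bold>\<not> \<phi>'))) P p"
      using leq_refl unfolding fimp_def fneg_def fconj_def by blast
  next
    assume L: "(\<^bold>\<not> (\<phi> \<^bold>\<and> (\<^bold>\<not> \<phi>'))) P p"
    show "(\<phi> \<^bold>\<longrightarrow> \<phi>') P p" unfolding fimp_def
    proof (intro ballI impI)
      fix q assume q: "q \<in> conds P" "leq P q p" "\<phi> P q"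
      have "dense_below (\<phi>' P) P q"
        unfolding dense_below_def
      proof (intro ballI impI)
        fix r assume r: "r \<in> conds P" "leq P r q"
        have "\<phi> P r" using regular_mono[OF reg(1) q(3) r(2) q(1) r(1)] .
        moreover have "leq P r p" using leq_trans[OF r(2) q(2) r(1) q(1) p] .
        ultimately have "\<not> (\<^bold>\<not> \<phi>') P r" using L r(1) unfolding fneg_def fconj_def by blast
        then show "\<exists>ra\<in>conds P. leq P ra r \<and> \<phi>' P ra" unfolding fneg_def by blast
      qed
      then show "\<phi>' P q" using bspec[OF reg(2)[unfolded regular_def] q(1)] by simp
    qed
  qed
qed simp

lemma repr_iff:
  assumes "repr P \<phi> \<Psi>" "repr P \<phi>' \<Psi>'" shows "repr P (\<phi> \<^bold>\<longleftrightarrow> \<phi>') (\<lambda>G. \<Psi> G \<longleftrightarrow> \<Psi>' G)"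
proof (rule repr_cong)
  show "repr P ((\<phi> \<^bold>\<longrightarrow> \<phi>') \<^bold>\<and> (\<phi>' \<^bold>\<longrightarrow> \<phi>)) (\<lambda>G. (\<Psi> G \<longrightarrow> \<Psi>' G) \<and> (\<Psi>' G \<longrightarrow> \<Psi> G))"
    by (intro repr_imp repr_conj assms)
qed (auto simp: fiff_def intro!: always_eventually)

lemma regular_all:
  assumes reg: "\<And>x. regular P (\<phi> x)" shows "regular P (\<^bold>\<forall>x. \<phi> x)"
proof (rule regularI, goal_cases)
  case (1 p q)
  then show ?case using regular_mono[OF reg] unfolding fall_def by blast
next
  case (2 p)
  have "dense_below (\<phi> x P) P p" for x using 2(2) unfolding fall_def dense_below_def by blast
  then show ?case using bspec[OF reg[unfolded regular_def] 2(1)] by (simp add: fall_def)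
qed

text \<open>A condition either forces all instances or has an extension that refutes one; meeting
  this dense set gives the direction from truth to forcing. Countability enters where all instances
  are evaluated along the same sequence.\<close>

lemma repr_all:
  fixes \<phi> :: "'c::countable \<Rightarrow> 'p formula"
  assumes "\<And>x. repr P (\<phi> x) (\<Psi> x)" shows "repr P (\<^bold>\<forall>x. \<phi> x) (\<lambda>G. \<forall>x. \<Psi> x G)"
proof -
  have reg: "regular P (\<phi> x)" and ae: "\<forall>\<^sub>F G in gen P. holds P G (\<phi> x) \<longleftrightarrow> \<Psi> x G"
    and nae: "\<forall>\<^sub>F G in gen P. holds P G (\<^bold>\<not> (\<phi> x)) \<longleftrightarrow> \<not> \<Psi> x G" for x
    using assms[of x] repr_neg[OF assms[of x]] by (auto simp: repr_def)
  have reg': "regular P (\<^bold>\<forall>x. \<phi> x)" by (rule regular_all[OF reg])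
  have "dense_in P {q. (\<^bold>\<forall>x. \<phi> x) P q \<or> (\<exists>x. (\<^bold>\<not> (\<phi> x)) P q)}"
  proof (rule dense_inI, cases)
    fix p assume p: "p \<in> conds P" "(\<^bold>\<forall>x. \<phi> x) P p"
    then show "\<exists>q\<in>conds P. leq P q p \<and> q \<in> {q. (\<^bold>\<forall>x. \<phi> x) P q \<or> (\<exists>x. (\<^bold>\<not> (\<phi> x)) P q)}"
      using leq_refl by blast
  next
    fix p assume p: "p \<in> conds P" "\<not> (\<^bold>\<forall>x. \<phi> x) P p"
    then obtain x where "\<not> \<phi> x P p" by (auto simp: fall_def)
    then have "\<not> dense_below (\<phi> x P) P p" using bspec[OF reg[unfolded regular_def] p(1)] by simp
    then show "\<exists>q\<in>conds P. leq P q p \<and> q \<in> {q. (\<^bold>\<forall>x. \<phi> x) P q \<or> (\<exists>x. (\<^bold>\<not> (\<phi> x)) P q)}"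
      unfolding dense_below_def fneg_def by blast
  qed
  note dense = eventually_dense[OF this]
  have "\<forall>\<^sub>F G in gen P. \<forall>x. holds P G (\<phi> x) \<longleftrightarrow> \<Psi> x G"
    by (rule eventually_gen_all) (rule ae)
  moreover have "\<forall>\<^sub>F G in gen P. \<forall>x. holds P G (\<^bold>\<not> (\<phi> x)) \<longleftrightarrow> \<not> \<Psi> x G"
    by (rule eventually_gen_all) (rule nae)
  moreover note dense
  ultimately
  have "\<forall>\<^sub>F G in gen P. holds P G (\<^bold>\<forall>x. \<phi> x) \<longleftrightarrow> (\<forall>x. \<Psi> x G)"
  proof eventually_elim
    case (elim G)
    show ?case
    proof
      assume "holds P G (\<^bold>\<forall>x. \<phi> x)"
      then show "\<forall>x. \<Psi> x G" using elim(1) by (auto simp: holds_def fall_def)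
    next
      assume *: "\<forall>x. \<Psi> x G"
      then have "\<not> (\<^bold>\<not> (\<phi> x)) P (G i)" for x i using elim(2) by (auto simp: holds_def)
      then show "holds P G (\<^bold>\<forall>x. \<phi> x)" using elim(3) by (auto simp: holds_def)
    qed
  qed
  then show ?thesis using reg' by (auto simp: repr_def)
qed

lemma repr_ex:
  fixes \<phi> :: "'c::countable \<Rightarrow> 'p formula"
  assumes "\<And>x. repr P (\<phi> x) (\<Psi> x)" shows "repr P (\<^bold>\<exists>x. \<phi> x) (\<lambda>G. \<exists>x. \<Psi> x G)"
proof (rule repr_cong)
  show "repr P (\<^bold>\<not> (\<^bold>\<forall>x. \<^bold>\<not> (\<phi> x))) (\<lambda>G. \<not> (\<forall>x. \<not> \<Psi> x G))"
    by (intro repr_neg repr_all assms)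
next
  fix p show "(\<^bold>\<exists>x. \<phi> x) P p \<longleftrightarrow> (\<^bold>\<not> (\<^bold>\<forall>x. \<^bold>\<not> (\<phi> x))) P p"
    unfolding fex_def fall_def fneg_def dense_below_def by meson
qed (auto intro!: always_eventually)

lemmas repr_intros = repr_ground repr_val repr_neg repr_conj repr_imp repr_iff repr_all repr_ex

section \<open>Countable operations on truth values and functionals\<close>

lemma bp_cong: "bp P \<Psi> \<Longrightarrow> \<forall>\<^sub>F G in gen P. \<Psi> G \<longleftrightarrow> \<Psi>' G \<Longrightarrow> bp P \<Psi>'"
  unfolding bp_def using repr_cong by blast

lemma bp_open:
  assumes "\<And>p q. p \<in> conds P \<Longrightarrow> q \<in> conds P \<Longrightarrow> leq P q p \<Longrightarrow> D p \<Longrightarrow> D q"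
  shows "bp P (\<lambda>G. \<exists>i. D (G i))"
  using repr_open[of D] assms unfolding bp_def by blast

lemma bp_const: "bp P (\<lambda>_. b)" unfolding bp_def using repr_ground by blast
lemma bp_not: "bp P \<Psi> \<Longrightarrow> bp P (\<lambda>G. \<not> \<Psi> G)" unfolding bp_def using repr_neg by blast
lemma bp_conj: "bp P \<Psi> \<Longrightarrow> bp P \<Psi>' \<Longrightarrow> bp P (\<lambda>G. \<Psi> G \<and> \<Psi>' G)" unfolding bp_def using repr_conj by blast
lemma bp_imp: "bp P \<Psi> \<Longrightarrow> bp P \<Psi>' \<Longrightarrow> bp P (\<lambda>G. \<Psi> G \<longrightarrow> \<Psi>' G)" unfolding bp_def using repr_imp by blast
lemma bp_disj: "bp P \<Psi> \<Longrightarrow> bp P \<Psi>' \<Longrightarrow> bp P (\<lambda>G. \<Psi> G \<or> \<Psi>' G)"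
  using bp_imp[OF bp_not[of \<Psi>], of \<Psi>'] by (rule bp_cong) (auto intro!: always_eventually)
lemma bp_all:
  fixes \<Psi> :: "'c::countable \<Rightarrow> _"
  shows "(\<And>x. bp P (\<Psi> x)) \<Longrightarrow> bp P (\<lambda>G. \<forall>x. \<Psi> x G)"
  unfolding bp_def using repr_all[of _ \<Psi>] by metis
lemma bp_ex:
  fixes \<Psi> :: "'c::countable \<Rightarrow> _"
  shows "(\<And>x. bp P (\<Psi> x)) \<Longrightarrow> bp P (\<lambda>G. \<exists>x. \<Psi> x G)"
  unfolding bp_def using repr_ex[of _ \<Psi>] by metis

text \<open>A countable range splits the statement into countably many cases, one for each value of
  \<open>V\<close>. This makes compositions and recursions measurable.\<close>

lemma bp_subst:
  fixes V :: "_ \<Rightarrow> 'v::countable"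
  assumes "meas P V" "\<And>v. bp P (\<Psi> v)" shows "bp P (\<lambda>G. \<Psi> (V G) G)"
proof -
  have "bp P (\<lambda>G. \<exists>v. V G = v \<and> \<Psi> v G)"
    by (intro bp_ex bp_conj) (use assms in \<open>auto simp: meas_def\<close>)
  then show ?thesis by simp
qed

lemma meas_subst:
  fixes V :: "_ \<Rightarrow> 'v::countable"
  assumes "meas P V" "\<And>v. meas P (W v)" shows "meas P (\<lambda>G. W (V G) G)"
  unfolding meas_def
proof
  fix w show "bp P (\<lambda>G. W (V G) G = w)"
    by (rule bp_subst[OF assms(1)]) (use assms(2) in \<open>auto simp: meas_def\<close>)
qed

lemma meas_const: "meas P (\<lambda>_. c)"
  unfolding meas_def using bp_const by blast

lemma meas_if:
  "bp P \<Psi> \<Longrightarrow> meas P V \<Longrightarrow> meas P W \<Longrightarrow> meas P (\<lambda>G. if \<Psi> G then V G else W G)"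
  unfolding meas_def
proof
  fix v assume "bp P \<Psi>" "\<forall>v. bp P (\<lambda>G. V G = v)" "\<forall>v. bp P (\<lambda>G. W G = v)"
  then have "bp P (\<lambda>G. (\<Psi> G \<longrightarrow> V G = v) \<and> (\<not> \<Psi> G \<longrightarrow> W G = v))"
    by (intro bp_conj bp_imp bp_not) auto
  then show "bp P (\<lambda>G. (if \<Psi> G then V G else W G) = v)" by (simp add: if_split)
qed

lemma meas_Least:
  assumes "\<And>k::nat. bp P (\<Psi> k)" shows "meas P (\<lambda>G. LEAST k. \<Psi> k G)"
  unfolding meas_def
proof
  fix v
  \<comment> \<open>The second disjunct accounts for sequences along which no \<open>k\<close>
    qualifies: there the minimum has the fixed value \<open>LEAST k. False\<close>.\<close>
  have "bp P (\<lambda>G. (\<Psi> v G \<and> (\<forall>k. k < v \<longrightarrow> \<not> \<Psi> k G)) \<or> ((\<forall>k. \<not> \<Psi> k G) \<and> (LEAST k::nat. False) = v))"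
    by (intro bp_disj bp_conj bp_all bp_imp bp_not bp_const assms)
  moreover have "((LEAST k. \<Psi> k G) = v) \<longleftrightarrow> ((\<Psi> v G \<and> (\<forall>k. k < v \<longrightarrow> \<not> \<Psi> k G)) \<or> ((\<forall>k. \<not> \<Psi> k G) \<and> (LEAST k::nat. False) = v))" for G
  proof (cases "\<exists>k. \<Psi> k G")
    case True
    then show ?thesis
      using LeastI_ex[OF True] not_less_Least Least_equality[of "\<lambda>k. \<Psi> k G" v] by (metis not_less)
  qed auto
  ultimately show "bp P (\<lambda>G. (LEAST k. \<Psi> k G) = v)" by simp
qed

lemma bp_ev: "bp P (\<lambda>G. ev P G \<tau> n v)" unfolding bp_def by (rule exI, rule repr_val)

lemma meas_THE:
  assumes "\<And>v. bp P (\<Psi> v)" "\<forall>\<^sub>F G in gen P. \<exists>!v. \<Psi> v G" shows "meas P (\<lambda>G. THE v. \<Psi> v G)"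
  unfolding meas_def
proof
  fix v
  from assms(2) have "\<forall>\<^sub>F G in gen P. \<Psi> v G \<longleftrightarrow> (THE v. \<Psi> v G) = v"
    by eventually_elim (metis theI)
  then show "bp P (\<lambda>G. (THE v. \<Psi> v G) = v)" by (rule bp_cong[OF assms(1)])
qed

lemma meas_fn:
  assumes "\<forall>\<^sub>F G in gen P. total_name P G \<tau>" shows "meas P (\<lambda>G. fn P G \<tau> n)"
  unfolding fn_def
  by (rule meas_THE[OF bp_ev], rule eventually_mono[OF assms]) (simp add: total_name_def)

lemma repr_is_fun:
  fixes \<tau> :: "('p, 'v::countable) fun_name"
  shows "repr P (is_fun \<tau>) (\<lambda>G. total_name P G \<tau>)"
proof -
  have "repr P (is_fun \<tau>) (\<lambda>G. (\<forall>n. \<exists>v. ev P G \<tau> n v) \<and> (\<forall>n v w. ev P G \<tau> n v \<and> ev P G \<tau> n w \<longrightarrow> v = w))"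
    unfolding is_fun_def by (intro repr_intros)
  then show ?thesis by (rule repr_cong) (auto simp: total_name_def intro!: always_eventually)
qed

lemma repr_in_incr: "repr P (in_incr f) (\<lambda>G. total_name P G f \<and> strict_mono (fn P G f))"
proof -
  have "repr P (in_incr f) (\<lambda>G. total_name P G f \<and>
     (\<forall>m n k l. m < n \<longrightarrow> ev P G f m k \<longrightarrow> ev P G f n l \<longrightarrow> k < l))"
    unfolding in_incr_def by (intro repr_intros repr_is_fun)
  then show ?thesis by (rule repr_cong) (auto simp: fn_iff strict_mono_def intro!: always_eventually)
qed

lemma repr_in_interval:
  "repr P (in_interval j f n) (\<lambda>G. \<exists>k l. ev P G f n k \<and> ev P G f (Suc n) l \<and> k \<le> j \<and> j < l)"
  unfolding in_interval_def by (intro repr_intros)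

lemma repr_eq_at:
  fixes x :: "('p, 'v::countable) fun_name"
  shows "repr P (eq_at x y n) (\<lambda>G. \<exists>v. ev P G x n v \<and> ev P G y n v)"
  unfolding eq_at_def by (intro repr_intros)

lemma repr_same_fun:
  fixes x :: "('p, 'v::countable) fun_name"
  shows "repr P (same_fun x y) (\<lambda>G. \<forall>n v. ev P G x n v \<longleftrightarrow> ev P G y n v)"
  unfolding same_fun_def by (intro repr_intros)

lemma repr_in_E:
  "repr P (in_E z x f) (\<lambda>G. total_name P G z \<and> (\<exists>m. \<forall>n. m \<le> n \<longrightarrow>
     (\<exists>j. (\<exists>k l. ev P G f n k \<and> ev P G f (Suc n) l \<and> k \<le> j \<and> j < l) \<and>
       \<not> (\<exists>v. ev P G z j v \<and> ev P G x j v))))"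
  unfolding in_E_def in_Cantor_def by (intro repr_intros repr_is_fun repr_in_interval repr_eq_at)

lemma repr_extends: "repr P (extends z s) (\<lambda>G. \<forall>j. j < length s \<longrightarrow> ev P G z j (s ! j))"
  unfolding extends_def by (intro repr_intros)

section \<open>Antichains and countable names\<close>

lemma maximal_antichain:
  assumes "S \<subseteq> conds P"
  obtains A where "A \<subseteq> S" "\<And>p q. p \<in> A \<Longrightarrow> q \<in> A \<Longrightarrow> p \<noteq> q \<Longrightarrow> \<not> compat P p q"
    "\<And>p. p \<in> S \<Longrightarrow> \<exists>q\<in>A. compat P p q"
proof -
  let ?F = "{A. A \<subseteq> S \<and> (\<forall>p\<in>A. \<forall>q\<in>A. p \<noteq> q \<longrightarrow> \<not> compat P p q)}"
  have "\<exists>M\<in>?F. \<forall>X\<in>?F. M \<subseteq> X \<longrightarrow> X = M"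
  proof (rule subset_Zorn')
    fix C assume "subset.chain ?F C"
    then have C: "\<And>A. A \<in> C \<Longrightarrow> A \<in> ?F" "\<And>A B. A \<in> C \<Longrightarrow> B \<in> C \<Longrightarrow> A \<subseteq> B \<or> B \<subseteq> A"
      unfolding subset_chain_def by blast+
    have "\<not> compat P p q" if pq: "p \<in> \<Union>C" "q \<in> \<Union>C" "p \<noteq> q" for p q
    proof -
      from pq obtain A B where AB: "A \<in> C" "B \<in> C" "p \<in> A" "q \<in> B" by auto
      then obtain D where "D \<in> C" "p \<in> D" "q \<in> D" using C(2)[OF AB(1,2)] by blast
      then show ?thesis using C(1) pq(3) by blast
    qed
    moreover have "\<Union>C \<subseteq> S" using C(1) by blast
    ultimately show "\<Union>C \<in> ?F" by simp
  qed
  then obtain A where A: "A \<in> ?F" "\<forall>X\<in>?F. A \<subseteq> X \<longrightarrow> X = A" by (elim bexE)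
  show ?thesis
  proof (rule that[of A])
    fix p assume p: "p \<in> S"
    show "\<exists>q\<in>A. compat P p q"
    proof (rule ccontr)
      assume n: "\<not> ?thesis"
      have sym: "compat P a b \<longleftrightarrow> compat P b a" for a b by (auto simp: compat_def)
      have "insert p A \<in> ?F" using A(1) n p sym by auto
      then have "insert p A = A" using A(2)[rule_format, of "insert p A"] by blast
      then have "p \<in> A" by blast
      moreover have "compat P p p" using p assms leq_refl by (auto simp: compat_def)
      ultimately show False using n by blast
    qed
  qed (use A(1) in auto)
qed

text \<open>For each \<open>n\<close> a maximal antichain is taken among the conditions that decide
  the value at \<open>n\<close>. It is countable by ccc, and since the deciding conditions are
  dense, every generic sequence passes below a member \<open>q\<close> of it and so takes the value
  \<open>w n q\<close> attached to \<open>q\<close>.\<close>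

lemma name_exists:
  fixes V :: "(nat \<Rightarrow> 'p) \<Rightarrow> nat \<Rightarrow> 'v::countable"
  assumes ccc: "ccc P" and V: "\<And>n. meas P (\<lambda>G. V G n)"
  obtains \<tau> :: "('p, 'v) fun_name" where "countable \<tau>" "fst ` \<tau> \<subseteq> conds P"
    "\<forall>\<^sub>F G in gen P. \<forall>n v. ev P G \<tau> n v \<longleftrightarrow> V G n = v"
proof -
  define S where "S n = {q \<in> conds P. \<exists>v. \<forall>\<^sub>F G in gen P. met P G q \<longrightarrow> V G n = v}" for n
  have S: "dense_in P (S n)" for n
  proof (rule dense_inI)
    fix p assume p: "p \<in> conds P"
    have "\<forall>v. \<exists>\<phi>. repr P \<phi> (\<lambda>G. V G n = v)" using V[of n] by (auto simp: meas_def bp_def)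
    then obtain \<phi> where \<phi>: "\<And>v. repr P (\<phi> v) (\<lambda>G. V G n = v)" by metis
    then have "\<forall>\<^sub>F G in gen P. \<forall>v. holds P G (\<phi> v) \<longleftrightarrow> V G n = v"
      by (intro eventually_gen_all) (auto simp: repr_def)
    then obtain G where G: "descending P G" "G 0 = p" "\<forall>v. holds P G (\<phi> v) \<longleftrightarrow> V G n = v"
      using generic_exists[OF p] by blast
    then obtain i where i: "\<phi> (V G n) P (G i)" unfolding holds_def by blast
    have c: "G i \<in> conds P" using G by (auto simp: descending_def)
    then have "G i \<in> S n" using repr_forces[OF \<phi> c] i by (auto simp: S_def)
    then show "\<exists>q\<in>conds P. leq P q p \<and> q \<in> S n" using c descending_le[OF G(1), of 0 i] G(2) by auto
  qed
  have "\<exists>A. A \<subseteq> S n \<and> (\<forall>p\<in>A. \<forall>q\<in>A. p \<noteq> q \<longrightarrow> \<not> compat P p q) \<and> (\<forall>p\<in>S n. \<exists>q\<in>A. compat P p q)" for n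
    by (rule maximal_antichain[of "S n"]) (auto simp: S_def)
  then obtain A where A: "\<And>n. A n \<subseteq> S n" "\<And>n. \<forall>p\<in>A n. \<forall>q\<in>A n. p \<noteq> q \<longrightarrow> \<not> compat P p q"
     "\<And>n. \<forall>p\<in>S n. \<exists>q\<in>A n. compat P p q" by metis
  have AP: "A n \<subseteq> conds P" for n using A(1) by (auto simp: S_def)
  then have cA: "countable (A n)" for n using ccc A(2)[of n] by (auto simp: ccc_def)
  have "\<forall>n q. \<exists>v. q \<in> A n \<longrightarrow> (\<forall>\<^sub>F G in gen P. met P G q \<longrightarrow> V G n = v)"
    using A(1) by (auto simp: S_def)
  then obtain w where w: "\<And>n q. q \<in> A n \<Longrightarrow> \<forall>\<^sub>F G in gen P. met P G q \<longrightarrow> V G n = w n q" by metis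
  let ?\<tau> = "\<Union>n. (\<lambda>q. (q, n, w n q)) ` A n"
  have "\<forall>\<^sub>F G in gen P. \<forall>n. \<forall>q\<in>A n. met P G q \<longrightarrow> V G n = w n q"
    by (intro eventually_gen_all eventually_gen_ball cA w)
  moreover have "\<forall>\<^sub>F G in gen P. \<forall>n. \<exists>i. G i \<in> {r. \<exists>q\<in>A n. leq P r q}"
  proof (intro eventually_gen_all eventually_dense dense_inI)
    fix n p assume p: "p \<in> conds P"
    then obtain s where s: "s \<in> S n" "leq P s p" "s \<in> conds P" using S by (auto simp: dense_in_def)
    then obtain q r where "q \<in> A n" "r \<in> conds P" "leq P r s" "leq P r q"
      using A(3)[of n] by (auto simp: compat_def)
    then show "\<exists>r\<in>conds P. leq P r p \<and> r \<in> {r. \<exists>q\<in>A n. leq P r q}"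
      using s p leq_trans by blast
  qed
  ultimately have "\<forall>\<^sub>F G in gen P. \<forall>n v. ev P G ?\<tau> n v \<longleftrightarrow> V G n = v"
  proof eventually_elim
    case (elim G)
    show ?case
    proof (intro allI iffI)
      fix n v assume "ev P G ?\<tau> n v"
      then obtain q where "q \<in> A n" "met P G q" "v = w n q" by (auto simp: ev_def met_def)
      then show "V G n = v" using elim(1) by auto
    next
      fix n v assume v: "V G n = v"
      obtain i q where q: "q \<in> A n" "leq P (G i) q" using elim(2) by blast
      then have "w n q = v" using elim(1) v unfolding met_def by metis
      then have "(q, n, v) \<in> ?\<tau>" using q by auto
      then show "ev P G ?\<tau> n v" using q AP unfolding ev_def by blast
    qed
  qed
  moreover have "countable ?\<tau>" using cA by auto
  moreover have "fst ` ?\<tau> \<subseteq> conds P" using subsetD[OF AP] by auto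
  ultimately show ?thesis by (intro that[of ?\<tau>])
qed

end

text \<open>Takes the place of the \<open>\<Delta>\<close>-system lemma: all other members of the family differ from a fixed one
  at one of finitely many points.\<close>

lemma countable_incompatible_card:
  fixes h :: "'i \<Rightarrow> 'x \<rightharpoonup> 'y::countable"
  assumes "\<And>i. i \<in> I \<Longrightarrow> finite (dom (h i)) \<and> card (dom (h i)) = n"
    and "\<And>i j. i \<in> I \<Longrightarrow> j \<in> I \<Longrightarrow> i \<noteq> j \<Longrightarrow> \<exists>x\<in>dom (h i) \<inter> dom (h j). h i x \<noteq> h j x"
  shows "countable I"
  using assms
proof (induction n arbitrary: I h)
  \<comment> \<open>Empty functions are never incompatible, so there is at most one of them.\<close>
  case 0
  have "\<exists>a. I \<subseteq> {a}"
  proof (cases "I = {}")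
    case False
    then obtain a where a: "a \<in> I" by blast
    have "i = a" if i: "i \<in> I" for i
    proof (rule ccontr)
      assume "i \<noteq> a"
      then obtain x where "x \<in> dom (h i)" using 0(2)[OF i a] by blast
      then show False using 0(1)[OF i] by auto
    qed
    then show ?thesis by blast
  qed simp
  then show ?case by (meson countable_empty countable_insert countable_subset)
next
  case (Suc n)
  show ?case
  proof (cases "I = {}")
    case False
    then obtain a where a: "a \<in> I" by blast
    \<comment> \<open>Fixing a common value \<open>v\<close> at \<open>x\<close> removes one point
      from the domains; two members must then be incompatible at another point.\<close>
    let ?J = "\<lambda>x v. {i\<in>I. h i x = Some v}"
    have J: "countable (?J x v)" for x v
    proof (rule Suc.IH[of _ "\<lambda>i. (h i)(x := None)"])
      fix i assume i: "i \<in> ?J x v"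
      then have "finite (dom (h i)) \<and> card (dom (h i)) = Suc n" "x \<in> dom (h i)" using Suc.prems(1) by auto
      then show "finite (dom ((h i)(x := None))) \<and> card (dom ((h i)(x := None))) = n" by simp
    next
      fix i j assume ij: "i \<in> ?J x v" "j \<in> ?J x v" "i \<noteq> j"
      then obtain y where "y \<in> dom (h i) \<inter> dom (h j)" "h i y \<noteq> h j y" using Suc.prems(2)[of i j] by auto
      then show "\<exists>y\<in>dom ((h i)(x := None)) \<inter> dom ((h j)(x := None)). ((h i)(x := None)) y \<noteq> ((h j)(x := None)) y"
        using ij by (intro bexI[of _ y]) auto
    qed
    have "I \<subseteq> insert a (\<Union>x\<in>dom (h a). \<Union>v. ?J x v)"
    proof
      fix i assume i: "i \<in> I"
      show "i \<in> insert a (\<Union>x\<in>dom (h a). \<Union>v. ?J x v)"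
      proof (cases "i = a")
        case False
        then obtain x where "x \<in> dom (h i)" "x \<in> dom (h a)" using Suc.prems(2)[OF i a] by blast
        then show ?thesis using i by blast
      qed simp
    qed
    moreover have "countable (dom (h a))" using Suc.prems(1)[OF a] by (simp add: countable_finite)
    then have "countable (insert a (\<Union>x\<in>dom (h a). \<Union>v. ?J x v))" using J by simp
    ultimately show ?thesis by (rule countable_subset)
  qed simp
qed

lemma countable_incompatible:
  fixes h :: "'i \<Rightarrow> 'x \<rightharpoonup> 'y::countable"
  assumes fin: "\<And>i. i \<in> I \<Longrightarrow> finite (dom (h i))"
    and inc: "\<And>i j. i \<in> I \<Longrightarrow> j \<in> I \<Longrightarrow> i \<noteq> j \<Longrightarrow> \<exists>x\<in>dom (h i) \<inter> dom (h j). h i x \<noteq> h j x"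
  shows "countable I"
proof -
  have "countable {i\<in>I. card (dom (h i)) = n}" for n
    by (rule countable_incompatible_card[of _ h n]) (use fin inc in auto)
  then have "countable (\<Union>n. {i\<in>I. card (dom (h i)) = n})" by simp
  moreover have "I = (\<Union>n. {i\<in>I. card (dom (h i)) = n})" by auto
  ultimately show ?thesis by simp
qed

section \<open>Interval partitions and the sets \<open>E_set x f\<close>\<close>

definition E_set :: "(nat \<Rightarrow> bool) \<Rightarrow> (nat \<Rightarrow> nat) \<Rightarrow> (nat \<Rightarrow> bool) set" where
  "E_set x f = {z. \<exists>m. \<forall>n\<ge>m. \<exists>j\<in>{f n..<f (Suc n)}. z j \<noteq> x j}"

lemma strict_mono_ge: "strict_mono f \<Longrightarrow> n \<le> f n" for f :: "nat \<Rightarrow> nat"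
  by (rule strict_mono_imp_increasing)

lemma E_set_mono:
  assumes f: "strict_mono f" and g: "strict_mono g"
    and sub: "\<exists>m. \<forall>n\<ge>m. \<exists>k. {f k..<f (Suc k)} \<subseteq> {g n..<g (Suc n)} \<and> (\<forall>j\<in>{f k..<f (Suc k)}. x j = y j)"
  shows "E_set x f \<subseteq> E_set y g"
proof
  fix z assume "z \<in> E_set x f"
  then obtain a where a: "\<And>n. n \<ge> a \<Longrightarrow> \<exists>j\<in>{f n..<f (Suc n)}. z j \<noteq> x j" by (auto simp: E_set_def)
  obtain m where m: "\<And>n. n \<ge> m \<Longrightarrow> \<exists>k. {f k..<f (Suc k)} \<subseteq> {g n..<g (Suc n)} \<and> (\<forall>j\<in>{f k..<f (Suc k)}. x j = y j)"
    using sub by blast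
  \<comment> \<open>The bound \<open>f a\<close> ensures \<open>a \<le> k\<close> for the interval
    of \<open>f\<close> found below, because \<open>f a \<le> n \<le> g n \<le> f k\<close>.\<close>
  have "\<exists>j\<in>{g n..<g (Suc n)}. z j \<noteq> y j" if n: "n \<ge> max m (f a)" for n
  proof -
    obtain k where k: "{f k..<f (Suc k)} \<subseteq> {g n..<g (Suc n)}" "\<forall>j\<in>{f k..<f (Suc k)}. x j = y j"
      using m[of n] n by auto
    have "f k < f (Suc k)" using f by (simp add: strict_mono_Suc_iff)
    then have "g n \<le> f k" using k(1) by (auto simp: subset_iff)
    then have "f a \<le> f k" using strict_mono_ge[OF g, of n] n by auto
    then have "a \<le> k" using strict_mono_less_eq[OF f] by blast
    then show ?thesis using a[of k] k by fastforce
  qed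
  then show "z \<in> E_set y g" unfolding E_set_def by blast
qed

text \<open>The interval of a strictly increasing \<open>f\<close> with index \<open>m\<close> does
  not begin before \<open>m\<close>. So an interval that starts at \<open>m\<close> contains the
  \<open>m\<close>-th intervals of \<open>f\<close> and \<open>g\<close> as soon as it reaches the
  ends of both, and the sum of these ends is a bound for both.\<close>

fun merge :: "(nat \<Rightarrow> nat) \<Rightarrow> (nat \<Rightarrow> nat) \<Rightarrow> nat \<Rightarrow> nat" where
  "merge f g 0 = 0"
| "merge f g (Suc n) = f (Suc (merge f g n)) + g (Suc (merge f g n))"

lemma merge_intervals:
  assumes f: "strict_mono f" and g: "strict_mono g"
  shows "strict_mono (merge f g)"
    and "{f (merge f g n)..<f (Suc (merge f g n))} \<subseteq> {merge f g n..<merge f g (Suc n)}"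
    and "{g (merge f g n)..<g (Suc (merge f g n))} \<subseteq> {merge f g n..<merge f g (Suc n)}"
proof -
  show "strict_mono (merge f g)" unfolding strict_mono_Suc_iff
  proof
    fix n show "merge f g n < merge f g (Suc n)"
      using strict_mono_ge[OF f, of "Suc (merge f g n)"] by simp
  qed
  show "{f (merge f g n)..<f (Suc (merge f g n))} \<subseteq> {merge f g n..<merge f g (Suc n)}"
    using strict_mono_ge[OF f, of "merge f g n"] by auto
  show "{g (merge f g n)..<g (Suc (merge f g n))} \<subseteq> {merge f g n..<merge f g (Suc n)}"
    using strict_mono_ge[OF g, of "merge f g n"] by auto
qed

definition agree :: "(nat \<Rightarrow> bool) \<Rightarrow> (nat \<Rightarrow> bool) \<Rightarrow> (nat \<Rightarrow> nat) \<Rightarrow> nat \<Rightarrow> bool" where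
  "agree c x f k \<longleftrightarrow> (\<forall>j. f k \<le> j \<longrightarrow> j < f (Suc k) \<longrightarrow> c j = x j)"

text \<open>Since \<open>k \<le> f k\<close>, it suffices to demand that the index \<open>k\<close>
  be at least the last end point. Taking the least such \<open>k\<close> keeps the functional
  measurable.\<close>

fun agree_seq :: "(nat \<Rightarrow> bool) \<Rightarrow> (nat \<Rightarrow> bool) \<Rightarrow> (nat \<Rightarrow> nat) \<Rightarrow> nat \<Rightarrow> nat" where
  "agree_seq c x f 0 = 0"
| "agree_seq c x f (Suc n) = f (Suc (LEAST k. agree_seq c x f n \<le> k \<and> agree c x f k))"

lemma agree_seq_intervals:
  assumes f: "strict_mono f" and ag: "\<And>N. \<exists>k\<ge>N. agree c x f k"
  shows "strict_mono (agree_seq c x f)"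
    and "\<exists>k. {f k..<f (Suc k)} \<subseteq> {agree_seq c x f n..<agree_seq c x f (Suc n)} \<and> agree c x f k"
proof -
  let ?g = "agree_seq c x f"
  let ?k = "\<lambda>n. LEAST k. ?g n \<le> k \<and> agree c x f k"
  have k: "?g n \<le> ?k n \<and> agree c x f (?k n)" for n
    by (rule LeastI_ex) (use ag in blast)
  have le: "?g n \<le> f (?k n)" for n using k[of n] strict_mono_ge[OF f, of "?k n"] by linarith
  show "strict_mono ?g" unfolding strict_mono_Suc_iff
  proof
    fix n
    have "f (?k n) < f (Suc (?k n))" using f by (simp add: strict_mono_Suc_iff)
    then show "?g n < ?g (Suc n)" using le[of n] by simp
  qed
  show "\<exists>k. {f k..<f (Suc k)} \<subseteq> {?g n..<?g (Suc n)} \<and> agree c x f k"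
    using le[of n] k[of n] by (intro exI[of _ "?k n"]) auto
qed

text \<open>Selects intervals of \<open>g\<close> that contain no interval of \<open>f\<close>. An
  interval of \<open>f\<close> that begins before a point \<open>e\<close> has index below
  \<open>e\<close>, hence ends by \<open>f e\<close>. The gap up to
  \<open>f (g (Suc (pick f g i)))\<close> thus keeps an interval of \<open>f\<close> from meeting
  two selected intervals.\<close>

fun pick :: "(nat \<Rightarrow> nat) \<Rightarrow> (nat \<Rightarrow> nat) \<Rightarrow> nat \<Rightarrow> nat" where
  "pick f g 0 = (LEAST n. \<forall>k. \<not> (g n \<le> f k \<and> f (Suc k) \<le> g (Suc n)))"
| "pick f g (Suc i) = (LEAST n. f (g (Suc (pick f g i))) \<le> g n \<and> (\<forall>k. \<not> (g n \<le> f k \<and> f (Suc k) \<le> g (Suc n))))"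

definition diag :: "(nat \<Rightarrow> bool) \<Rightarrow> (nat \<Rightarrow> nat) \<Rightarrow> (nat \<Rightarrow> bool) \<Rightarrow> (nat \<Rightarrow> nat) \<Rightarrow> nat \<Rightarrow> bool" where
  "diag x f y g j = (if \<exists>i. g (pick f g i) \<le> j \<and> j < g (Suc (pick f g i)) then y j else \<not> x j)"

text \<open>On the selected intervals the real equals \<open>y\<close>, and there are infinitely
  many of them. An interval of \<open>f\<close> is not included in a selected one and does not meet
  two of them, so it has a point at which the real differs from \<open>x\<close>.\<close>

lemma diag_separates:
  assumes f: "strict_mono f" and g: "strict_mono g"
    and good: "\<And>m. \<exists>n\<ge>m. \<forall>k. \<not> {f k..<f (Suc k)} \<subseteq> {g n..<g (Suc n)}"
  shows "diag x f y g \<in> E_set x f" and "diag x f y g \<notin> E_set y g"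
proof -
  have fS: "f n < f (Suc n)" and gS: "g n < g (Suc n)" for n
    using f g by (simp_all add: strict_mono_Suc_iff)
  have good': "\<exists>n. m \<le> g n \<and> (\<forall>k. \<not> (g n \<le> f k \<and> f (Suc k) \<le> g (Suc n)))" for m
  proof -
    obtain n where n: "n \<ge> m" "\<forall>k. \<not> {f k..<f (Suc k)} \<subseteq> {g n..<g (Suc n)}" using good by blast
    then have "m \<le> g n" using strict_mono_ge[OF g, of n] by linarith
    moreover have "\<not> (g n \<le> f k \<and> f (Suc k) \<le> g (Suc n))" for k using n(2) fS[of k] by fastforce
    ultimately show ?thesis by blast
  qed
  let ?p = "pick f g"
  have "\<forall>k. \<not> (g (?p i) \<le> f k \<and> f (Suc k) \<le> g (Suc (?p i)))" for i
  proof (cases i)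
    case 0
    have "\<exists>n. \<forall>k. \<not> (g n \<le> f k \<and> f (Suc k) \<le> g (Suc n))" using good' by blast
    from LeastI_ex[OF this] show ?thesis unfolding 0 by simp
  next
    case (Suc i')
    from LeastI_ex[OF good'[of "f (g (Suc (?p i')))"]] show ?thesis unfolding Suc by simp
  qed
  then have p: "\<And>i k. g (?p i) \<le> f k \<Longrightarrow> \<not> f (Suc k) \<le> g (Suc (?p i))" by blast
  have step: "f (g (Suc (?p i))) \<le> g (?p (Suc i))" for i
    using LeastI_ex[OF good'[of "f (g (Suc (?p i)))"]] by simp
  have mono: "?p i < ?p (Suc i)" for i
  proof -
    have "g (Suc (?p i)) \<le> g (?p (Suc i))"
      using step[of i] strict_mono_ge[OF f, of "g (Suc (?p i))"] by linarith
    then show ?thesis using strict_mono_less_eq[OF g] by (simp add: Suc_le_eq)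
  qed
  then have pm: "strict_mono ?p" by (simp add: strict_mono_Suc_iff)
  have sep: "f (g (Suc (?p i))) \<le> g (?p j)" if "i < j" for i j
  proof -
    have "?p (Suc i) \<le> ?p j" using strict_mono_less_eq[OF pm, of "Suc i" j] that by (simp add: Suc_le_eq del: pick.simps)
    then show ?thesis using step[of i] strict_mono_less_eq[OF g] le_trans by blast
  qed
  show "diag x f y g \<in> E_set x f"
  proof -
    have "\<exists>j\<in>{f k..<f (Suc k)}. diag x f y g j \<noteq> x j" for k
    proof (rule ccontr)
      assume n: "\<not> ?thesis"
      have ex: "\<exists>i. g (?p i) \<le> j \<and> j < g (Suc (?p i))" if "f k \<le> j" "j < f (Suc k)" for j
      proof -
        have "diag x f y g j = x j" using n that by simp
        then show ?thesis unfolding diag_def by (auto split: if_splits simp del: pick.simps)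
      qed
      obtain i where i: "g (?p i) \<le> f k" "f k < g (Suc (?p i))" using ex[of "f k"] fS by blast
      then have lt: "g (Suc (?p i)) < f (Suc k)" using p[of i k] by simp
      \<comment> \<open>The first point after the selected interval still belongs to the interval of
        \<open>f\<close>, so another selected interval would have to cover it.\<close>
      then obtain i' where i': "g (?p i') \<le> g (Suc (?p i))" "g (Suc (?p i)) < g (Suc (?p i'))"
        using ex[of "g (Suc (?p i))"] i by auto
      have "i < i'"
        using i'(2) strict_mono_less[OF g] strict_mono_less[OF pm] by simp
      have "k < g (Suc (?p i))" using i strict_mono_ge[OF f, of k] by linarith
      then have "f (Suc k) \<le> f (g (Suc (?p i)))" using strict_mono_less_eq[OF f] by (simp add: Suc_le_eq)
      then show False using sep[OF \<open>i < i'\<close>] i' lt by linarith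
    qed
    then show ?thesis by (auto simp: E_set_def)
  qed
  show "diag x f y g \<notin> E_set y g"
  proof
    assume "diag x f y g \<in> E_set y g"
    then obtain m where m: "\<And>n. n \<ge> m \<Longrightarrow> \<exists>j\<in>{g n..<g (Suc n)}. diag x f y g j \<noteq> y j"
      by (auto simp: E_set_def)
    obtain j where "j \<in> {g (?p m)..<g (Suc (?p m))}" "diag x f y g j \<noteq> y j"
      using m[of "?p m"] strict_mono_ge[OF pm, of m] by blast
    then show False by (auto simp: diag_def split: if_splits)
  qed
qed

section \<open>Covering countably many nowhere dense sets by one set
  \<open>E_set x f\<close>\<close>

definition good_ext :: "(bool list \<Rightarrow> nat \<Rightarrow> bool) \<Rightarrow> nat \<Rightarrow> bool list \<Rightarrow> bool" where
  "good_ext S m w \<longleftrightarrow> w \<noteq> [] \<and> (\<forall>u i. length u = m \<longrightarrow> i \<le> m \<longrightarrow> S (u @ w) i)"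

text \<open>In the application, \<open>S u i\<close> says that the basic open set of
  \<open>u\<close> misses the \<open>i\<close>-th nowhere dense set. The word is the least one in a
  numbering because \<open>LEAST\<close>, unlike an arbitrary choice, preserves measurability in
  \<open>S\<close>.\<close>

definition ext_word :: "(bool list \<Rightarrow> nat \<Rightarrow> bool) \<Rightarrow> nat \<Rightarrow> bool list" where
  "ext_word S m = from_nat (LEAST k. good_ext S m (from_nat k))"

fun cover_f :: "(bool list \<Rightarrow> nat \<Rightarrow> bool) \<Rightarrow> nat \<Rightarrow> nat" where
  "cover_f S 0 = 0"
| "cover_f S (Suc n) = cover_f S n + length (ext_word S (cover_f S n))"

definition cover_x :: "(bool list \<Rightarrow> nat \<Rightarrow> bool) \<Rightarrow> nat \<Rightarrow> bool" where
  "cover_x S j = (let n = LEAST n. j < cover_f S (Suc n) in ext_word S (cover_f S n) ! (j - cover_f S n))"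

text \<open>The word placed on the \<open>n\<close>-th interval leads from every sequence of length
  \<open>f n\<close> into basic open sets that miss all nowhere dense sets up to index
  \<open>f n\<close>. A real that agrees with \<open>x\<close> on this interval is outside all of
  them, so a member of the \<open>i\<close>-th set differs from \<open>x\<close> on every interval
  from the \<open>i\<close>-th on.\<close>

lemma cover_avoids:
  assumes mono: "\<And>u w i. S u i \<Longrightarrow> S (u @ w) i" and ex: "\<And>u i. \<exists>w. S (u @ w) i"
  shows "strict_mono (cover_f S)"
    and "(\<And>m. \<not> S (map z [0..<m]) i) \<Longrightarrow> z \<in> E_set (cover_x S) (cover_f S)"
proof -
  \<comment> \<open>Finitely many requirements are met by appending words one after another;
    \<open>mono\<close> preserves those already met.\<close>
  have fin: "\<exists>w. \<forall>(u, i)\<in>A. S (u @ w) i" if "finite A" for A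
    using that
  proof (induction A rule: finite_induct)
    case (insert p A)
    obtain u i where p: "p = (u, i)" by (cases p)
    obtain w where w: "\<forall>(u, i)\<in>A. S (u @ w) i" using insert by blast
    obtain w' where w': "S ((u @ w) @ w') i" using ex by blast
    have "\<forall>(u, i)\<in>insert p A. S (u @ (w @ w')) i"
    proof
      fix q assume "q \<in> insert p A"
      then consider "q = (u, i)" | "q \<in> A" using p by blast
      then show "case q of (u, i) \<Rightarrow> S (u @ (w @ w')) i"
      proof cases
        case 2
        obtain v k where q: "q = (v, k)" by (cases q)
        then have "S (v @ w) k" using w 2 by auto
        then have "S ((v @ w) @ w') k" by (rule mono)
        then show ?thesis using q by simp
      qed (use w' in simp)
    qed
    then show ?case by blast
  qed simp
  have "\<exists>w. good_ext S m w" for m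
  proof -
    have "finite ({u :: bool list. length u = m} \<times> {..m})"
      using finite_lists_length_eq[of "UNIV :: bool set" m] by simp
    then obtain w where w: "\<And>u i. length u = m \<Longrightarrow> i \<le> m \<Longrightarrow> S (u @ w) i" using fin by fastforce
    \<comment> \<open>One more digit makes the word nonempty, as strict monotonicity of
      \<open>cover_f\<close> demands.\<close>
    have "good_ext S m (w @ [True])"
      unfolding good_ext_def using mono[OF w, of _ _ "[True]"] by simp
    then show ?thesis by blast
  qed
  then have "\<exists>k. good_ext S m (from_nat k)" for m by (metis from_nat_to_nat)
  then have ge: "good_ext S m (ext_word S m)" for m
    unfolding ext_word_def by (rule LeastI_ex)
  then have ne: "length (ext_word S m) > 0" for m by (auto simp: good_ext_def)
  show sm: "strict_mono (cover_f S)" using ne by (simp add: strict_mono_Suc_iff)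
  let ?f = "cover_f S"
  have x: "cover_x S j = ext_word S (?f n) ! (j - ?f n)" if j: "?f n \<le> j" "j < ?f (Suc n)" for n j
  proof -
    have "(LEAST n. j < ?f (Suc n)) = n"
    proof (rule Least_equality)
      fix k assume "j < ?f (Suc k)"
      then have "?f n < ?f (Suc k)" using j by linarith
      then show "n \<le> k" using strict_mono_less[OF sm, of n "Suc k"] by (simp del: cover_f.simps)
    qed (rule j)
    then show ?thesis by (simp add: cover_x_def Let_def)
  qed
  assume z: "\<And>m. \<not> S (map z [0..<m]) i"
  have "\<exists>j\<in>{?f n..<?f (Suc n)}. z j \<noteq> cover_x S j" if n: "n \<ge> i" for n
  proof (rule ccontr)
    assume neg: "\<not> ?thesis"
    let ?w = "ext_word S (?f n)"
    have "map z [0..<?f (Suc n)] = map z [0..<?f n] @ ?w"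
    proof (rule nth_equalityI)
      fix j assume "j < length (map z [0..<?f (Suc n)])"
      then have j: "j < ?f (Suc n)" by simp
      show "map z [0..<?f (Suc n)] ! j = (map z [0..<?f n] @ ?w) ! j"
      proof (cases "j < ?f n")
        case False
        then have "z j = ?w ! (j - ?f n)" using neg x[of n j] j by auto
        then show ?thesis using False j by (simp add: nth_append)
      qed (use j in \<open>simp add: nth_append\<close>)
    qed simp
    moreover have "i \<le> ?f n" using strict_mono_ge[OF sm, of n] n by linarith
    then have "S (map z [0..<?f n] @ ?w) i" using ge[of "?f n"] by (simp add: good_ext_def)
    ultimately show False using z[of "?f (Suc n)"] by simp
  qed
  then show "z \<in> E_set (cover_x S) ?f" unfolding E_set_def by blast
qed

section \<open>Measurable functionals of generic sequences\<close>

context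
  fixes P :: "'p forcing"
  assumes P: "forcing_notion P"
begin

lemma meas_comp2: "meas P V \<Longrightarrow> meas P W \<Longrightarrow> meas P (\<lambda>G. g (V G) (W G))"
  for V :: "_ \<Rightarrow> 'v::countable" and W :: "_ \<Rightarrow> 'w::countable"
  by (intro meas_subst[OF P, of V "\<lambda>v G. g v (W G)"] meas_subst[OF P, of W "\<lambda>w G. g _ w"] meas_const[OF P])

lemma meas_comp: "meas P V \<Longrightarrow> meas P (\<lambda>G. g (V G))" for V :: "_ \<Rightarrow> 'v::countable"
  by (intro meas_subst[OF P, of V "\<lambda>v G. g v"] meas_const[OF P])

lemma meas_at: "(\<And>n. meas P (\<lambda>G. f G n)) \<Longrightarrow> meas P V \<Longrightarrow> meas P (\<lambda>G. f G (V G))"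
  for V :: "_ \<Rightarrow> 'v::countable"
  by (rule meas_subst[OF P, of V "\<lambda>v G. f G v"])

lemma bp_rel: "meas P V \<Longrightarrow> meas P W \<Longrightarrow> bp P (\<lambda>G. r (V G) (W G))"
  for V :: "_ \<Rightarrow> 'v::countable" and W :: "_ \<Rightarrow> 'w::countable"
proof -
  assume "meas P V" "meas P W"
  then have "meas P (\<lambda>G. r (V G) (W G))" by (rule meas_comp2)
  then have "bp P (\<lambda>G. r (V G) (W G) = True)" unfolding meas_def by (rule spec)
  then show ?thesis by simp
qed

lemma meas_merge:
  assumes f: "\<And>n. meas P (\<lambda>G. f G n)" and g: "\<And>n. meas P (\<lambda>G. g G n)"
  shows "meas P (\<lambda>G. merge (f G) (g G) n)"
proof (induction n)
  case 0
  show ?case using meas_const[OF P] by simp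
next
  case (Suc n)
  have "meas P (\<lambda>G. f G (Suc (merge (f G) (g G) n)))" "meas P (\<lambda>G. g G (Suc (merge (f G) (g G) n)))"
    by (rule meas_at[OF f meas_comp[OF Suc]] meas_at[OF g meas_comp[OF Suc]])+
  from meas_comp2[OF this, of "(+)"] show ?case by simp
qed

lemma bp_agree:
  assumes "\<And>n. meas P (\<lambda>G. c G n)" "\<And>n. meas P (\<lambda>G. x G n)" "\<And>n. meas P (\<lambda>G. f G n)"
  shows "bp P (\<lambda>G. agree (c G) (x G) (f G) k)"
  unfolding agree_def
  by (intro bp_all[OF P] bp_imp[OF P] bp_rel assms meas_const[OF P])

lemma meas_agree_seq:
  assumes c: "\<And>n. meas P (\<lambda>G. c G n)" and x: "\<And>n. meas P (\<lambda>G. x G n)" and f: "\<And>n. meas P (\<lambda>G. f G n)"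
  shows "meas P (\<lambda>G. agree_seq (c G) (x G) (f G) n)"
proof (induction n)
  case 0
  show ?case using meas_const[OF P] by simp
next
  case (Suc n)
  have "meas P (\<lambda>G. LEAST k. agree_seq (c G) (x G) (f G) n \<le> k \<and> agree (c G) (x G) (f G) k)"
    by (intro meas_Least[OF P] bp_conj[OF P] bp_agree bp_rel Suc meas_const[OF P] c x f)
  from meas_at[OF f meas_comp[OF this, of Suc]] show ?case by simp
qed

lemma meas_pick:
  assumes f: "\<And>n. meas P (\<lambda>G. f G n)" and g: "\<And>n. meas P (\<lambda>G. g G n)"
  shows "meas P (\<lambda>G. pick (f G) (g G) i)"
proof (induction i)
  case 0
  show ?case unfolding pick.simps
    by (intro meas_Least[OF P] bp_all[OF P] bp_not[OF P] bp_conj[OF P] bp_rel f g)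
next
  case (Suc i)
  have "meas P (\<lambda>G. f G (g G (Suc (pick (f G) (g G) i))))"
    by (rule meas_at[OF f meas_at[OF g meas_comp[OF Suc]]])
  then show ?case unfolding pick.simps
    by (intro meas_Least[OF P] bp_all[OF P] bp_not[OF P] bp_conj[OF P] bp_rel f g)
qed

lemma meas_diag:
  assumes x: "\<And>n. meas P (\<lambda>G. x G n)" and f: "\<And>n. meas P (\<lambda>G. f G n)"
    and y: "\<And>n. meas P (\<lambda>G. y G n)" and g: "\<And>n. meas P (\<lambda>G. g G n)"
  shows "meas P (\<lambda>G. diag (x G) (f G) (y G) (g G) j)"
  unfolding diag_def
  by (intro meas_if[OF P] bp_ex[OF P] bp_conj[OF P] bp_rel meas_const[OF P] meas_at[OF g]
      meas_comp[of _ Suc] meas_comp[of _ Not] meas_pick x f y g)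

lemma meas_cover:
  assumes S: "\<And>u i. bp P (\<lambda>G. S G u i)"
  shows "meas P (\<lambda>G. cover_f (S G) n)" and "meas P (\<lambda>G. cover_x (S G) n)"
proof -
  have "bp P (\<lambda>G. good_ext (S G) m w)" for m w
    unfolding good_ext_def by (intro bp_conj[OF P] bp_all[OF P] bp_imp[OF P] bp_const[OF P] S)
  then have "meas P (\<lambda>G. LEAST k. good_ext (S G) m (from_nat k))" for m
    by (intro meas_Least[OF P])
  from meas_comp[OF this, of from_nat] have w: "meas P (\<lambda>G. ext_word (S G) m)" for m
    unfolding ext_word_def .
  show f: "meas P (\<lambda>G. cover_f (S G) n)" for n
  proof (induction n)
    case 0
    show ?case using meas_const[OF P] by simp
  next
    case (Suc n)
    have "meas P (\<lambda>G. length (ext_word (S G) (cover_f (S G) n)))"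
      by (rule meas_comp[OF meas_at[of "\<lambda>G. ext_word (S G)", OF w Suc]])
    from meas_comp2[OF Suc this, of "(+)"] show ?case by simp
  qed
  have n: "meas P (\<lambda>G. LEAST k. n < cover_f (S G) (Suc k))"
    by (rule meas_Least[OF P]) (rule bp_rel[OF meas_const[OF P] f])
  have fn: "meas P (\<lambda>G. cover_f (S G) (LEAST k. n < cover_f (S G) (Suc k)))"
    by (rule meas_at[of "\<lambda>G. cover_f (S G)", OF f n])
  have "meas P (\<lambda>G. ext_word (S G) (cover_f (S G) (LEAST k. n < cover_f (S G) (Suc k))))"
    by (rule meas_at[of "\<lambda>G. ext_word (S G)", OF w fn])
  from meas_comp2[OF this fn, where g = "\<lambda>w a. w ! (n - a)"]
  show "meas P (\<lambda>G. cover_x (S G) n)" by (simp add: cover_x_def Let_def)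
qed

end

definition dominates :: "('p, nat) fun_name \<Rightarrow> ('p, nat) fun_name \<Rightarrow> 'p formula" where
  "dominates f g = (\<^bold>\<forall>n. \<^bold>\<exists>k. \<^bold>\<forall>j. in_interval j g k \<^bold>\<longrightarrow> in_interval j f n)"

section \<open>Ranks\<close>

lemma El_less [simp]: "El a < El b \<longleftrightarrow> a < b"
  by (auto simp: less_ext_def)

lemma El_less_Whole [simp]: "El a < Whole"
  by (simp add: less_ext_def)

context
  fixes R :: "'a::order set"
  assumes R: "wfp_on R (<)"
begin

lemma rank_le_Rstar:
  assumes "x < y" "y \<in> Rstar R" shows "rank R x \<le> rank R y"
proof (cases "x \<in> Rstar R")
  case True
  then show ?thesis using rankR_less[OF R assms(2) True assms(1)] assms(2) by (simp add: rank_def)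
next
  case False
  have "(LEAST \<alpha>. \<alpha> \<in> rankR R ` {y\<in>Rstar R. x < y}) \<le> rankR R y"
    by (rule Least_le) (use assms in blast)
  then show ?thesis using False assms(2) by (simp add: rank_def)
qed

lemma rank_attained:
  assumes "x \<notin> Rstar R" shows "\<exists>y\<in>Rstar R. x < y \<and> rank R x = rank R y"
proof -
  have "x < Whole" using assms by (cases x) (auto simp: Rstar_def)
  then have "\<exists>\<alpha>. \<alpha> \<in> rankR R ` {y\<in>Rstar R. x < y}" by (auto simp: Rstar_def)
  then have "(LEAST \<alpha>. \<alpha> \<in> rankR R ` {y\<in>Rstar R. x < y}) \<in> rankR R ` {y\<in>Rstar R. x < y}"
    by (rule LeastI_ex)
  then show ?thesis using assms by (auto simp: rank_def)
qed

text \<open>The rank of \<open>y\<close> is the rank of an element of \<open>Rstar R\<close> at or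
  above \<open>y\<close>, and that element also lies above \<open>x\<close>.\<close>

lemma rank_mono: "x < y \<Longrightarrow> rank R x \<le> rank R y"
  using rank_le_Rstar rank_attained by (metis less_trans)

lemma rank_less_Rstar: "x < y \<Longrightarrow> x \<in> Rstar R \<Longrightarrow> y \<in> Rstar R \<Longrightarrow> rank R x < rank R y"
  using rankR_less[OF R] by (simp add: rank_def)

lemma ll_trans: "ll R x y \<Longrightarrow> ll R y z \<Longrightarrow> ll R x z"
  by (auto simp: ll_def)

lemma Qbelow_trans: "b \<in> Qbelow R x \<Longrightarrow> c \<in> Qbelow R (El b) \<Longrightarrow> c \<in> Qbelow R x"
  using ll_trans by (auto simp: Qbelow_def)

text \<open>The rank of \<open>c\<close> may equal that of \<open>b\<close>; weak monotonicity of
  the rank is enough. Clause (4) relates elements of equal rank, so closure of \<open>Q_x\<close>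
  under \<open><\<close>, and not merely under \<open>\<ll>\<close>, is what amalgamation
  uses.\<close>

lemma Qbelow_down: "b \<in> Qbelow R x \<Longrightarrow> c < b \<Longrightarrow> c \<in> Qbelow R x"
  using rank_mono[of "El c" "El b"] less_trans[of "El c" "El b" x] by (auto simp: Qbelow_def ll_def)

lemma Qbelow_irrefl: "b \<notin> Qbelow R (El b)"
  by (simp add: Qbelow_def ll_def)

end

section \<open>Conditions\<close>

text \<open>\<open>dominates\<close> and \<open>fresh\<close> are clauses (3a) and (3b) of the order, \<open>le3\<close> and \<open>le4\<close> are (3) and (4).
  The relation \<open>le\<close> does not depend on the stage and induces the order of every \<open>\<P> R x\<close>, see \<open>leq_P\<close>.\<close>

definition fresh :: "('p, nat) fun_name \<Rightarrow> nat list \<Rightarrow> nat list \<Rightarrow> 'p formula" where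
  "fresh f t t' = (\<^bold>\<forall>n. ground (1 \<le> n \<and> length t \<le> n \<and> n < length t') \<^bold>\<longrightarrow>
     (\<^bold>\<exists>k. \<^bold>\<forall>j. in_interval j f k \<^bold>\<longrightarrow> ground (t' ! (n - 1) \<le> j \<and> j < t' ! n)))"

definition le3 :: "('a::order) set \<Rightarrow> ('a, 'i) cond \<Rightarrow> ('a, 'i) cond \<Rightarrow> 'a \<Rightarrow> bool" where
  "le3 R p q b \<longleftrightarrow> prefix (t_part q b) (t_part p b) \<and>
     (dominates (f_part p b) (f_part q b) \<^bold>\<and> fresh (f_part q b) (t_part q b) (t_part p b))
       (with_Cohen (\<P> R (El b))) (restr R p (El b), s_part p (rank R (El b)))"

definition le4 :: "('a::order, 'i) cond \<Rightarrow> ('a, 'i) cond \<Rightarrow> 'a \<Rightarrow> 'a \<Rightarrow> bool" where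
  "le4 p q b c \<longleftrightarrow> (\<forall>n. 1 \<le> n \<and> length (t_part q c) \<le> n \<and> n < length (t_part p c) \<longrightarrow>
     (\<exists>k. 1 \<le> k \<and> k < length (t_part p b) \<and>
        {t_part p b ! (k - 1)..<t_part p b ! k} \<subseteq> {t_part p c ! (n - 1)..<t_part p c ! n}))"

definition le :: "('a::order) set \<Rightarrow> ('a, 'i) cond \<Rightarrow> ('a, 'i) cond \<Rightarrow> bool" where
  "le R p q \<longleftrightarrow> supp q \<subseteq> supp p \<and> (\<forall>\<alpha>\<in>ranks R (supp q). prefix (s_part q \<alpha>) (s_part p \<alpha>)) \<and>
     (\<forall>b\<in>supp q. le3 R p q b) \<and>
     (\<forall>b\<in>supp q. \<forall>c\<in>supp q. b < c \<and> rank R (El b) = rank R (El c) \<longrightarrow> le4 p q b c)"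

definition good :: "('a::order) set \<Rightarrow> ('a, 'i) cond \<Rightarrow> bool" where
  "good R p \<longleftrightarrow> finite (supp p) \<and> dom (side p) = ranks R (supp p) \<and>
     (\<forall>b\<in>supp p. sorted_wrt (<) (t_part p b) \<and> incr_name (with_Cohen (\<P> R (El b))) (f_part p b))"

lemma conds_P: "p \<in> conds (\<P> R x) \<longleftrightarrow> good R p \<and> supp p \<subseteq> Qbelow R x"
  by (subst \<P>.simps) (auto simp: stage_def stage_conds_def good_def subset_iff)

lemma leq_P:
  assumes "supp q \<subseteq> Qbelow R x" shows "leq (\<P> R x) p q \<longleftrightarrow> le R p q"
proof -
  have "leq (\<P> R x) p q \<longleftrightarrow> stage_leq R (\<lambda>b. if b \<in> Qbelow R x then \<P> R (El b) else undefined) p q"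
    by (subst \<P>.simps) (simp add: stage_def)
  also have "\<dots> \<longleftrightarrow> le R p q"
    unfolding stage_leq_def le_def le3_def le4_def dominates_def fresh_def forces_def
    using assms by (intro conj_cong ball_cong refl) (auto simp: subset_iff)
  finally show ?thesis .
qed

section \<open>Products with Cohen forcing\<close>

lemma conds_with_Cohen: "x \<in> conds (with_Cohen P) \<longleftrightarrow> fst x \<in> conds P"
  by (cases x) (auto simp: with_Cohen_def)

lemma leq_with_Cohen: "leq (with_Cohen P) x y \<longleftrightarrow> leq P (fst x) (fst y) \<and> prefix (snd y) (snd x)"
  by (cases x; cases y) (auto simp: with_Cohen_def)

lemma forcing_notion_with_Cohen:
  assumes P: "forcing_notion P" shows "forcing_notion (with_Cohen P)"
  unfolding forcing_notion_def
proof (intro conjI)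
  show "conds (with_Cohen P) \<noteq> {}" using P by (auto simp: forcing_notion_def with_Cohen_def)
  show "reflp_on (conds (with_Cohen P)) (leq (with_Cohen P))"
    by (intro reflp_onI) (auto simp: leq_with_Cohen conds_with_Cohen leq_refl[OF P])
  show "transp_on (conds (with_Cohen P)) (leq (with_Cohen P))"
    by (intro transp_onI) (auto simp: leq_with_Cohen conds_with_Cohen intro: leq_trans[OF P])
qed

text \<open>There are countably many Cohen conditions \<open>s\<close>, and over a fixed
  \<open>s\<close> incompatible pairs have incompatible first coordinates.\<close>

lemma ccc_with_Cohen:
  assumes "ccc P" shows "ccc (with_Cohen P)"
  unfolding ccc_def
proof (intro allI impI)
  fix A assume A: "A \<subseteq> conds (with_Cohen P)"
    and anti: "\<forall>p\<in>A. \<forall>q\<in>A. p \<noteq> q \<longrightarrow> \<not> compat (with_Cohen P) p q"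
  have "countable {p. (p, s) \<in> A}" for s
  proof -
    have "\<not> compat P p q" if "(p, s) \<in> A" "(q, s) \<in> A" "p \<noteq> q" for p q
    proof
      assume "compat P p q"
      then obtain r where "r \<in> conds P" "leq P r p" "leq P r q" by (auto simp: compat_def)
      then have "compat (with_Cohen P) (p, s) (q, s)"
        unfolding compat_def by (intro bexI[of _ "(r, s)"]) (auto simp: conds_with_Cohen leq_with_Cohen)
      then show False using anti that by blast
    qed
    moreover have "{p. (p, s) \<in> A} \<subseteq> conds P" using A by (auto simp: conds_with_Cohen subset_iff)
    ultimately show ?thesis using assms unfolding ccc_def by blast
  qed
  then have "countable (\<Union>s. (\<lambda>p. (p, s)) ` {p. (p, s) \<in> A})" by simp
  moreover have "A = (\<Union>s. (\<lambda>p. (p, s)) ` {p. (p, s) \<in> A})" by auto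
  ultimately show "countable A" by simp
qed

definition in_int :: "'p forcing \<Rightarrow> (nat \<Rightarrow> 'p) \<Rightarrow> ('p, nat) fun_name \<Rightarrow> nat \<Rightarrow> nat \<Rightarrow> bool" where
  "in_int P G f n j \<longleftrightarrow> (\<exists>u v. ev P G f n u \<and> ev P G f (Suc n) v \<and> u \<le> j \<and> j < v)"

lemma in_int_iff: "total_name P G f \<Longrightarrow> in_int P G f n j \<longleftrightarrow> fn P G f n \<le> j \<and> j < fn P G f (Suc n)"
  by (simp add: in_int_def fn_iff)

section \<open>Clauses (3a) and (3b) along generic sequences\<close>

lemma repr_dominates:
  assumes P: "forcing_notion P"
  shows "repr P (dominates f g) (\<lambda>G. \<forall>n. \<exists>k. \<forall>j.
    in_int P G g k j \<longrightarrow>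
    in_int P G f n j)"
  unfolding dominates_def in_int_def by (intro repr_intros[OF P] repr_in_interval[OF P])

lemma repr_fresh:
  assumes P: "forcing_notion P"
  shows "repr P (fresh f t t') (\<lambda>G. \<forall>n. 1 \<le> n \<and> length t \<le> n \<and> n < length t' \<longrightarrow> (\<exists>k. \<forall>j.
    in_int P G f k j \<longrightarrow> t' ! (n - 1) \<le> j \<and> j < t' ! n))"
  unfolding fresh_def in_int_def by (intro repr_intros[OF P] repr_in_interval[OF P])

lemma dominates_refl:
  assumes P: "forcing_notion P" and p: "p \<in> conds P" shows "dominates f f P p"
  unfolding repr_forces[OF P repr_dominates[OF P] p] by (intro always_eventually) blast

lemma dominates_trans:
  assumes P: "forcing_notion P" and p: "p \<in> conds P"
    and "dominates f g P p" "dominates g h P p" shows "dominates f h P p"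
  using assms(3,4) unfolding repr_forces[OF P repr_dominates[OF P] p]
proof eventually_elim
  case (elim G)
  show ?case
  proof (intro impI allI)
    fix n assume m: "met P G p"
    obtain k where k: "\<forall>j. in_int P G g k j \<longrightarrow> in_int P G f n j" using elim(1) m by blast
    obtain l where "\<forall>j. in_int P G h l j \<longrightarrow> in_int P G g k j" using elim(2) m by blast
    with k show "\<exists>k. \<forall>j. in_int P G h k j \<longrightarrow> in_int P G f n j" by blast
  qed
qed

lemma fresh_trivial:
  assumes P: "forcing_notion P" and p: "p \<in> conds P" and "length t' \<le> length t"
  shows "fresh f t t' P p"
  unfolding repr_forces[OF P repr_fresh[OF P] p] using assms(3) by (intro always_eventually) simp

text \<open>This is where (3a) earns its place in the order: an interval of \<open>t''\<close> that
  is new over \<open>t'\<close> contains an interval of \<open>g\<close>, and this one contains an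
  interval of \<open>f\<close>.\<close>

lemma fresh_trans:
  assumes P: "forcing_notion P" and p: "p \<in> conds P" and pre: "prefix t t'" "prefix t' t''"
    and "dominates g f P p" "fresh f t t' P p" "fresh g t' t'' P p"
  shows "fresh f t t'' P p"
  using assms(5-7) unfolding repr_forces[OF P repr_fresh[OF P] p] repr_forces[OF P repr_dominates[OF P] p]
proof eventually_elim
  case (elim G)
  show ?case
  proof (intro impI allI)
    fix n assume m: "met P G p" and n: "1 \<le> n \<and> length t \<le> n \<and> n < length t''"
    show "\<exists>k. \<forall>j. in_int P G f k j \<longrightarrow> t'' ! (n - 1) \<le> j \<and> j < t'' ! n"
    proof (cases "n < length t'")
      case True
      then have "t'' ! n = t' ! n" "t'' ! (n - 1) = t' ! (n - 1)"
        using pre(2) by (auto simp: prefix_def nth_append)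
      then show ?thesis using elim(2) m n True by auto
    next
      case False
      then obtain k where k: "\<forall>j. in_int P G g k j \<longrightarrow> t'' ! (n - 1) \<le> j \<and> j < t'' ! n"
        using elim(3) m n by (meson not_less)
      obtain l where "\<forall>j. in_int P G f l j \<longrightarrow>
        in_int P G g k j" using elim(1) m by blast
      then have "\<forall>j. in_int P G f l j \<longrightarrow> t'' ! (n - 1) \<le> j \<and> j < t'' ! n"
        using k by meson
      then show ?thesis by (rule exI)
    qed
  qed
qed

section \<open>Restrictions of conditions\<close>

lemma finite_supp: "good R p \<Longrightarrow> finite (supp p)" by (simp add: good_def)

lemma ranksI: "b \<in> F \<Longrightarrow> rank R (El b) \<in> ranks R F" by (simp add: ranks_def)

lemma supp_restr: "supp (restr R p x) = supp p \<inter> Qbelow R x"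
  by (auto simp: restr_def supp_def Let_def)

lemma main_restr: "b \<in> Qbelow R x \<Longrightarrow> main (restr R p x) b = main p b"
  by (cases "main p b") (auto simp: restr_def supp_def Let_def restrict_map_def)

lemma parts_restr:
  assumes "b \<in> Qbelow R x"
  shows "t_part (restr R p x) b = t_part p b" "f_part (restr R p x) b = f_part p b"
  using main_restr[OF assms, of p] by (simp_all add: t_part_def f_part_def)

lemma s_part_restr:
  assumes "\<alpha> \<in> ranks R (supp p \<inter> Qbelow R x)" shows "s_part (restr R p x) \<alpha> = s_part p \<alpha>"
  using assms by (simp add: restr_def s_part_def Let_def)

lemma good_restr: "good R p \<Longrightarrow> good R (restr R p x)"
proof -
  assume g: "good R p"
  have "dom (side (restr R p x)) = ranks R (supp p \<inter> Qbelow R x)"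
    using g by (auto simp: restr_def good_def Let_def ranks_def)
  then show ?thesis using g by (auto simp: good_def supp_restr parts_restr)
qed

lemma restr_conds: "good R p \<Longrightarrow> restr R p x \<in> conds (\<P> R x)"
  by (simp add: conds_P good_restr supp_restr)

lemma cond_eqI: "side p = side q \<Longrightarrow> main p = main q \<Longrightarrow> p = q"
  by (cases p; cases q) auto

lemma restr_eq_self:
  assumes "good R p" "supp p \<subseteq> Qbelow R x" shows "restr R p x = p"
proof (rule cond_eqI)
  have F: "supp p \<inter> Qbelow R x = supp p" using assms by blast
  have dom: "m |` dom m = m" for m :: "'k \<rightharpoonup> 'v"
  proof
    fix x show "(m |` dom m) x = m x" by (cases "m x") (auto simp: restrict_map_def)
  qed
  show "main (restr R p x) = main p"
    unfolding restr_def Let_def F by (simp add: supp_def dom)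
  show "side (restr R p x) = side p"
    unfolding restr_def Let_def F using assms(1) dom[of "side p"] by (simp add: good_def)
qed

section \<open>Operations on conditions\<close>

definition amalg :: "('a, 'i) cond \<Rightarrow> ('a, 'i) cond \<Rightarrow> ('a, 'i) cond" where
  "amalg p q = Cond (side p ++ side q) (main p ++ main q)"

definition set_s :: "('a, 'i) cond \<Rightarrow> 'a ordi \<Rightarrow> bool list \<Rightarrow> ('a, 'i) cond" where
  "set_s p \<beta> s = Cond ((side p)(\<beta> \<mapsto> s)) (main p)"

definition upd :: "('a, 'i) cond \<Rightarrow> 'a \<Rightarrow> nat list \<Rightarrow> ('i \<Rightarrow> (('a, 'i) cond \<times> bool list) \<times> nat \<times> nat) \<Rightarrow> ('a, 'i) cond" where
  "upd p b t g = Cond (side p) ((main p)(b \<mapsto> (t, g)))"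

text \<open>An absent Cohen part counts as empty. Thus the projection to \<open>P_b * C\<close> is
  defined also on conditions without \<open>b\<close> and is monotone, see
  \<open>s_of_prefix\<close>.\<close>

definition s_of :: "('a, 'i) cond \<Rightarrow> 'a ordi \<Rightarrow> bool list" where
  "s_of p \<alpha> = (case side p \<alpha> of None \<Rightarrow> [] | Some s \<Rightarrow> s)"

text \<open>The Cohen part at the rank of \<open>b\<close> may already be present through another
  element of that rank, and then it has to be kept.\<close>

definition add_elem :: "('a::order) set \<Rightarrow> ('a, 'i) cond \<Rightarrow> 'a \<Rightarrow> ('i \<Rightarrow> (('a, 'i) cond \<times> bool list) \<times> nat \<times> nat) \<Rightarrow> ('a, 'i) cond" where
  "add_elem R p b g = Cond ((side p)(rank R (El b) \<mapsto> s_of p (rank R (El b)))) ((main p)(b \<mapsto> ([], g)))"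

lemma ranks_Un: "ranks R (A \<union> B) = ranks R A \<union> ranks R B" by (auto simp: ranks_def)

lemma stage_conds_pair:
  "good R p \<Longrightarrow> (restr R p x, s) \<in> conds (with_Cohen (\<P> R x))"
  by (simp add: conds_with_Cohen restr_conds)

lemma s_of_eq: "good R p \<Longrightarrow> \<alpha> \<in> ranks R (supp p) \<Longrightarrow> s_of p \<alpha> = s_part p \<alpha>"
  by (auto simp: good_def s_of_def s_part_def split: option.split)

lemma s_of_prefix:
  assumes "good R p" "good R q" "le R p q" shows "prefix (s_of q \<alpha>) (s_of p \<alpha>)"
proof (cases "\<alpha> \<in> ranks R (supp q)")
  case True
  then have "\<alpha> \<in> ranks R (supp p)" using assms(3) by (auto simp: le_def ranks_def)
  then have "side p \<alpha> \<noteq> None" "side q \<alpha> \<noteq> None" using True assms(1,2) by (auto simp: good_def)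
  then show ?thesis using True assms(3) by (auto simp: le_def s_of_def s_part_def)
next
  case False
  then have "side q \<alpha> = None" using assms(2) by (auto simp: good_def)
  then show ?thesis by (simp add: s_of_def)
qed

lemma le4_same: "main p c = main q c \<Longrightarrow> le4 p q b c"
  by (simp add: le4_def t_part_def)

lemma supp_amalg: "supp (amalg p q) = supp p \<union> supp q"
  by (auto simp: amalg_def supp_def)

lemma main_amalg: "main (amalg p q) b = (if b \<in> supp q then main q b else main p b)"
  by (auto simp: amalg_def supp_def map_add_def split: option.splits)

lemma s_part_amalg:
  "good R q \<Longrightarrow> s_part (amalg p q) \<alpha> = (if \<alpha> \<in> ranks R (supp q) then s_part q \<alpha> else s_part p \<alpha>)"
  unfolding good_def s_part_def amalg_def by (auto simp: map_add_def split: option.splits)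

lemma good_amalg:
  assumes "good R p" "good R q" shows "good R (amalg p q)"
proof -
  have "dom (side (amalg p q)) = ranks R (supp p \<union> supp q)"
    using assms by (auto simp: amalg_def good_def ranks_Un)
  moreover have "sorted_wrt (<) (t_part (amalg p q) b) \<and> incr_name (with_Cohen (\<P> R (El b))) (f_part (amalg p q) b)"
    if "b \<in> supp p \<union> supp q" for b
    using assms that unfolding good_def t_part_def f_part_def main_amalg by auto
  ultimately show ?thesis using assms by (auto simp: good_def supp_amalg)
qed

text \<open>Elements of \<open>Q_b\<close> have smaller rank than \<open>b\<close>, so the Cohen
  part at the rank of \<open>b\<close> is invisible in \<open>P_b\<close>.\<close>

lemma restr_set_s:
  assumes "\<beta> = rank R (El b)" shows "restr R (set_s p \<beta> s) (El b) = restr R p (El b)"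
proof -
  have "\<beta> \<notin> ranks R (supp p \<inter> Qbelow R (El b))" using assms by (auto simp: ranks_def Qbelow_def ll_def)
  then show ?thesis by (simp add: restr_def set_s_def supp_def Let_def)
qed

lemma supp_upd: "supp (upd p b t g) = insert b (supp p)"
  by (auto simp: upd_def supp_def)

lemma parts_upd:
  "t_part (upd p b t g) c = (if c = b then t else t_part p c)"
  "f_part (upd p b t g) c = (if c = b then range g else f_part p c)"
  "s_part (upd p b t g) \<alpha> = s_part p \<alpha>"
  by (simp_all add: upd_def t_part_def f_part_def s_part_def)

lemma supp_add_elem: "supp (add_elem R p b g) = insert b (supp p)"
  by (auto simp: add_elem_def supp_def)

lemma main_add_elem: "c \<noteq> b \<Longrightarrow> main (add_elem R p b g) c = main p c"
  by (simp add: add_elem_def)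

lemma parts_add_elem:
  "t_part (add_elem R p b g) b = []" "f_part (add_elem R p b g) b = range g"
  by (simp_all add: add_elem_def t_part_def f_part_def)

section \<open>The order and its basic extensions\<close>

context
  fixes R :: "'a::order set"
  assumes R: "wfp_on R (<)"
begin

lemma restr_restr:
  assumes "c \<in> Qbelow R x" shows "restr R (restr R p x) (El c) = restr R p (El c)"
proof -
  have "supp p \<inter> Qbelow R x \<inter> Qbelow R (El c) = supp p \<inter> Qbelow R (El c)"
    using Qbelow_trans[OF R assms] by blast
  moreover from this have "supp p \<inter> Qbelow R x \<inter> (supp p \<inter> Qbelow R (El c)) = supp p \<inter> Qbelow R (El c)" by blast
  moreover have "ranks R (supp p \<inter> Qbelow R (El c)) \<subseteq> ranks R (supp p \<inter> Qbelow R x)"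
    using Qbelow_trans[OF R assms] by (auto simp: ranks_def)
  ultimately show ?thesis
    unfolding restr_def[of R "restr R p x"] Let_def supp_restr
    by (simp add: restr_def Let_def Int_absorb1)
qed

lemma le_restr:
  assumes "le R p q" shows "le R (restr R p x) (restr R q x)"
proof -
  have sub: "supp q \<subseteq> supp p" using assms by (simp add: le_def)
  have s: "s_part (restr R p x) \<alpha> = s_part p \<alpha>" "s_part (restr R q x) \<alpha> = s_part q \<alpha>" "\<alpha> \<in> ranks R (supp q)"
    if "\<alpha> \<in> ranks R (supp q \<inter> Qbelow R x)" for \<alpha>
    using that sub by (auto intro!: s_part_restr simp: ranks_def)
  have "le3 R (restr R p x) (restr R q x) b" if b: "b \<in> supp q" "b \<in> Qbelow R x" for b
    using assms b s(1)[OF ranksI[of b]] by (simp add: le3_def le_def parts_restr restr_restr)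
  moreover have "le4 (restr R p x) (restr R q x) b c"
    if "b \<in> supp q" "b \<in> Qbelow R x" "c \<in> supp q" "c \<in> Qbelow R x" "b < c" "rank R (El b) = rank R (El c)" for b c
    using assms that by (simp add: le4_def le_def parts_restr)
  ultimately show ?thesis
    using assms s sub unfolding le_def supp_restr by auto
qed

text \<open>That \<open>P_b\<close> is a preorder is an assumption here, because the lemma is used
  in the induction that proves it.\<close>

lemma le3_same':
  assumes "forcing_notion (\<P> R (El b) :: ('a, 'i) cond forcing)"
    and "good R (p :: ('a, 'i) cond)" "main p b = main q b"
  shows "le3 R p q b"
proof -
  have parts: "t_part q b = t_part p b" "f_part q b = f_part p b"
    using assms(3) by (simp_all add: t_part_def f_part_def)
  note C = stage_conds_pair[OF assms(2)] and F = forcing_notion_with_Cohen[OF assms(1)]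
  show ?thesis
    unfolding le3_def parts fconj_def using dominates_refl[OF F C] fresh_trivial[OF F C] by simp
qed

text \<open>The order of \<open>P_x\<close> refers to forcing over \<open>P_b * C\<close> for
  \<open>b\<close> in \<open>Q_x\<close> only, so induction on the rank applies.\<close>

lemma forcing_notion_P: "forcing_notion (\<P> R x :: ('a, 'i) cond forcing)"
proof (induction x rule: measure_induct_rule[where f = "rank R"])
  case (less x)
  have F: "forcing_notion (\<P> R (El b) :: ('a, 'i) cond forcing)" if "b \<in> Qbelow R x" for b
    using less that by (simp add: Qbelow_def ll_def)
  let ?P = "\<P> R x :: ('a, 'i) cond forcing"
  show ?case unfolding forcing_notion_def
  proof (intro conjI)
    have "Cond Map.empty Map.empty \<in> conds ?P"
      by (simp add: conds_P good_def supp_def ranks_def)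
    then show "conds ?P \<noteq> {}" by blast
    show "reflp_on (conds ?P) (leq ?P)"
    proof (rule reflp_onI)
      fix p assume "p \<in> conds ?P"
      then have p: "good R p" "supp p \<subseteq> Qbelow R x" by (simp_all add: conds_P)
      then have "le R p p"
        unfolding le_def using le3_same'[OF F p(1) refl] le4_same[of p] by (auto simp: subset_iff)
      then show "leq ?P p p" using leq_P p by blast
    qed
    show "transp_on (conds ?P) (leq ?P)"
    proof (rule transp_onI)
      fix p q r assume "p \<in> conds ?P" "q \<in> conds ?P" "r \<in> conds ?P" and l: "leq ?P p q" "leq ?P q r"
      then have g: "good R p" "good R q" "good R r"
        and S: "supp p \<subseteq> Qbelow R x" "supp q \<subseteq> Qbelow R x" "supp r \<subseteq> Qbelow R x" by (simp_all add: conds_P)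
      have pq: "le R p q" and qr: "le R q r" using l leq_P[OF S(2)] leq_P[OF S(3)] by simp_all
      have sub: "supp q \<subseteq> supp p" "supp r \<subseteq> supp q" using pq qr by (auto simp: le_def)
      have sp: "prefix (s_part q \<alpha>) (s_part p \<alpha>)" if "\<alpha> \<in> ranks R (supp q)" for \<alpha>
        using pq that by (auto simp: le_def)
      have sq: "prefix (s_part r \<alpha>) (s_part q \<alpha>)" "\<alpha> \<in> ranks R (supp q)" if "\<alpha> \<in> ranks R (supp r)" for \<alpha>
        using qr that sub by (auto simp: le_def ranks_def)
      have "le3 R p r b" if b: "b \<in> supp r" for b
      proof -
        let ?C = "with_Cohen (\<P> R (El b)) :: (('a, 'i) cond \<times> bool list) forcing"
        let ?p = "(restr R p (El b), s_part p (rank R (El b)))"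
        let ?q = "(restr R q (El b), s_part q (rank R (El b)))"
        have C: "forcing_notion ?C" using forcing_notion_with_Cohen F b S by blast
        have c: "?p \<in> conds ?C" "?q \<in> conds ?C" using stage_conds_pair g by blast+
        have "leq (\<P> R (El b)) (restr R p (El b)) (restr R q (El b))"
          using le_restr[OF pq] leq_P[of "restr R q (El b)" R "El b"] by (simp add: supp_restr)
        then have le: "leq ?C ?p ?q" using sp[OF ranksI] sub b by (auto simp: leq_with_Cohen)
        have 1: "prefix (t_part q b) (t_part p b)" "dominates (f_part p b) (f_part q b) ?C ?p"
           "fresh (f_part q b) (t_part q b) (t_part p b) ?C ?p"
          using pq b sub by (auto simp: le_def le3_def fconj_def)
        have "prefix (t_part r b) (t_part q b)" "dominates (f_part q b) (f_part r b) ?C ?q"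
           "fresh (f_part r b) (t_part r b) (t_part q b) ?C ?q"
          using qr b sub by (auto simp: le_def le3_def fconj_def)
        \<comment> \<open>What the restriction of \<open>q\<close> forces is also forced by the
          stronger restriction of \<open>p\<close>, by regularity; now both sets of statements
          concern the same condition.\<close>
        then have 2: "prefix (t_part r b) (t_part q b)" "dominates (f_part q b) (f_part r b) ?C ?p"
           "fresh (f_part r b) (t_part r b) (t_part q b) ?C ?p"
          using regular_mono[OF C _ _ le c(2,1)] repr_dominates[OF C] repr_fresh[OF C]
          unfolding repr_def by blast+
        show ?thesis unfolding le3_def fconj_def
          using 1 2 dominates_trans[OF C c(1)] fresh_trans[OF C c(1)] prefix_order.trans by blast
      qed
      moreover have "le4 p r b c" if bc: "b \<in> supp r" "c \<in> supp r" "b < c" "rank R (El b) = rank R (El c)" for b c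
        unfolding le4_def
      proof (intro allI impI)
        fix n assume n: "1 \<le> n \<and> length (t_part r c) \<le> n \<and> n < length (t_part p c)"
        have bc': "b \<in> supp q" "c \<in> supp q" using bc sub by auto
        have pr: "prefix (t_part q b) (t_part p b)" "prefix (t_part q c) (t_part p c)"
          using pq bc' by (auto simp: le_def le3_def)
        have l1: "le4 p q b c" and l2: "le4 q r b c" using pq qr bc bc' unfolding le_def by blast+
        show "\<exists>k. 1 \<le> k \<and> k < length (t_part p b) \<and>
          {t_part p b ! (k - 1)..<t_part p b ! k} \<subseteq> {t_part p c ! (n - 1)..<t_part p c ! n}"
        proof (cases "n < length (t_part q c)")
          case False
          then show ?thesis using l1 n by (simp add: le4_def)
        next
          case True
          then obtain k where k: "1 \<le> k" "k < length (t_part q b)"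
            "{t_part q b ! (k - 1)..<t_part q b ! k} \<subseteq> {t_part q c ! (n - 1)..<t_part q c ! n}"
            using l2 n unfolding le4_def by blast
          have "t_part p c ! n = t_part q c ! n" "t_part p c ! (n - 1) = t_part q c ! (n - 1)"
            "t_part p b ! k = t_part q b ! k" "t_part p b ! (k - 1) = t_part q b ! (k - 1)"
            using pr True k(2) by (auto simp: prefix_def nth_append)
          moreover have "k < length (t_part p b)" using pr(1) k(2) by (auto simp: prefix_def)
          ultimately show ?thesis using k by (intro exI[of _ k]) simp
        qed
      qed
      moreover have "\<forall>\<alpha>\<in>ranks R (supp r). prefix (s_part r \<alpha>) (s_part p \<alpha>)"
        using sp sq prefix_order.trans by blast
      ultimately have "le R p r" unfolding le_def using sub by blast
      then show "leq ?P p r" using leq_P[OF S(3)] by blast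
    qed
  qed
qed

lemma forcing_notion_PC: "forcing_notion (with_Cohen (\<P> R x) :: (('a, 'i) cond \<times> bool list) forcing)"
  by (rule forcing_notion_with_Cohen[OF forcing_notion_P])

lemma le3_same: "good R p \<Longrightarrow> main p b = main q b \<Longrightarrow> le3 R p q b"
  by (rule le3_same'[OF forcing_notion_P])

lemma le_same_main:
  assumes "good R p" "supp q \<subseteq> supp p" "\<And>b. b \<in> supp q \<Longrightarrow> main p b = main q b"
    and "\<And>\<alpha>. \<alpha> \<in> ranks R (supp q) \<Longrightarrow> prefix (s_part q \<alpha>) (s_part p \<alpha>)"
  shows "le R p q"
  unfolding le_def using assms le3_same[OF assms(1)] le4_same by blast

lemma le_restr_self: "good R p \<Longrightarrow> le R p (restr R p x)"
  by (rule le_same_main) (auto simp: supp_restr main_restr s_part_restr)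

lemma le_refl: "good R p \<Longrightarrow> le R p p"
  by (rule le_same_main) auto

text \<open>Without the assumption on ranks, \<open>q\<close> might contradict the Cohen part of \<open>p\<close> at a rank that
  occurs in \<open>p\<close> only outside \<open>Q\<^sub>b\<close>.\<close>

lemma amalg_extends:
  assumes p: "good R p" and q: "good R q" "supp q \<subseteq> Qbelow R (El b)" and le: "le R q (restr R p (El b))"
    and rk: "ranks R (supp p) \<inter> ranks R (Qbelow R (El b)) \<subseteq> ranks R (supp p \<inter> Qbelow R (El b))"
  shows "good R (amalg p q)" "le R (amalg p q) p" "restr R (amalg p q) (El b) = q"
proof -
  let ?r = "amalg p q"
  show r: "good R ?r" by (rule good_amalg[OF p q(1)])
  have sub: "supp p \<inter> Qbelow R (El b) \<subseteq> supp q" using le by (auto simp: le_def supp_restr)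
  then have F: "supp ?r \<inter> Qbelow R (El b) = supp q" using q(2) by (auto simp: supp_amalg)
  show rq: "restr R ?r (El b) = q"
  proof (rule cond_eqI)
    have "(side p ++ side q) |` dom (side q) = side q"
      by (rule ext) (auto simp: restrict_map_def map_add_def dom_def split: option.splits)
    then show "side (restr R ?r (El b)) = side q"
      using q(1) unfolding restr_def Let_def F by (simp add: amalg_def good_def)
    show "main (restr R ?r (El b)) = main q"
    proof
      fix c show "main (restr R ?r (El b)) c = main q c"
      proof (cases "c \<in> supp q")
        case True
        then show ?thesis using q(2) main_restr[of c R "El b" ?r] by (auto simp: main_amalg)
      next
        case False
        then have "c \<notin> supp (restr R ?r (El b))" using F by (simp add: supp_restr)
        then have "main (restr R ?r (El b)) c = None" unfolding supp_def by blast
        moreover have "main q c = None" using False unfolding supp_def by blast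
        ultimately show ?thesis by simp
      qed
    qed
  qed
  have s: "prefix (s_part p \<alpha>) (s_part ?r \<alpha>)" if \<alpha>: "\<alpha> \<in> ranks R (supp p)" for \<alpha>
  proof (cases "\<alpha> \<in> ranks R (supp q)")
    case True
    then have "\<alpha> \<in> ranks R (supp p \<inter> Qbelow R (El b))" using \<alpha> rk q(2) by (auto simp: ranks_def)
    then have "prefix (s_part p \<alpha>) (s_part q \<alpha>)"
      using le by (auto simp: le_def supp_restr s_part_restr)
    then show ?thesis using True by (simp add: s_part_amalg[OF q(1)])
  qed (simp add: s_part_amalg[OF q(1)])
  have parts: "t_part ?r c = t_part q c" "f_part ?r c = f_part q c" if "c \<in> supp q" for c
    using that by (simp_all add: t_part_def f_part_def main_amalg)
  have l3: "le3 R ?r p c" if c: "c \<in> supp p" for c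
  proof (cases "c \<in> Qbelow R (El b)")
    case True
    then have cq: "c \<in> supp q" using sub c by blast
    have "le3 R q (restr R p (El b)) c" using le c True by (auto simp: le_def supp_restr)
    moreover have "restr R ?r (El c) = restr R q (El c)" using restr_restr[OF True, of ?r] rq by simp
    moreover have "s_part ?r (rank R (El c)) = s_part q (rank R (El c))"
      using ranksI[OF cq] by (simp add: s_part_amalg[OF q(1)])
    ultimately show ?thesis using True by (simp add: le3_def parts[OF cq] parts_restr)
  next
    case False
    then have "main ?r c = main p c" using q(2) by (auto simp: main_amalg)
    then show ?thesis by (rule le3_same[OF r])
  qed
  \<comment> \<open>If \<open>d\<close> lies outside \<open>Q_b\<close>, its sequence is unchanged
    and (4) is vacuous. If it lies inside, then so does \<open>c\<close>, and (4) is inherited from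
    \<open>q\<close>.\<close>
  have l4: "le4 ?r p c d" if cd: "c \<in> supp p" "d \<in> supp p" "c < d" "rank R (El c) = rank R (El d)" for c d
  proof (cases "d \<in> Qbelow R (El b)")
    case True
    then have c: "c \<in> Qbelow R (El b)" using Qbelow_down[OF R] cd(3) by blast
    then have "le4 q (restr R p (El b)) c d" using le cd True by (auto simp: le_def supp_restr)
    then show ?thesis using c True sub cd by (simp add: le4_def parts parts_restr subset_iff)
  next
    case False
    then have "main ?r d = main p d" using q(2) by (auto simp: main_amalg)
    then show ?thesis by (rule le4_same)
  qed
  show "le R ?r p" unfolding le_def using s l3 l4 by (auto simp: supp_amalg)
qed

lemma set_s_extends:
  assumes p: "good R p" and "\<beta> \<in> ranks R (supp p)" "prefix (s_part p \<beta>) s"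
  shows "good R (set_s p \<beta> s)" "le R (set_s p \<beta> s) p" "supp (set_s p \<beta> s) = supp p"
    "main (set_s p \<beta> s) = main p" "s_part (set_s p \<beta> s) \<alpha> = (if \<alpha> = \<beta> then s else s_part p \<alpha>)"
proof -
  let ?r = "set_s p \<beta> s"
  show S: "supp ?r = supp p" and M: "main ?r = main p" by (simp_all add: set_s_def supp_def)
  show s: "s_part ?r \<alpha> = (if \<alpha> = \<beta> then s else s_part p \<alpha>)" for \<alpha> by (simp add: set_s_def s_part_def)
  show g: "good R ?r" using p assms(2) unfolding good_def S t_part_def f_part_def M
    by (auto simp: set_s_def)
  show "le R ?r p" by (rule le_same_main[OF g]) (use S M s assms in auto)
qed

lemma restr_upd: "restr R (upd p b t g) (El b) = restr R p (El b)"
proof -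
  have b: "b \<notin> Qbelow R (El b)" by (rule Qbelow_irrefl[OF R])
  then have "supp (upd p b t g) \<inter> Qbelow R (El b) = supp p \<inter> Qbelow R (El b)" by (auto simp: supp_upd)
  then show ?thesis using b by (simp add: restr_def Let_def upd_def)
qed

text \<open>A change at \<open>b\<close> matters for (4) only in pairs with \<open>b\<close> as the
  upper element; in other pairs the upper sequence gets no new interval. As \<open>b\<close> is not
  in \<open>Q_b\<close>, the forcing statements in (3) are judged by the old restriction of
  \<open>p\<close>.\<close>

lemma upd_extends:
  assumes p: "good R p" and b: "b \<in> supp p"
    and t: "sorted_wrt (<) t" and g: "incr_name (with_Cohen (\<P> R (El b))) (range g)"
  shows "good R (upd p b t g)"
    and "prefix (t_part p b) t \<Longrightarrow>
      dominates (range g) (f_part p b) (with_Cohen (\<P> R (El b))) (restr R p (El b), s_part p (rank R (El b))) \<Longrightarrow>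
      fresh (f_part p b) (t_part p b) t (with_Cohen (\<P> R (El b))) (restr R p (El b), s_part p (rank R (El b))) \<Longrightarrow>
      (\<And>c. c \<in> supp p \<Longrightarrow> c < b \<Longrightarrow> rank R (El c) = rank R (El b) \<Longrightarrow> le4 (upd p b t g) p c b) \<Longrightarrow>
      le R (upd p b t g) p"
proof -
  let ?r = "upd p b t g"
  have S: "supp ?r = supp p" using b by (auto simp: supp_upd)
  show r: "good R ?r"
    using p b t g by (auto simp: good_def S parts_upd) (auto simp: upd_def)
  assume pre: "prefix (t_part p b) t"
    and d: "dominates (range g) (f_part p b) (with_Cohen (\<P> R (El b))) (restr R p (El b), s_part p (rank R (El b)))"
    and f: "fresh (f_part p b) (t_part p b) t (with_Cohen (\<P> R (El b))) (restr R p (El b), s_part p (rank R (El b)))"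
    and l4: "\<And>c. c \<in> supp p \<Longrightarrow> c < b \<Longrightarrow> rank R (El c) = rank R (El b) \<Longrightarrow> le4 ?r p c b"
  have "le3 R ?r p c" if "c \<in> supp p" for c
  proof (cases "c = b")
    case True
    then show ?thesis using pre d f by (simp add: le3_def parts_upd restr_upd fconj_def)
  next
    case False
    then show ?thesis by (intro le3_same[OF r]) (simp add: upd_def)
  qed
  moreover have "le4 ?r p c d" if "c \<in> supp p" "d \<in> supp p" "c < d" "rank R (El c) = rank R (El d)" for c d
  proof (cases "d = b")
    case False
    then show ?thesis by (intro le4_same) (simp add: upd_def)
  qed (use that l4 in simp)
  ultimately show "le R ?r p" unfolding le_def S by (auto simp: parts_upd)
qed

lemma add_elem_extends:
  assumes p: "good R p" and b: "b \<notin> supp p" and g: "incr_name (with_Cohen (\<P> R (El b))) (range g)"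
  shows "good R (add_elem R p b g)" "le R (add_elem R p b g) p"
proof -
  let ?r = "add_elem R p b g"
  have "sorted_wrt (<) (t_part ?r c) \<and> incr_name (with_Cohen (\<P> R (El c))) (f_part ?r c)" if "c \<in> supp ?r" for c
  proof (cases "c = b")
    case False
    then have "t_part ?r c = t_part p c" "f_part ?r c = f_part p c" "c \<in> supp p"
      using that by (simp_all add: t_part_def f_part_def main_add_elem supp_add_elem)
    then show ?thesis using p by (simp add: good_def)
  qed (use g in \<open>simp add: parts_add_elem\<close>)
  moreover have "dom (side ?r) = ranks R (supp ?r)"
    using p by (auto simp: supp_add_elem ranks_def good_def) (auto simp: add_elem_def)
  ultimately show r: "good R ?r" using p by (simp add: good_def supp_add_elem)
  show "le R ?r p"
  proof (rule le_same_main[OF r])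
    show "supp p \<subseteq> supp ?r" by (auto simp: supp_add_elem)
    show "main ?r c = main p c" if "c \<in> supp p" for c using that b by (intro main_add_elem) auto
    fix \<alpha> assume "\<alpha> \<in> ranks R (supp p)"
    then have "s_part ?r \<alpha> = s_part p \<alpha>"
      using s_of_eq[OF p] by (auto simp: add_elem_def s_part_def)
    then show "prefix (s_part p \<alpha>) (s_part ?r \<alpha>)" by simp
  qed
qed

end

section \<open>The countable chain condition\<close>

text \<open>An injection of the natural numbers into \<open>'i\<close> has a left inverse that maps
  \<open>'i\<close> onto them; this is composed with an enumeration of
  \<open>\<tau>\<close>.\<close>

lemma range_countable:
  assumes "infinite (UNIV :: 'i set)" "countable \<tau>" "\<tau> \<noteq> {}" shows "\<exists>g :: 'i \<Rightarrow> _. range g = \<tau>"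
proof -
  obtain f :: "nat \<Rightarrow> 'i" where "inj f" using infinite_countable_subset[OF assms(1)] by blast
  then have "range (inv f) = UNIV" by (rule inj_imp_surj_inv)
  then have "range (\<lambda>i. from_nat_into \<tau> (inv f i)) = range (from_nat_into \<tau>)"
    by (metis image_image)
  also have "\<dots> = \<tau>" using assms(2,3) by (rule range_from_nat_into[rotated])
  finally show ?thesis by blast
qed

lemma incr_name_total:
  assumes P: "forcing_notion P" and f: "incr_name P f"
  shows "\<forall>\<^sub>F G in gen P. total_name P G f \<and> strict_mono (fn P G f)"
  using f repr_forced[OF P repr_in_incr[OF P]] by (simp add: incr_name_def)

lemma incr_name_exists:
  fixes P :: "'p forcing"
  assumes index: "infinite (UNIV :: 'i set)" and P: "forcing_notion P" and ccc: "ccc P"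
    and V: "\<And>n. meas P (\<lambda>G. V G n)" and mono: "\<forall>\<^sub>F G in gen P. strict_mono (V G)"
  shows "\<exists>g :: 'i \<Rightarrow> 'p \<times> nat \<times> nat. incr_name P (range g) \<and>
    (\<forall>\<^sub>F G in gen P. total_name P G (range g) \<and> fn P G (range g) = V G)"
proof -
  obtain \<tau> :: "('p, nat) fun_name" where \<tau>: "countable \<tau>" "fst ` \<tau> \<subseteq> conds P"
    "\<forall>\<^sub>F G in gen P. \<forall>n v. ev P G \<tau> n v \<longleftrightarrow> V G n = v"
    by (rule name_exists[OF P ccc V])
  \<comment> \<open>The name has to be nonempty in order to be the range of a function on
    \<open>'i\<close>; its evaluation along one sequence shows that it is.\<close>
  obtain p where "p \<in> conds P" using P by (auto simp: forcing_notion_def)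
  then obtain G where "\<forall>n v. ev P G \<tau> n v \<longleftrightarrow> V G n = v" using generic_exists[OF P _ \<tau>(3)] by blast
  then have "ev P G \<tau> 0 (V G 0)" by blast
  then have "\<tau> \<noteq> {}" by (auto simp: ev_def)
  then obtain g :: "'i \<Rightarrow> 'p \<times> nat \<times> nat" where g: "range g = \<tau>" using range_countable[OF index \<tau>(1)] by blast
  have tot: "\<forall>\<^sub>F G in gen P. total_name P G \<tau> \<and> fn P G \<tau> = V G"
    using \<tau>(3)
  proof eventually_elim
    case (elim G)
    then have "fn P G \<tau> n = V G n" for n by (intro fn_eqI) blast
    then show ?case using elim by (auto simp: total_name_def)
  qed
  with mono have "\<forall>\<^sub>F G in gen P. total_name P G \<tau> \<and> strict_mono (fn P G \<tau>)" by eventually_elim simp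
  then have "incr_name P \<tau>" unfolding incr_name_def repr_forced[OF P repr_in_incr[OF P]] using \<tau>(2) by blast
  then show ?thesis using tot g by blast
qed

text \<open>Supplies the name component when a new element is added to the support of a
  condition.\<close>

lemma id_name:
  assumes "infinite (UNIV :: 'i set)" "forcing_notion P" "ccc P"
  shows "\<exists>g :: 'i \<Rightarrow> _. incr_name P (range g)"
proof -
  have "\<And>n. meas P (\<lambda>G. (\<lambda>G n. n) G n)" by (rule meas_const[OF assms(2)])
  from incr_name_exists[OF assms, of "\<lambda>G n. n", OF this] show ?thesis
    by (auto simp: strict_mono_def)
qed

lemma dominatesI:
  assumes P: "forcing_notion P" and p: "p \<in> conds P"
    and "\<forall>\<^sub>F G in gen P. total_name P G f \<and> total_name P G g \<and>
      (\<forall>n. \<exists>k. {fn P G g k..<fn P G g (Suc k)} \<subseteq> {fn P G f n..<fn P G f (Suc n)})"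
  shows "dominates f g P p"
  unfolding repr_forces[OF P repr_dominates[OF P] p] using assms(3)
proof eventually_elim
  case (elim G)
  then show ?case by (simp add: in_int_iff subset_iff)
qed

text \<open>The merged partition is at first only a functional of the generic sequence; ccc turns it
  into a name that fits into a condition. Hence the induction on the rank in
  \<open>ccc_P\<close>.\<close>

lemma merge_names:
  fixes P :: "'p forcing"
  assumes index: "infinite (UNIV :: 'i set)" and P: "forcing_notion P" and ccc: "ccc P"
    and f: "incr_name P f" and g: "incr_name P g"
  shows "\<exists>h :: 'i \<Rightarrow> _. incr_name P (range h) \<and>
    (\<forall>p\<in>conds P. dominates (range h) f P p \<and> dominates (range h) g P p)"
proof -
  note tf = incr_name_total[OF P f] and tg = incr_name_total[OF P g]
  have "meas P (\<lambda>G. fn P G f n)" for n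
    by (rule meas_fn[OF P], rule eventually_mono[OF tf]) simp
  moreover have "meas P (\<lambda>G. fn P G g n)" for n
    by (rule meas_fn[OF P], rule eventually_mono[OF tg]) simp
  ultimately have "meas P (\<lambda>G. merge (fn P G f) (fn P G g) n)" for n by (rule meas_merge[OF P])
  moreover have "\<forall>\<^sub>F G in gen P. strict_mono (merge (fn P G f) (fn P G g))"
    using tf tg by eventually_elim (simp add: merge_intervals)
  ultimately obtain h :: "'i \<Rightarrow> 'p \<times> nat \<times> nat" where h: "incr_name P (range h)"
    "\<forall>\<^sub>F G in gen P. total_name P G (range h) \<and> fn P G (range h) = merge (fn P G f) (fn P G g)"
    using incr_name_exists[OF index P ccc, of "\<lambda>G. merge (fn P G f) (fn P G g)"] by blast
  have "dominates (range h) f P p" "dominates (range h) g P p" if p: "p \<in> conds P" for p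
  proof -
    from h(2) tf tg have "\<forall>\<^sub>F G in gen P. total_name P G (range h) \<and> total_name P G f \<and>
      (\<forall>n. \<exists>k. {fn P G f k..<fn P G f (Suc k)} \<subseteq> {fn P G (range h) n..<fn P G (range h) (Suc n)})"
    proof eventually_elim
      case (elim G)
      then show ?case using merge_intervals(2)[of "fn P G f" "fn P G g"] by (simp del: merge.simps) blast
    qed
    then show "dominates (range h) f P p" by (rule dominatesI[OF P p])
    from h(2) tf tg have "\<forall>\<^sub>F G in gen P. total_name P G (range h) \<and> total_name P G g \<and>
      (\<forall>n. \<exists>k. {fn P G g k..<fn P G g (Suc k)} \<subseteq> {fn P G (range h) n..<fn P G (range h) (Suc n)})"
    proof eventually_elim
      case (elim G)
      then show ?case using merge_intervals(3)[of "fn P G f" "fn P G g"] by (simp del: merge.simps) blast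
    qed
    then show "dominates (range h) g P p" by (rule dominatesI[OF P p])
  qed
  then show ?thesis using h(1) by blast
qed

text \<open>In the common extension no sequence \<open>t_b\<close> grows, so (3b) and (4) are
  vacuous. Only (3a) demands something new, namely one name that dominates both given names at each
  common element.\<close>

lemma good_compat:
  fixes R :: "'a::order set"
  assumes R: "wfp_on R (<)" and index: "infinite (UNIV :: 'i set)"
    and p: "good R (p :: ('a, 'i) cond)" and q: "good R q"
    and ccc: "\<And>b. b \<in> supp p \<inter> supp q \<Longrightarrow> ccc (with_Cohen (\<P> R (El b)) :: (('a, 'i) cond \<times> bool list) forcing)"
    and t: "\<And>b. b \<in> supp p \<inter> supp q \<Longrightarrow> t_part p b = t_part q b"
    and s: "\<And>\<alpha>. \<alpha> \<in> ranks R (supp p) \<inter> ranks R (supp q) \<Longrightarrow> s_part p \<alpha> = s_part q \<alpha>"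
  shows "\<exists>r. good R r \<and> supp r = supp p \<union> supp q \<and> le R r p \<and> le R r q"
proof -
  let ?C = "\<lambda>b. with_Cohen (\<P> R (El b)) :: (('a, 'i) cond \<times> bool list) forcing"
  note F = forcing_notion_PC[OF R]
  have "\<exists>h :: 'i \<Rightarrow> _. b \<in> supp p \<inter> supp q \<longrightarrow> incr_name (?C b) (range h) \<and>
     (\<forall>c\<in>conds (?C b). dominates (range h) (f_part p b) (?C b) c \<and> dominates (range h) (f_part q b) (?C b) c)" for b
  proof (cases "b \<in> supp p \<inter> supp q")
    case True
    then have "incr_name (?C b) (f_part p b)" "incr_name (?C b) (f_part q b)" using p q by (simp_all add: good_def)
    from merge_names[OF index F ccc[OF True] this] show ?thesis by simp
  qed blast
  then have "\<exists>h :: 'a \<Rightarrow> 'i \<Rightarrow> _. \<forall>b. b \<in> supp p \<inter> supp q \<longrightarrow> incr_name (?C b) (range (h b)) \<and>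
     (\<forall>c\<in>conds (?C b). dominates (range (h b)) (f_part p b) (?C b) c \<and> dominates (range (h b)) (f_part q b) (?C b) c)"
    by (intro choice allI)
  then obtain h :: "'a \<Rightarrow> 'i \<Rightarrow> _" where h0: "\<forall>b. b \<in> supp p \<inter> supp q \<longrightarrow> incr_name (?C b) (range (h b)) \<and>
     (\<forall>c\<in>conds (?C b). dominates (range (h b)) (f_part p b) (?C b) c \<and> dominates (range (h b)) (f_part q b) (?C b) c)"
    by (elim exE)
  have h: "incr_name (?C b) (range (h b))"
    "\<And>c. c \<in> conds (?C b) \<Longrightarrow> dominates (range (h b)) (f_part p b) (?C b) c \<and> dominates (range (h b)) (f_part q b) (?C b) c"
    if b: "b \<in> supp p \<inter> supp q" for b
    using mp[OF spec[OF h0] b] by simp_all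
  define r where "r = Cond (side p ++ side q)
    (\<lambda>b. if b \<in> supp p \<inter> supp q then Some (t_part p b, h b) else (main p ++ main q) b)"
  have S: "supp r = supp p \<union> supp q"
    by (auto simp: r_def supp_def map_add_def split: option.splits if_splits)
  have mp: "main r b = main p b" if "b \<in> supp p" "b \<notin> supp q" for b
    using that unfolding r_def supp_def by (auto simp: map_add_def split: option.split)
  have mq: "main r b = main q b" if "b \<notin> supp p" "b \<in> supp q" for b
    using that unfolding r_def supp_def by (auto simp: map_add_def split: option.split)
  have rb: "t_part r b = t_part p b" "t_part r b = t_part q b" "f_part r b = range (h b)" if "b \<in> supp p \<inter> supp q" for b
    using that t[OF that] by (simp_all add: r_def t_part_def f_part_def)
  have "sorted_wrt (<) (t_part r b) \<and> incr_name (?C b) (f_part r b)" if b: "b \<in> supp r" for b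
  proof -
    consider "b \<in> supp p \<inter> supp q" | "b \<in> supp p" "b \<notin> supp q" | "b \<notin> supp p" "b \<in> supp q"
      using b S by blast
    then show ?thesis
    proof cases
      case 1
      then show ?thesis using h(1)[OF 1] p unfolding rb(1,3)[OF 1] by (simp add: good_def)
    next
      case 2
      then show ?thesis using mp[OF 2] p by (simp add: good_def t_part_def f_part_def)
    next
      case 3
      then show ?thesis using mq[OF 3] q by (simp add: good_def t_part_def f_part_def)
    qed
  qed
  moreover have "dom (side r) = ranks R (supp r)" using p q unfolding S ranks_Un by (auto simp: r_def good_def)
  ultimately have r: "good R r" using p q S by (simp add: good_def)
  have sq: "s_part r \<alpha> = s_part q \<alpha>" if "\<alpha> \<in> ranks R (supp q)" for \<alpha>
    using that q by (auto simp: r_def s_part_def good_def map_add_def split: option.splits)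
  have sp: "s_part r \<alpha> = s_part p \<alpha>" if \<alpha>: "\<alpha> \<in> ranks R (supp p)" for \<alpha>
  proof (cases "\<alpha> \<in> ranks R (supp q)")
    case True
    then show ?thesis using sq s \<alpha> by simp
  next
    case False
    then have "side q \<alpha> = None" using q by (auto simp: good_def)
    then show ?thesis by (simp add: r_def s_part_def map_add_def)
  qed
  have tt: "t_part r b = t_part p b" if "b \<in> supp p" for b
    using rb(1) mp[OF that] that by (cases "b \<in> supp q") (auto simp: t_part_def)
  have tt': "t_part r b = t_part q b" if "b \<in> supp q" for b
    using rb(2) mq[OF _ that] that by (cases "b \<in> supp p") (auto simp: t_part_def)
  note fr = fresh_trivial[OF F stage_conds_pair[OF r] order.refl]
  have "le3 R r p b" if b: "b \<in> supp p" for b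
  proof (cases "b \<in> supp q")
    case True
    then have b': "b \<in> supp p \<inter> supp q" using b by blast
    show ?thesis unfolding le3_def fconj_def rb(3)[OF b'] tt[OF b]
      using h(2)[OF b' stage_conds_pair[OF r]] fr by simp
  qed (use mp b le3_same[OF R r] in blast)
  moreover have "le3 R r q b" if b: "b \<in> supp q" for b
  proof (cases "b \<in> supp p")
    case True
    then have b': "b \<in> supp p \<inter> supp q" using b by blast
    show ?thesis unfolding le3_def fconj_def rb(3)[OF b'] tt'[OF b]
      using h(2)[OF b' stage_conds_pair[OF r]] fr by simp
  qed (use mq b le3_same[OF R r] in blast)
  moreover have "le4 r p b c" if "c \<in> supp p" for b c using tt[OF that] by (simp add: le4_def)
  moreover have "le4 r q b c" if "c \<in> supp q" for b c using tt'[OF that] by (simp add: le4_def)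
  ultimately have "le R r p" "le R r q" unfolding le_def using S sp sq by auto
  then show ?thesis using r S by blast
qed

text \<open>The coding \<open>h\<close> forgets the names \<open>f_b\<close> and keeps the sequences
  \<open>s\<close> and \<open>t\<close>, so its values lie in a countable set. Members of an
  antichain have incompatible codes, since \<open>good_compat\<close> amalgamates conditions with
  compatible ones.\<close>

lemma ccc_P:
  fixes R :: "'a::order set"
  assumes R: "wfp_on R (<)" and index: "infinite (UNIV :: 'i set)"
  shows "ccc (\<P> R x :: ('a, 'i) cond forcing)"
proof (induction x rule: measure_induct_rule[where f = "rank R"])
  case (less x)
  let ?P = "\<P> R x :: ('a, 'i) cond forcing"
  have C: "ccc (with_Cohen (\<P> R (El b)) :: (('a, 'i) cond \<times> bool list) forcing)" if "b \<in> Qbelow R x" for b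
    using less that by (intro ccc_with_Cohen) (simp add: Qbelow_def ll_def)
  show ?case unfolding ccc_def
  proof (intro allI impI)
    fix A assume A: "A \<subseteq> conds ?P" and anti: "\<forall>p\<in>A. \<forall>q\<in>A. p \<noteq> q \<longrightarrow> \<not> compat ?P p q"
    define h :: "('a, 'i) cond \<Rightarrow> 'a + 'a ordi \<rightharpoonup> nat list + bool list" where
      "h p = case_sum (\<lambda>b. map_option (Inl \<circ> fst) (main p b)) (\<lambda>\<alpha>. map_option Inr (side p \<alpha>))" for p
    have h_simps: "h p (Inl b) = map_option (Inl \<circ> fst) (main p b)" "h p (Inr \<alpha>) = map_option Inr (side p \<alpha>)"
      for p b \<alpha> by (simp_all add: h_def)
    have dom_h: "Inl b \<in> dom (h p) \<longleftrightarrow> b \<in> supp p" "Inr \<alpha> \<in> dom (h p) \<longleftrightarrow> \<alpha> \<in> dom (side p)" for p b \<alpha>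
      by (simp_all add: domIff h_simps supp_def)
    show "countable A"
    proof (rule countable_incompatible[of A h])
      fix p assume "p \<in> A"
      then have "good R p" using A by (auto simp: conds_P)
      then have "finite (Inl ` supp p \<union> Inr ` dom (side p))" by (simp add: good_def ranks_def)
      moreover have "dom (h p) \<subseteq> Inl ` supp p \<union> Inr ` dom (side p)"
      proof
        fix y assume "y \<in> dom (h p)"
        then show "y \<in> Inl ` supp p \<union> Inr ` dom (side p)" by (cases y) (simp_all add: dom_h)
      qed
      ultimately show "finite (dom (h p))" by (rule finite_subset[rotated])
    next
      fix p q assume pq: "p \<in> A" "q \<in> A" "p \<noteq> q"
      then have g: "good R p" "good R q" "supp p \<subseteq> Qbelow R x" "supp q \<subseteq> Qbelow R x"
        using subsetD[OF A pq(1)] subsetD[OF A pq(2)] by (simp_all add: conds_P)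
      show "\<exists>y\<in>dom (h p) \<inter> dom (h q). h p y \<noteq> h q y"
      proof (rule ccontr)
        assume "\<not> ?thesis"
        then have eq: "h p y = h q y" if "y \<in> dom (h p)" "y \<in> dom (h q)" for y using that by (meson IntI)
        have "t_part p b = t_part q b" if b: "b \<in> supp p \<inter> supp q" for b
        proof -
          obtain u v where "main p b = Some u" "main q b = Some v" using b by (auto simp: supp_def)
          then show ?thesis using eq[of "Inl b"] b by (simp add: dom_h h_simps t_part_def)
        qed
        moreover have "s_part p \<alpha> = s_part q \<alpha>" if "\<alpha> \<in> ranks R (supp p) \<inter> ranks R (supp q)" for \<alpha>
        proof -
          have \<alpha>: "\<alpha> \<in> dom (side p)" "\<alpha> \<in> dom (side q)" using that g(1,2) by (simp_all add: good_def)
          then obtain u v where "side p \<alpha> = Some u" "side q \<alpha> = Some v" by auto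
          then show ?thesis using eq[of "Inr \<alpha>"] \<alpha> by (simp add: dom_h h_simps s_part_def)
        qed
        ultimately obtain r where r: "good R r" "supp r = supp p \<union> supp q" "le R r p" "le R r q"
          using good_compat[OF R index g(1,2) C] g(3) by blast
        then have "compat ?P p q" unfolding compat_def
          using g by (intro bexI[of _ r]) (simp_all add: conds_P leq_P)
        then show False using anti pq by blast
      qed
    qed
  qed
qed

section \<open>Projections\<close>

definition proj :: "('a::order) set \<Rightarrow> 'a \<Rightarrow> ('a, 'i) cond \<Rightarrow> ('a, 'i) cond \<times> bool list" where
  "proj R b p = (restr R p (El b), s_of p (rank R (El b)))"

lemma gen_fst:
  assumes P: "forcing_notion P" and "eventually \<Psi> (gen P)"
  shows "\<forall>\<^sub>F \<rho> in gen (with_Cohen P). \<Psi> (fst \<circ> \<rho>)"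
proof (rule eventually_gen_proj[OF assms(2)])
  fix D assume "dense_in P D"
  show "dense_in (with_Cohen P) {p. fst p \<in> D}"
    unfolding dense_in_def
  proof
    fix p assume "p \<in> conds (with_Cohen P)"
    then obtain q where "q \<in> conds P" "leq P q (fst p)" "q \<in> D"
      using \<open>dense_in P D\<close> by (auto simp: dense_in_def conds_with_Cohen)
    then show "\<exists>q\<in>conds (with_Cohen P). leq (with_Cohen P) q p \<and> q \<in> {p. fst p \<in> D}"
      by (intro bexI[of _ "(q, snd p)"]) (auto simp: conds_with_Cohen leq_with_Cohen)
  qed
qed (auto simp: conds_with_Cohen leq_with_Cohen)

context
  fixes R :: "'a::order set"
  assumes R: "wfp_on R (<)" and index: "infinite (UNIV :: 'i set)"
begin

lemma ccc_PC: "ccc (with_Cohen (\<P> R x) :: (('a, 'i) cond \<times> bool list) forcing)"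
  by (rule ccc_with_Cohen[OF ccc_P[OF R index]])

lemma le_trans:
  fixes p q r :: "('a, 'i) cond"
  assumes "good R p" "good R q" "good R r" "supp p \<subseteq> Qbelow R x" "le R p q" "le R q r"
  shows "le R p r"
proof -
  have S: "supp q \<subseteq> Qbelow R x" "supp r \<subseteq> Qbelow R x" using assms by (auto simp: le_def)
  then have c: "p \<in> conds (\<P> R x)" "q \<in> conds (\<P> R x)" "r \<in> conds (\<P> R x)" using assms by (simp_all add: conds_P)
  have l: "leq (\<P> R x) p q" "leq (\<P> R x) q r" using assms leq_P S by blast+
  have "leq (\<P> R x) p r" by (rule leq_trans[OF forcing_notion_P[OF R] l c])
  then show ?thesis using leq_P S by blast
qed

lemma id_name_PC: "\<exists>g :: 'i \<Rightarrow> _. incr_name (with_Cohen (\<P> R x) :: (('a, 'i) cond \<times> bool list) forcing) (range g)"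
  by (rule id_name[OF index forcing_notion_PC[OF R] ccc_PC])

text \<open>Provides the assumption on ranks in \<open>amalg_extends\<close>: each rank shared by
  \<open>p\<close> and \<open>Q_b\<close> is given to an element of \<open>Q_b\<close> in the
  support. The added elements repeat ranks already present, so finitely many steps are
  enough.\<close>

lemma realize_ranks:
  fixes p :: "('a, 'i) cond"
  assumes p: "good R p" "supp p \<subseteq> Qbelow R x" and b: "b \<in> Qbelow R x"
  shows "\<exists>p'. good R p' \<and> supp p' \<subseteq> Qbelow R x \<and> le R p' p \<and>
    supp p' \<subseteq> supp p \<union> Qbelow R (El b) \<and> (\<forall>c\<in>supp p. main p' c = main p c) \<and>
    ranks R (supp p') \<inter> ranks R (Qbelow R (El b)) \<subseteq> ranks R (supp p' \<inter> Qbelow R (El b))"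
proof -
  have claim: "A \<subseteq> ranks R (supp p) \<inter> ranks R (Qbelow R (El b)) \<Longrightarrow>
    \<exists>p'. good R p' \<and> supp p' \<subseteq> Qbelow R x \<and> le R p' p \<and> supp p' \<subseteq> supp p \<union> Qbelow R (El b) \<and>
      (\<forall>c\<in>supp p. main p' c = main p c) \<and> ranks R (supp p') = ranks R (supp p) \<and>
      A \<subseteq> ranks R (supp p' \<inter> Qbelow R (El b))" if "finite A" for A
    using that
  proof (induction A rule: finite_induct)
    case empty
    show ?case using p le_refl[OF R p(1)] by (intro exI[of _ p]) simp
  next
    case (insert \<alpha> A)
    then obtain p' where p': "good R p'" "supp p' \<subseteq> Qbelow R x" "le R p' p" "supp p' \<subseteq> supp p \<union> Qbelow R (El b)"
      "\<forall>c\<in>supp p. main p' c = main p c" "ranks R (supp p') = ranks R (supp p)"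
      "A \<subseteq> ranks R (supp p' \<inter> Qbelow R (El b))" by auto
    show ?case
    proof (cases "\<alpha> \<in> ranks R (supp p' \<inter> Qbelow R (El b))")
      case True
      then show ?thesis using p' by (intro exI[of _ p']) simp
    next
      case False
      obtain y where y: "y \<in> Qbelow R (El b)" "rank R (El y) = \<alpha>" using insert.prems by (auto simp: ranks_def)
      then have y': "y \<notin> supp p'" using False by (auto simp: ranks_def)
      then have y'': "y \<notin> supp p" using p'(3) by (auto simp: le_def)
      obtain g :: "'i \<Rightarrow> (('a, 'i) cond \<times> bool list) \<times> nat \<times> nat" where
        g: "incr_name (with_Cohen (\<P> R (El y))) (range g)" using id_name_PC by blast
      let ?r = "add_elem R p' y g"
      have r: "good R ?r" "le R ?r p'" by (rule add_elem_extends[OF R p'(1) y' g])+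
      have S: "supp ?r \<subseteq> Qbelow R x" using p'(2) y Qbelow_trans[OF R b] by (auto simp: supp_add_elem)
      have "le R ?r p" by (rule le_trans[OF r(1) p'(1) p(1) S r(2) p'(3)])
      moreover have "ranks R (supp ?r) = ranks R (supp p)"
        using p'(6) insert.prems y(2) by (auto simp: supp_add_elem ranks_def)
      moreover have "\<forall>c\<in>supp p. main ?r c = main p c" using p'(5) y'' main_add_elem by metis
      moreover have "insert \<alpha> A \<subseteq> ranks R (supp ?r \<inter> Qbelow R (El b))"
        using p'(7) y by (auto simp: supp_add_elem ranks_def)
      moreover have "supp ?r \<subseteq> supp p \<union> Qbelow R (El b)" using p'(4) y(1) by (auto simp: supp_add_elem)
      ultimately show ?thesis using r(1) S by blast
    qed
  qed
  have "finite (ranks R (supp p) \<inter> ranks R (Qbelow R (El b)))" using finite_supp[OF p(1)] by (simp add: ranks_def)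
  from claim[OF this order.refl] show ?thesis by (elim exE conjE) (intro exI conjI; assumption?; simp)
qed

text \<open>After the shared ranks are realized, a pair \<open>(q, s)\<close> in \<open>D\<close> is
  grafted onto the condition in two moves: \<open>q\<close> by amalgamation, which leaves the Cohen
  part at the rank of \<open>b\<close> alone, and then \<open>s\<close>. The last two clauses, that
  the main part is unchanged outside \<open>Q_b\<close>, are what \<open>extend_one\<close> relies
  on.\<close>

lemma extend_below:
  fixes p :: "('a, 'i) cond"
  assumes p: "good R p" "supp p \<subseteq> Qbelow R x" and b: "b \<in> supp p"
    and D: "dense_in (with_Cohen (\<P> R (El b))) D"
  shows "\<exists>r. good R r \<and> supp r \<subseteq> Qbelow R x \<and> le R r p \<and>
    (restr R r (El b), s_part r (rank R (El b))) \<in> D \<and> supp r \<subseteq> supp p \<union> Qbelow R (El b) \<and>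
    (\<forall>c\<in>supp p. c \<notin> Qbelow R (El b) \<longrightarrow> main r c = main p c)"
proof -
  let ?\<beta> = "rank R (El b)"
  have bx: "b \<in> Qbelow R x" using p b by blast
  obtain p' where p': "good R p'" "supp p' \<subseteq> Qbelow R x" "le R p' p" "supp p' \<subseteq> supp p \<union> Qbelow R (El b)"
    "\<forall>c\<in>supp p. main p' c = main p c"
    "ranks R (supp p') \<inter> ranks R (Qbelow R (El b)) \<subseteq> ranks R (supp p' \<inter> Qbelow R (El b))"
    using realize_ranks[OF p bx] by blast
  have sub: "supp p \<subseteq> supp p'" using p'(3) by (simp add: le_def)
  obtain q s where qs: "(q, s) \<in> conds (with_Cohen (\<P> R (El b)))" "(q, s) \<in> D"
    "leq (with_Cohen (\<P> R (El b))) (q, s) (restr R p' (El b), s_part p' ?\<beta>)"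
    using D stage_conds_pair[OF p'(1)] unfolding dense_in_def by fast
  then have q: "good R q" "supp q \<subseteq> Qbelow R (El b)" and s: "prefix (s_part p' ?\<beta>) s"
    by (simp_all add: conds_with_Cohen conds_P leq_with_Cohen)
  have le: "le R q (restr R p' (El b))"
    using qs(3) leq_P[of "restr R p' (El b)" R "El b"] by (simp add: leq_with_Cohen supp_restr)
  let ?a = "amalg p' q"
  have a: "good R ?a" "le R ?a p'" "restr R ?a (El b) = q" by (rule amalg_extends[OF R p'(1) q le p'(6)])+
  have "?\<beta> \<notin> ranks R (supp q)" using q(2) by (auto simp: ranks_def Qbelow_def ll_def)
  then have sa: "s_part ?a ?\<beta> = s_part p' ?\<beta>" by (simp add: s_part_amalg[OF q(1)])
  have \<beta>: "?\<beta> \<in> ranks R (supp ?a)" using ranksI[of b] b sub by (auto simp: supp_amalg)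
  let ?r = "set_s ?a ?\<beta> s"
  have r: "good R ?r" "le R ?r ?a" "supp ?r = supp ?a" "main ?r = main ?a"
     "\<And>\<alpha>. s_part ?r \<alpha> = (if \<alpha> = ?\<beta> then s else s_part ?a \<alpha>)"
    using set_s_extends[OF R a(1) \<beta>] s sa by auto
  have S: "supp ?r \<subseteq> Qbelow R x" using p'(2) q(2) Qbelow_trans[OF R bx] r(3) by (auto simp: supp_amalg)
  have "le R ?r p'" by (rule le_trans[OF r(1) a(1) p'(1) S r(2) a(2)])
  then have "le R ?r p" by (rule le_trans[OF r(1) p'(1) p(1) S _ p'(3)])
  moreover have "(restr R ?r (El b), s_part ?r ?\<beta>) \<in> D"
    using qs(2) r(5) a(3) restr_set_s[OF refl, of R ?a b s] by simp
  moreover have "supp ?r \<subseteq> supp p \<union> Qbelow R (El b)" using r(3) p'(4) q(2) by (auto simp: supp_amalg)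
  moreover have "main ?r c = main p c" if "c \<in> supp p" "c \<notin> Qbelow R (El b)" for c
    using that p'(5) q(2) unfolding r(4) main_amalg by auto
  ultimately show ?thesis using r(1) S by blast
qed

lemma dense_P:
  fixes D :: "('a, 'i) cond set"
  assumes a: "a \<in> Qbelow R x"
    and D: "\<And>p. good R p \<Longrightarrow> supp p \<subseteq> Qbelow R x \<Longrightarrow> a \<in> supp p \<Longrightarrow>
      \<exists>r. good R r \<and> supp r \<subseteq> Qbelow R x \<and> le R r p \<and> r \<in> D"
  shows "dense_in (\<P> R x) D"
  unfolding dense_in_def
proof
  fix p :: "('a, 'i) cond" assume "p \<in> conds (\<P> R x)"
  then have p: "good R p" "supp p \<subseteq> Qbelow R x" by (simp_all add: conds_P)
  obtain p' where p': "good R p'" "supp p' \<subseteq> Qbelow R x" "le R p' p" "a \<in> supp p'"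
  proof (cases "a \<in> supp p")
    case True
    then show ?thesis using p le_refl[OF R p(1)] that by blast
  next
    case False
    obtain g :: "'i \<Rightarrow> (('a, 'i) cond \<times> bool list) \<times> nat \<times> nat" where
      g: "incr_name (with_Cohen (\<P> R (El a))) (range g)" using id_name_PC by blast
    show ?thesis using that[of "add_elem R p a g"] add_elem_extends[OF R p(1) False g] a p(2)
      by (simp add: supp_add_elem)
  qed
  obtain r where r: "good R r" "supp r \<subseteq> Qbelow R x" "le R r p'" "r \<in> D" using D[OF p'(1,2,4)] by blast
  have "le R r p" by (rule le_trans[OF r(1) p'(1) p(1) r(2) r(3) p'(3)])
  then show "\<exists>q\<in>conds (\<P> R x). leq (\<P> R x) q p \<and> q \<in> D"
    using r p by (intro bexI[of _ r]) (simp_all add: conds_P leq_P)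
qed

text \<open>Genericity over \<open>P_x\<close> yields genericity over \<open>P_b * C\<close>: once
  \<open>b\<close> has been put into the support, \<open>extend_below\<close> shows that preimages
  of dense sets are dense.\<close>

lemma gen_proj:
  assumes b: "b \<in> Qbelow R x" and \<Psi>: "eventually \<Psi> (gen (with_Cohen (\<P> R (El b)) :: (('a, 'i) cond \<times> bool list) forcing))"
  shows "\<forall>\<^sub>F G in gen (\<P> R x :: ('a, 'i) cond forcing). \<Psi> (proj R b \<circ> G)"
proof (rule eventually_gen_proj[OF \<Psi>])
  fix p q :: "('a, 'i) cond"
  assume p: "p \<in> conds (\<P> R x)"
  then have g: "good R p" "supp p \<subseteq> Qbelow R x" by (simp_all add: conds_P)
  then show "proj R b p \<in> conds (with_Cohen (\<P> R (El b)))" using stage_conds_pair by (simp add: proj_def)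
  assume q: "q \<in> conds (\<P> R x)" and l: "leq (\<P> R x) p q"
  then have g': "good R q" "supp q \<subseteq> Qbelow R x" by (simp_all add: conds_P)
  have le: "le R p q" using l leq_P[OF g'(2)] by simp
  have "leq (\<P> R (El b)) (restr R p (El b)) (restr R q (El b))"
    using leq_P[of "restr R q (El b)" R "El b"] le_restr[OF R le] by (simp add: supp_restr)
  then show "leq (with_Cohen (\<P> R (El b))) (proj R b p) (proj R b q)"
    using s_of_prefix[OF g(1) g'(1) le] by (simp add: proj_def leq_with_Cohen)
next
  fix D :: "(('a, 'i) cond \<times> bool list) set" assume D: "dense_in (with_Cohen (\<P> R (El b))) D"
  show "dense_in (\<P> R x) {p. proj R b p \<in> D}"
  proof (rule dense_P[OF b])
    fix p :: "('a, 'i) cond" assume p: "good R p" "supp p \<subseteq> Qbelow R x" "b \<in> supp p"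
    obtain r where r: "good R r" "supp r \<subseteq> Qbelow R x" "le R r p" "(restr R r (El b), s_part r (rank R (El b))) \<in> D"
      using extend_below[OF p D] by blast
    have "b \<in> supp r" using r(3) p(3) by (auto simp: le_def)
    then have "proj R b r \<in> D" using r(4) s_of_eq[OF r(1) ranksI] by (simp add: proj_def)
    then show "\<exists>r. good R r \<and> supp r \<subseteq> Qbelow R x \<and> le R r p \<and> r \<in> {p. proj R b p \<in> D}" using r by blast
  qed
qed

lemma gen_restr:
  assumes b: "b \<in> Qbelow R x" and \<Psi>: "eventually \<Psi> (gen (\<P> R (El b) :: ('a, 'i) cond forcing))"
  shows "\<forall>\<^sub>F G in gen (\<P> R x :: ('a, 'i) cond forcing). \<Psi> ((\<lambda>p. restr R p (El b)) \<circ> G)"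
proof -
  have "fst \<circ> (proj R b \<circ> G) = (\<lambda>p. restr R p (El b)) \<circ> G" for G :: "nat \<Rightarrow> ('a, 'i) cond"
    by (auto simp: proj_def)
  then show ?thesis using gen_proj[OF b gen_fst[OF forcing_notion_P[OF R] \<Psi>]] by simp
qed

end

section \<open>Growing the sequences \<open>t\<^sub>a\<close>\<close>

definition decides :: "('p, nat) fun_name \<Rightarrow> ('p, bool) fun_name \<Rightarrow> nat \<Rightarrow> nat \<Rightarrow> nat \<Rightarrow> bool list \<Rightarrow> 'p formula" where
  "decides f X k u v w = (val f k u \<^bold>\<and> val f (Suc k) v \<^bold>\<and> (\<^bold>\<forall>j. ground (j < length w) \<^bold>\<longrightarrow> val X j (w ! j)))"

lemma repr_decides:
  assumes P: "forcing_notion P"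
  shows "repr P (decides f X k u v w) (\<lambda>G. ev P G f k u \<and> ev P G f (Suc k) v \<and>
    (\<forall>j. j < length w \<longrightarrow> ev P G X j (w ! j)))"
  unfolding decides_def by (intro repr_intros[OF P])

text \<open>The index \<open>k\<close> doubles as a lower bound for the decided interval, since
  \<open>k \<le> f k\<close>. A generic sequence from \<open>q\<close> reveals the values, and one
  of its members forces them.\<close>

lemma decides_exists:
  assumes P: "forcing_notion P" and q: "q \<in> conds P"
    and X: "\<forall>\<^sub>F G in gen P. total_name P G X"
    and f: "\<forall>\<^sub>F G in gen P. total_name P G f \<and> strict_mono (fn P G f)"
  shows "\<exists>q'\<in>conds P. leq P q' q \<and> (\<exists>u v w. k \<le> u \<and> u < v \<and> length w = v \<and> decides f X k u v w P q')"
proof -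
  have "\<forall>\<^sub>F G in gen P. \<forall>u v w. holds P G (decides f X k u v w) \<longleftrightarrow> ev P G f k u \<and> ev P G f (Suc k) v \<and>
    (\<forall>j. j < length w \<longrightarrow> ev P G X j (w ! j))"
    using repr_decides[OF P, of f X k] unfolding repr_def by (intro eventually_gen_all) blast
  with X f have "\<forall>\<^sub>F G in gen P. \<exists>u v w. k \<le> u \<and> u < v \<and> length w = v \<and> holds P G (decides f X k u v w)"
  proof eventually_elim
    case (elim G)
    let ?F = "fn P G f" and ?w = "map (fn P G X) [0..<fn P G f (Suc k)]"
    have "k \<le> ?F k" "?F k < ?F (Suc k)" using elim(2) strict_mono_ge[of ?F k] by (auto simp: strict_mono_Suc_iff)
    moreover have "holds P G (decides f X k (?F k) (?F (Suc k)) ?w)"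
      using elim by (simp add: fn_iff)
    moreover have "length ?w = ?F (Suc k)" by simp
    ultimately show ?case by blast
  qed
  from generic_exists[OF P q this] obtain G u v w where G: "descending P G" "G 0 = q"
    "k \<le> u" "u < v" "length w = v" "holds P G (decides f X k u v w)" by blast
  then obtain i where "decides f X k u v w P (G i)" by (auto simp: holds_def)
  moreover have "G i \<in> conds P" using G(1) by (simp add: descending_def)
  moreover have "leq P (G i) q" using descending_le[OF P G(1), of 0 i] G(2) by simp
  ultimately show ?thesis using G(3-5) by blast
qed

text \<open>A dummy for the argument \<open>X\<close> of \<open>decides\<close>, where only \<open>f\<close> has to be decided.\<close>

lemma total_const_name:
  assumes P: "forcing_notion P"
  shows "\<forall>\<^sub>F G in gen P. total_name P G {(q, n, v). q \<in> conds P \<and> v}"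
  using eventually_descending[of P]
proof eventually_elim
  case (elim G)
  then have "G 0 \<in> conds P" by (simp add: descending_def)
  then have val: "ev P G {(q, n, v). q \<in> conds P \<and> v} n v \<longleftrightarrow> v" for n v
    using leq_refl[OF P, of "G 0"] unfolding ev_def by blast
  show ?case unfolding total_name_def
  proof
    fix n
    show "\<exists>!v. ev P G {(q, n, v). q \<in> conds P \<and> v} n v"
      using val[of n True] val[of n False] by (intro ex1I[of _ True]) (simp, metis (full_types))
  qed
qed

lemma fresh_append:
  assumes P: "forcing_notion P" and f: "\<forall>\<^sub>F G in gen P. total_name P G f" and p: "p \<in> conds P"
    and dec: "decides f X k u v w P p" and u: "t \<noteq> [] \<Longrightarrow> last t \<le> u" and v: "v \<le> v'"
  shows "fresh f t (t @ [v']) P p"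
proof -
  have "\<forall>\<^sub>F G in gen P. met P G p \<longrightarrow> ev P G f k u \<and> ev P G f (Suc k) v"
    using repr_forces[OF P repr_decides[OF P] p] dec by (auto elim: eventually_mono)
  with f show ?thesis unfolding repr_forces[OF P repr_fresh[OF P] p]
  proof eventually_elim
    case (elim G)
    show ?case
    proof (intro impI allI)
      fix n assume m: "met P G p" and n: "1 \<le> n \<and> length t \<le> n \<and> n < length (t @ [v'])"
      \<comment> \<open>For empty \<open>t\<close> the only new index is 0, which is the right end
        of no interval.\<close>
      then have n': "n = length t" "t \<noteq> []" by auto
      then have "(t @ [v']) ! n = v'" "(t @ [v']) ! (n - 1) = last t" by (simp_all add: nth_append last_conv_nth)
      moreover have "fn P G f k = u" "fn P G f (Suc k) = v" using elim m by (simp_all add: fn_iff)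
      ultimately have "\<forall>j. in_int P G f k j \<longrightarrow> (t @ [v']) ! (n - 1) \<le> j \<and> j < (t @ [v']) ! n"
        using elim(1) u[OF n'(2)] v by (auto simp: in_int_iff)
      then show "\<exists>k. \<forall>j. in_int P G f k j \<longrightarrow> (t @ [v']) ! (n - 1) \<le> j \<and> j < (t @ [v']) ! n" by (rule exI)
    qed
  qed
qed

lemma sorted_wrt_last: "sorted_wrt (<) t \<Longrightarrow> t \<noteq> [] \<Longrightarrow> x \<in> set t \<Longrightarrow> x \<le> last t" for t :: "nat list"
  by (cases t rule: rev_cases) (auto simp: sorted_wrt_append)

lemma sorted_wrt_snoc: "sorted_wrt (<) t \<Longrightarrow> (t \<noteq> [] \<Longrightarrow> last t < v) \<Longrightarrow> sorted_wrt (<) (t @ [v])" for t :: "nat list"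
  using sorted_wrt_last by (fastforce simp: sorted_wrt_append)

lemma t_part_prefix: "le R p q \<Longrightarrow> b \<in> supp q \<Longrightarrow> prefix (t_part q b) (t_part p b)"
  by (simp add: le_def le3_def)

lemma prefix_nth: "prefix s t \<Longrightarrow> k < length s \<Longrightarrow> t ! k = s ! k \<and> k < length t"
  by (auto simp: prefix_def nth_append)

context
  fixes R :: "'a::order set"
  assumes R: "wfp_on R (<)" and index: "infinite (UNIV :: 'i set)"
begin

text \<open>For each lower element \<open>e\<close> of the same rank, \<open>H\<close> provides an
  interval of \<open>t_e\<close> that does not begin before the end of \<open>t_c\<close>; a large
  new value of \<open>t_c\<close> encloses it, as (4) requires. For (3b) the condition is first
  extended in \<open>P_c * C\<close> until it decides an interval of \<open>f_c\<close> beyond the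
  end of \<open>t_c\<close>.\<close>

lemma extend_one:
  fixes p :: "('a, 'i) cond"
  assumes p: "good R p" "supp p \<subseteq> Qbelow R x" and c: "c \<in> supp p"
    and H: "\<And>e. e \<in> supp p \<Longrightarrow> e < c \<Longrightarrow> rank R (El e) = rank R (El c) \<Longrightarrow> t_part p c \<noteq> [] \<Longrightarrow>
      \<exists>k. 1 \<le> k \<and> k < length (t_part p e) \<and> last (t_part p c) \<le> t_part p e ! (k - 1)"
  shows "\<exists>r v. good R r \<and> supp r \<subseteq> Qbelow R x \<and> le R r p \<and> supp r \<subseteq> supp p \<union> Qbelow R (El c) \<and>
    t_part r c = t_part p c @ [v] \<and> N < v \<and>
    (\<forall>e\<in>supp p. e \<notin> Qbelow R (El c) \<longrightarrow> e \<noteq> c \<longrightarrow> main r e = main p e)"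
proof -
  let ?C = "with_Cohen (\<P> R (El c)) :: (('a, 'i) cond \<times> bool list) forcing"
  let ?f = "f_part p c" and ?t = "t_part p c"
  note F = forcing_notion_PC[OF R, of "El c"]
  have inc: "incr_name ?C ?f" and sorted: "sorted_wrt (<) ?t" using p(1) c by (simp_all add: good_def)
  note tot = incr_name_total[OF F inc]
  then have tot': "\<forall>\<^sub>F G in gen ?C. total_name ?C G ?f" by (rule eventually_mono) simp
  let ?X = "{(q, n, v). q \<in> conds ?C \<and> v}"
  define D where "D = {y. \<exists>k u v w. (?t \<noteq> [] \<longrightarrow> last ?t \<le> u) \<and> decides ?f ?X k u v w ?C y}"
  have "dense_in ?C D"
    unfolding dense_in_def
  proof
    fix y assume "y \<in> conds ?C"
    from decides_exists[OF F this total_const_name[OF F] tot, of "last ?t"]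
    show "\<exists>q\<in>conds ?C. leq ?C q y \<and> q \<in> D" unfolding D_def by blast
  qed
  from extend_below[OF R index p c this] obtain r1 where r1: "good R r1" "supp r1 \<subseteq> Qbelow R x" "le R r1 p"
    "(restr R r1 (El c), s_part r1 (rank R (El c))) \<in> D" "supp r1 \<subseteq> supp p \<union> Qbelow R (El c)"
    "\<forall>e\<in>supp p. e \<notin> Qbelow R (El c) \<longrightarrow> main r1 e = main p e" by blast
  let ?y = "(restr R r1 (El c), s_part r1 (rank R (El c)))"
  obtain k u v w where dec: "?t \<noteq> [] \<longrightarrow> last ?t \<le> u" "decides ?f ?X k u v w ?C ?y"
    using r1(4) unfolding D_def by blast
  have y: "?y \<in> conds ?C" by (rule stage_conds_pair[OF r1(1)])
  have sub: "supp p \<subseteq> supp r1" using r1(3) by (simp add: le_def)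
  have "main r1 c = main p c" using r1(6) c Qbelow_irrefl[OF R] by blast
  then have parts: "t_part r1 c = ?t" "f_part r1 c = ?f" by (simp_all add: t_part_def f_part_def)
  obtain g :: "'i \<Rightarrow> _" where g: "range g = ?f" by (rule that[of "snd (the (main p c))"]) (simp add: f_part_def)
  \<comment> \<open>\<open>v\<close> is the end of the decided interval of \<open>f_c\<close>,
    \<open>last\<close> keeps the sequence increasing, the sum bounds all entries of all sequences
    in \<open>p\<close>, and \<open>N\<close> is the requested bound. For an empty sequence
    \<open>last\<close> is an arbitrary number, which does no harm.\<close>
  define V where "V = N + v + last ?t + (\<Sum>e\<in>supp p. sum_list (t_part p e)) + 1"
  have V: "t_part p e ! j < V" if "e \<in> supp p" "j < length (t_part p e)" for e j
  proof -
    have "t_part p e ! j \<le> sum_list (t_part p e)" using that(2) by (rule elem_le_sum_list)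
    also have "\<dots> \<le> (\<Sum>e\<in>supp p. sum_list (t_part p e))"
      using that(1) finite_supp[OF p(1)] by (intro member_le_sum) auto
    finally show ?thesis by (simp add: V_def)
  qed
  let ?t' = "?t @ [V]"
  let ?r = "upd r1 c ?t' g"
  have sorted': "sorted_wrt (<) ?t'" using sorted by (rule sorted_wrt_snoc) (simp add: V_def)
  have cs: "c \<in> supp r1" using c sub by blast
  have incg: "incr_name ?C (range g)" using inc g by simp
  have r: "good R ?r" by (rule upd_extends(1)[OF R r1(1) cs sorted' incg])
  have "le R ?r r1"
  proof (rule upd_extends(2)[OF R r1(1) cs sorted' incg])
    show "prefix (t_part r1 c) ?t'" using parts by simp
    show "dominates (range g) (f_part r1 c) ?C ?y"
      unfolding parts g by (rule dominates_refl[OF F y])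
    show "fresh (f_part r1 c) (t_part r1 c) ?t' ?C ?y"
      unfolding parts by (rule fresh_append[OF F tot' y dec(2)]) (use dec(1) in \<open>auto simp: V_def\<close>)
    fix e assume e: "e \<in> supp r1" "e < c" "rank R (El e) = rank R (El c)"
    \<comment> \<open>Equal rank puts \<open>e\<close> outside \<open>Q_c\<close>, where the
      preceding extension has changed nothing.\<close>
    have nb: "e \<notin> Qbelow R (El c)" using e by (simp add: Qbelow_def ll_def)
    then have ep: "e \<in> supp p" using e r1(5) by blast
    then have "main r1 e = main p e" using r1(6) nb by blast
    then have te: "t_part r1 e = t_part p e" by (simp add: t_part_def)
    have ne: "e \<noteq> c" using e by auto
    show "le4 ?r r1 e c" unfolding le4_def parts_upd parts
    proof (intro allI impI)
      fix n assume n: "1 \<le> n \<and> length ?t \<le> n \<and> n < length (if c = c then ?t' else ?t)"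
      then have n': "n = length ?t" "?t \<noteq> []" by auto
      then obtain k where k: "1 \<le> k" "k < length (t_part p e)" "last ?t \<le> t_part p e ! (k - 1)"
        using H[OF ep e(2,3)] by blast
      have "?t' ! n = V" "?t' ! (n - 1) = last ?t" using n' by (simp_all add: nth_append last_conv_nth)
      then show "\<exists>k. 1 \<le> k \<and> k < length (if e = c then ?t' else t_part r1 e) \<and>
        {(if e = c then ?t' else t_part r1 e) ! (k - 1)..<(if e = c then ?t' else t_part r1 e) ! k}
          \<subseteq> {(if c = c then ?t' else ?t) ! (n - 1)..<(if c = c then ?t' else ?t) ! n}"
        using k V[OF ep k(2)] ne te by (intro exI[of _ k]) auto
    qed
  qed
  moreover have S: "supp ?r = supp r1" using cs by (auto simp: supp_upd)
  ultimately have "le R ?r p" using le_trans[OF R index r(1) r1(1) p(1), of x] r1(2,3) by simp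
  moreover have "N < V" by (simp add: V_def)
  moreover have "t_part ?r c = ?t @ [V]" by (simp add: parts_upd)
  moreover have "main ?r e = main p e" if "e \<in> supp p" "e \<notin> Qbelow R (El c)" "e \<noteq> c" for e
    using that r1(6) by (simp add: upd_def)
  ultimately show ?thesis using r S r1(2,5) by metis
qed

text \<open>By clause (4) of the order, the elements below \<open>c\<close> of the same rank have to be prolonged first;
  hence the induction on their number.\<close>

lemma extend_t:
  fixes p :: "('a, 'i) cond"
  assumes "good R p" "supp p \<subseteq> Qbelow R x" "c \<in> supp p"
  shows "\<exists>r v. good R r \<and> supp r \<subseteq> Qbelow R x \<and> le R r p \<and>
    {e\<in>supp r. rank R (El e) = rank R (El c)} = {e\<in>supp p. rank R (El e) = rank R (El c)} \<and>
    t_part r c = t_part p c @ [v] \<and> N < v \<and> (\<forall>e\<in>supp p. \<not> e \<le> c \<longrightarrow> main r e = main p e)"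
  using assms
proof (induction "card {e\<in>supp p. rank R (El e) = rank R (El c) \<and> e < c}" arbitrary: c p N rule: less_induct)
  case less
  note p = less.prems(1,2) and c = less.prems(3)
  let ?rk = "\<lambda>e. rank R (El e)"
  define A where "A = {e\<in>supp p. ?rk e = ?rk c}"
  define B where "B = {e\<in>A. e < c}"
  have fin: "finite A" using finite_supp[OF p(1)] by (simp add: A_def)
  \<comment> \<open>\<open>B'\<close> collects the lower elements already equipped with an interval
    beyond the end of \<open>t_c\<close>. The support gains no element of this rank, which keeps
    \<open>A\<close> fixed and with it the measure of the outer induction.\<close>
  have claim: "\<exists>p'. good R p' \<and> supp p' \<subseteq> Qbelow R x \<and> le R p' p \<and> {e\<in>supp p'. ?rk e = ?rk c} = A \<and>
      (\<forall>e\<in>supp p. \<not> e < c \<longrightarrow> main p' e = main p e) \<and>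
      (\<forall>e\<in>B'. \<exists>k. 1 \<le> k \<and> k < length (t_part p' e) \<and> last (t_part p c) \<le> t_part p' e ! (k - 1))"
    if "finite B'" "B' \<subseteq> B" for B'
    using that
  proof (induction B' rule: finite_induct)
    case empty
    show ?case using p le_refl[OF R p(1)] by (intro exI[of _ p]) (simp add: A_def)
  next
    case (insert e B')
    then obtain p' where p': "good R p'" "supp p' \<subseteq> Qbelow R x" "le R p' p" "{e\<in>supp p'. ?rk e = ?rk c} = A"
      "\<forall>e\<in>supp p. \<not> e < c \<longrightarrow> main p' e = main p e"
      "\<forall>e\<in>B'. \<exists>k. 1 \<le> k \<and> k < length (t_part p' e) \<and> last (t_part p c) \<le> t_part p' e ! (k - 1)" by auto
    have e: "e \<in> A" "e < c" "?rk e = ?rk c" using insert.prems by (auto simp: B_def A_def)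
    have small: "card {d\<in>supp q. ?rk d = ?rk e \<and> d < e} < card {e\<in>supp p. ?rk e = ?rk c \<and> e < c}"
      if q: "{d\<in>supp q. ?rk d = ?rk c} = A" for q :: "('a, 'i) cond"
    proof -
      have "{d\<in>supp q. ?rk d = ?rk e \<and> d < e} = {d\<in>A. d < e}" using q e(3) by auto
      also have "\<dots> \<subset> B" using e unfolding B_def by (auto dest: less_trans)
      finally have "{d\<in>supp q. ?rk d = ?rk e \<and> d < e} \<subset> B" .
      moreover have "B = {e\<in>supp p. ?rk e = ?rk c \<and> e < c}" by (auto simp: B_def A_def)
      moreover have "finite B" using fin by (simp add: B_def)
      ultimately show ?thesis using psubset_card_mono by metis
    qed
    have ep': "e \<in> supp p'" using e p'(4) by auto
    \<comment> \<open>Two prolongations are needed: the first value lies beyond the end of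
      \<open>t_c\<close>, the second one completes an interval that begins there.\<close>
    obtain p1 v1 where p1: "good R p1" "supp p1 \<subseteq> Qbelow R x" "le R p1 p'" "{e\<in>supp p1. ?rk e = ?rk c} = A"
      "t_part p1 e = t_part p' e @ [v1]" "last (t_part p c) < v1" "\<forall>d\<in>supp p'. \<not> d \<le> e \<longrightarrow> main p1 d = main p' d"
      using less.hyps[OF small[OF p'(4)] p'(1,2) ep', of "last (t_part p c)"] p'(4) e(3) by auto
    have ep1: "e \<in> supp p1" using e p1(4) by auto
    obtain p2 v2 where p2: "good R p2" "supp p2 \<subseteq> Qbelow R x" "le R p2 p1" "{e\<in>supp p2. ?rk e = ?rk c} = A"
      "t_part p2 e = t_part p1 e @ [v2]" "\<forall>d\<in>supp p1. \<not> d \<le> e \<longrightarrow> main p2 d = main p1 d"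
      using less.hyps[OF small[OF p1(4)] p1(1,2) ep1, of 0] p1(4) e(3) by auto
    have le1: "le R p2 p'" by (rule le_trans[OF R index p2(1) p1(1) p'(1) p2(2) p2(3) p1(3)])
    have le2: "le R p2 p" by (rule le_trans[OF R index p2(1) p'(1) p(1) p2(2) le1 p'(3)])
    have sub: "supp p \<subseteq> supp p'" "supp p' \<subseteq> supp p1" using p'(3) p1(3) by (auto simp: le_def)
    have "main p2 d = main p d" if d: "d \<in> supp p" "\<not> d < c" for d
    proof -
      have "\<not> d \<le> e" using d(2) e(2) by (meson le_less_trans)
      then show ?thesis using d p2(6) p1(7) p'(5) sub by (metis subsetD)
    qed
    moreover have "\<exists>k. 1 \<le> k \<and> k < length (t_part p2 d) \<and> last (t_part p c) \<le> t_part p2 d ! (k - 1)"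
      if d: "d \<in> insert e B'" for d
    proof (cases "d = e")
      case True
      \<comment> \<open>The witness is the index of the second new value; the first one is at the
        place before.\<close>
      then show ?thesis using p2(5) p1(5,6)
        by (intro exI[of _ "Suc (length (t_part p' e))"]) (simp add: nth_append)
    next
      case False
      then have "d \<in> B'" using d by blast
      then obtain k where k: "1 \<le> k" "k < length (t_part p' d)" "last (t_part p c) \<le> t_part p' d ! (k - 1)"
        using p'(6) by blast
      have "d \<in> supp p'" using \<open>d \<in> B'\<close> insert.prems p'(4) by (auto simp: B_def)
      then have pre: "prefix (t_part p' d) (t_part p2 d)" by (rule t_part_prefix[OF le1])
      show ?thesis using k prefix_nth[OF pre k(2)] prefix_nth[OF pre, of "k - 1"] by (intro exI[of _ k]) simp
    qed
    ultimately show ?case using p2(1,2,4) le2 by blast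
  qed
  have "finite B" using fin by (simp add: B_def)
  from claim[OF this order.refl] obtain p' where p': "good R p'" "supp p' \<subseteq> Qbelow R x" "le R p' p"
    "{e\<in>supp p'. ?rk e = ?rk c} = A" "\<forall>e\<in>supp p. \<not> e < c \<longrightarrow> main p' e = main p e"
    "\<forall>e\<in>B. \<exists>k. 1 \<le> k \<and> k < length (t_part p' e) \<and> last (t_part p c) \<le> t_part p' e ! (k - 1)" by blast
  have sub: "supp p \<subseteq> supp p'" using p'(3) by (simp add: le_def)
  have "main p' c = main p c" using p'(5) c by blast
  then have tc: "t_part p' c = t_part p c" by (simp add: t_part_def)
  have H: "\<exists>k. 1 \<le> k \<and> k < length (t_part p' e) \<and> last (t_part p' c) \<le> t_part p' e ! (k - 1)"
    if "e \<in> supp p'" "e < c" "?rk e = ?rk c" for e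
  proof -
    have "e \<in> A" using that p'(4) by blast
    then have "e \<in> B" using that by (simp add: B_def)
    then show ?thesis using p'(6) unfolding tc by (rule bspec[rotated])
  qed
  obtain r v where r: "good R r" "supp r \<subseteq> Qbelow R x" "le R r p'" "supp r \<subseteq> supp p' \<union> Qbelow R (El c)"
    "t_part r c = t_part p' c @ [v]" "N < v"
    "\<forall>e\<in>supp p'. e \<notin> Qbelow R (El c) \<longrightarrow> e \<noteq> c \<longrightarrow> main r e = main p' e"
    using extend_one[OF p'(1,2) subsetD[OF sub c] H, where N = N] by blast
  have "le R r p" by (rule le_trans[OF R index r(1) p'(1) p(1) r(2) r(3) p'(3)])
  moreover have "{e\<in>supp r. ?rk e = ?rk c} = A"
  proof -
    have "e \<notin> Qbelow R (El c)" if "?rk e = ?rk c" for e using that by (simp add: Qbelow_def ll_def)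
    moreover have "supp p' \<subseteq> supp r" using r(3) by (simp add: le_def)
    ultimately show ?thesis using r(4) p'(4) by blast
  qed
  moreover have "main r e = main p e" if e: "e \<in> supp p" "\<not> e \<le> c" for e
  proof -
    have "e \<notin> Qbelow R (El c)" "e \<noteq> c" "\<not> e < c" using e(2) by (auto simp: Qbelow_def ll_def)
    then show ?thesis using r(7) p'(5) e(1) sub by (metis subsetD)
  qed
  ultimately show ?case using r(1,2,5,6) unfolding tc A_def by blast
qed

end

section \<open>Generic reals\<close>

lemma chain_limit:
  fixes L :: "nat \<Rightarrow> 'v list"
  assumes L: "\<And>i j. i \<le> j \<Longrightarrow> prefix (L i) (L j)" and len: "\<exists>i. n < length (L i)"
  shows "\<exists>!v. \<exists>i. n < length (L i) \<and> L i ! n = v"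
proof -
  obtain i where i: "n < length (L i)" using len by blast
  show ?thesis
  proof (rule ex1I[of _ "L i ! n"])
    fix v assume "\<exists>j. n < length (L j) \<and> L j ! n = v"
    then obtain j where j: "n < length (L j)" "L j ! n = v" by blast
    have "prefix (L i) (L (max i j))" "prefix (L j) (L (max i j))" by (simp_all add: L)
    then have "L (max i j) ! n = L i ! n" "L (max i j) ! n = L j ! n"
      using i j(1) prefix_nth by blast+
    then show "v = L i ! n" using j(2) by simp
  qed (use i in blast)
qed

section \<open>The Cohen real over \<open>P\<close>\<close>

definition cohen :: "(nat \<Rightarrow> 'p \<times> bool list) \<Rightarrow> nat \<Rightarrow> bool" where
  "cohen \<rho> n = (THE v. \<exists>i. n < length (snd (\<rho> i)) \<and> snd (\<rho> i) ! n = v)"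

context
  fixes P :: "'p forcing"
  assumes P: "forcing_notion P"
begin

lemma prefix_Cohen:
  assumes "descending (with_Cohen P) \<rho>" "i \<le> j" shows "prefix (snd (\<rho> i)) (snd (\<rho> j))"
  using descending_le[OF forcing_notion_with_Cohen[OF P] assms] by (simp add: leq_with_Cohen)

lemma cohen_total: "\<forall>\<^sub>F \<rho> in gen (with_Cohen P). \<forall>n. \<exists>!v. \<exists>i. n < length (snd (\<rho> i)) \<and> snd (\<rho> i) ! n = v"
proof -
  have "\<forall>\<^sub>F \<rho> in gen (with_Cohen P). \<forall>n. \<exists>i. \<rho> i \<in> {y. n < length (snd y)}"
  proof (intro eventually_gen_all eventually_dense)
    fix n show "dense_in (with_Cohen P) {y. n < length (snd y)}"
      unfolding dense_in_def
    proof
      fix y assume "y \<in> conds (with_Cohen P)"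
      then show "\<exists>q\<in>conds (with_Cohen P). leq (with_Cohen P) q y \<and> q \<in> {y. n < length (snd y)}"
        by (intro bexI[of _ "(fst y, snd y @ replicate (Suc n) True)"])
          (auto simp: conds_with_Cohen leq_with_Cohen leq_refl[OF P])
    qed
  qed
  with eventually_descending[of "with_Cohen P"] show ?thesis
  proof eventually_elim
    case (elim \<rho>)
    show ?case
    proof
      fix n
      show "\<exists>!v. \<exists>i. n < length (snd (\<rho> i)) \<and> snd (\<rho> i) ! n = v"
        by (rule chain_limit[of "\<lambda>i. snd (\<rho> i)"]) (use elim prefix_Cohen in auto)
    qed
  qed
qed

lemma cohen_nth:
  assumes "\<forall>n. \<exists>!v. \<exists>i. n < length (snd (\<rho> i)) \<and> snd (\<rho> i) ! n = v" "n < length (snd (\<rho> i))"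
  shows "cohen \<rho> n = snd (\<rho> i) ! n"
  unfolding cohen_def by (rule the1_equality) (use assms in blast)+

lemma meas_cohen: "meas (with_Cohen P) (\<lambda>\<rho>. cohen \<rho> n)"
proof -
  note C = forcing_notion_with_Cohen[OF P]
  have "bp (with_Cohen P) (\<lambda>\<rho>. \<exists>i. n < length (snd (\<rho> i)) \<and> snd (\<rho> i) ! n = v)" for v
  proof (rule bp_open[OF C])
    fix p q :: "'p \<times> bool list" assume "leq (with_Cohen P) q p" "n < length (snd p) \<and> snd p ! n = v"
    then show "n < length (snd q) \<and> snd q ! n = v"
      using prefix_nth[of "snd p" "snd q" n] by (simp add: leq_with_Cohen)
  qed
  then show ?thesis unfolding cohen_def
    by (rule meas_THE[OF C]) (rule eventually_mono[OF cohen_total], simp)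
qed

lemma bp_ev_fst: "bp (with_Cohen P) (\<lambda>\<rho>. ev P (fst \<circ> \<rho>) \<tau> n v)"
proof -
  have "bp (with_Cohen P) (\<lambda>\<rho>. \<exists>i. \<exists>q\<in>conds P. (q, n, v) \<in> \<tau> \<and> leq P (fst (\<rho> i)) q)"
  proof (rule bp_open[OF forcing_notion_with_Cohen[OF P]])
    fix p q :: "'p \<times> bool list"
    assume c: "p \<in> conds (with_Cohen P)" "q \<in> conds (with_Cohen P)" and l: "leq (with_Cohen P) q p"
      and "\<exists>qa\<in>conds P. (qa, n, v) \<in> \<tau> \<and> leq P (fst p) qa"
    then obtain r where r: "r \<in> conds P" "(r, n, v) \<in> \<tau>" "leq P (fst p) r" by blast
    have "leq P (fst q) r"
      using leq_trans[OF P _ r(3)] c l r(1) by (simp add: conds_with_Cohen leq_with_Cohen)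
    then show "\<exists>qa\<in>conds P. (qa, n, v) \<in> \<tau> \<and> leq P (fst q) qa" using r by blast
  qed
  then show ?thesis by (simp add: ev_def)
qed

lemma meas_fn_fst:
  fixes \<tau> :: "('p, 'v) fun_name"
  assumes "\<forall>\<^sub>F G in gen P. total_name P G \<tau>"
  shows "meas (with_Cohen P) (\<lambda>\<rho>. fn P (fst \<circ> \<rho>) \<tau> n)"
  unfolding fn_def
proof (rule meas_THE[OF forcing_notion_with_Cohen[OF P] bp_ev_fst])
  show "\<forall>\<^sub>F \<rho> in gen (with_Cohen P). \<exists>!v. ev P (fst \<circ> \<rho>) \<tau> n v"
    using gen_fst[OF P assms] by (rule eventually_mono) (simp add: total_name_def)
qed

text \<open>Values of \<open>X\<close> that are decided beyond the present end of the Cohen part can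
  still be copied into it.\<close>

lemma cohen_agree:
  assumes X: "\<forall>\<^sub>F G in gen P. total_name P G X"
    and f: "\<forall>\<^sub>F G in gen P. total_name P G f \<and> strict_mono (fn P G f)"
  shows "\<forall>\<^sub>F \<rho> in gen (with_Cohen P). \<forall>N. \<exists>k\<ge>N. agree (cohen \<rho>) (fn P (fst \<circ> \<rho>) X) (fn P (fst \<circ> \<rho>) f) k"
proof -
  let ?C = "with_Cohen P"
  define D where "D N = {y. \<exists>k u v w. N \<le> k \<and> length w = v \<and> v \<le> length (snd y) \<and> decides f X k u v w P (fst y) \<and>
    (\<forall>j. u \<le> j \<longrightarrow> j < v \<longrightarrow> snd y ! j = w ! j)}" for N
  have "dense_in ?C (D N)" for N
    unfolding dense_in_def
  proof
    fix y assume y: "y \<in> conds ?C"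
    \<comment> \<open>With an index of at least \<open>length (snd y)\<close>, the decided interval
      begins where the Cohen part is still free.\<close>
    let ?s = "snd y" and ?k = "max N (length (snd y))"
    from y have "fst y \<in> conds P" by (simp add: conds_with_Cohen)
    from decides_exists[OF P this X f, of ?k] obtain q u v w where q: "q \<in> conds P" "leq P q (fst y)"
      "?k \<le> u" "u < v" "length w = v" "decides f X ?k u v w P q" by blast
    define s where "s = ?s @ drop (length ?s) w"
    have "length s = v" using q(3-5) by (simp add: s_def)
    moreover have "s ! j = w ! j" if "u \<le> j" "j < v" for j
      using that q(3-5) by (simp add: s_def nth_append)
    ultimately have "(q, s) \<in> D N" using q unfolding D_def
      by (intro CollectI exI[of _ ?k] exI[of _ u] exI[of _ v] exI[of _ w]) simp
    moreover have "(q, s) \<in> conds ?C" "leq ?C (q, s) y"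
      using q by (simp_all add: conds_with_Cohen leq_with_Cohen s_def)
    ultimately show "\<exists>q\<in>conds ?C. leq ?C q y \<and> q \<in> D N" by blast
  qed
  then have dense: "\<forall>\<^sub>F \<rho> in gen ?C. \<forall>N. \<exists>i. \<rho> i \<in> D N"
    by (intro eventually_gen_all eventually_dense)
  have "\<forall>\<^sub>F G in gen P. \<forall>k u v w. holds P G (decides f X k u v w) \<longleftrightarrow> ev P G f k u \<and> ev P G f (Suc k) v \<and>
    (\<forall>j. j < length w \<longrightarrow> ev P G X j (w ! j))"
    using repr_decides[OF P, of f X] unfolding repr_def by (intro eventually_gen_all) blast
  from gen_fst[OF P this] gen_fst[OF P X] gen_fst[OF P f] cohen_total dense
  show ?thesis
  proof eventually_elim
    case (elim \<rho>)
    show ?case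
    proof
      fix N
      obtain i where "\<rho> i \<in> D N" using elim(5) by blast
      then obtain k u v w where k: "N \<le> k" "length w = v" "v \<le> length (snd (\<rho> i))" "decides f X k u v w P (fst (\<rho> i))"
        "\<And>j. u \<le> j \<Longrightarrow> j < v \<Longrightarrow> snd (\<rho> i) ! j = w ! j" unfolding D_def by blast
      then have "holds P (fst \<circ> \<rho>) (decides f X k u v w)" by (auto simp: holds_def)
      then have e: "ev P (fst \<circ> \<rho>) f k u" "ev P (fst \<circ> \<rho>) f (Suc k) v"
        "\<And>j. j < v \<Longrightarrow> ev P (fst \<circ> \<rho>) X j (w ! j)" using elim(1) k(2) by auto
      have fk: "fn P (fst \<circ> \<rho>) f k = u" "fn P (fst \<circ> \<rho>) f (Suc k) = v" using e elim(3) by (simp_all add: fn_iff)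
      have "agree (cohen \<rho>) (fn P (fst \<circ> \<rho>) X) (fn P (fst \<circ> \<rho>) f) k"
        unfolding agree_def fk
      proof (intro allI impI)
        fix j assume j: "u \<le> j" "j < v"
        then have "cohen \<rho> j = w ! j" using cohen_nth[OF elim(4), of j i] k(3,5) by simp
        then show "cohen \<rho> j = fn P (fst \<circ> \<rho>) X j" using e(3)[OF j(2)] elim(2) by (simp add: fn_iff)
      qed
      then show "\<exists>k\<ge>N. agree (cohen \<rho>) (fn P (fst \<circ> \<rho>) X) (fn P (fst \<circ> \<rho>) f) k" using k(1) by blast
    qed
  qed
qed

end

section \<open>The generic reals of \<open>P_x\<close>\<close>

definition t_of :: "('a, 'i) cond \<Rightarrow> 'a \<Rightarrow> nat list" where
  "t_of p a = (if a \<in> supp p then t_part p a else [])"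

context
  fixes R :: "'a::order set"
  assumes R: "wfp_on R (<)" and index: "infinite (UNIV :: 'i set)"
begin

lemma descending_P:
  fixes G :: "nat \<Rightarrow> ('a, 'i) cond"
  assumes "descending (\<P> R x) G"
  shows "good R (G i)" "supp (G i) \<subseteq> Qbelow R x" "i \<le> j \<Longrightarrow> le R (G j) (G i)"
proof -
  have c: "G i \<in> conds (\<P> R x)" for i using assms by (simp add: descending_def)
  then show "good R (G i)" "supp (G i) \<subseteq> Qbelow R x" for i by (simp_all add: conds_P)
  then show "i \<le> j \<Longrightarrow> le R (G j) (G i)"
    using descending_le[OF forcing_notion_P[OF R] assms, of i j] by (simp add: leq_P)
qed

lemma t_of_prefix: "le R p q \<Longrightarrow> prefix (t_of q a) (t_of p a)"
  using t_part_prefix[of R p q a] by (auto simp: t_of_def le_def)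

lemma ev_d:
  fixes G :: "nat \<Rightarrow> ('a, 'i) cond"
  assumes G: "descending (\<P> R x) G"
  shows "ev (\<P> R x) G (d_name (\<P> R x) a) n k \<longleftrightarrow> (\<exists>i. n < length (t_of (G i) a) \<and> t_of (G i) a ! n = k)"
proof
  assume "ev (\<P> R x) G (d_name (\<P> R x) a) n k"
  then obtain i q where q: "q \<in> conds (\<P> R x)" "a \<in> supp q" "n < length (t_part q a)" "k = t_part q a ! n"
    "leq (\<P> R x) (G i) q" by (auto simp: ev_def d_name_def)
  then have "le R (G i) q" by (simp add: conds_P leq_P)
  from t_of_prefix[OF this, of a] have "prefix (t_part q a) (t_of (G i) a)" using q(2) by (simp add: t_of_def)
  then show "\<exists>i. n < length (t_of (G i) a) \<and> t_of (G i) a ! n = k"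
    using prefix_nth[OF _ q(3)] q(4) by blast
next
  assume "\<exists>i. n < length (t_of (G i) a) \<and> t_of (G i) a ! n = k"
  then obtain i where i: "n < length (t_of (G i) a)" "t_of (G i) a ! n = k" by blast
  have c: "G i \<in> conds (\<P> R x)" using G by (simp add: descending_def)
  have "a \<in> supp (G i)" using i by (auto simp: t_of_def split: if_splits)
  then have "(G i, n, k) \<in> d_name (\<P> R x) a" using i c by (simp add: d_name_def t_of_def)
  then show "ev (\<P> R x) G (d_name (\<P> R x) a) n k"
    using c leq_refl[OF forcing_notion_P[OF R] c] unfolding ev_def by blast
qed

lemma ev_c:
  fixes G :: "nat \<Rightarrow> ('a, 'i) cond"
  assumes G: "descending (\<P> R x) G"
  shows "ev (\<P> R x) G (c_name R (\<P> R x) \<alpha>) n k \<longleftrightarrow> (\<exists>i. n < length (s_of (G i) \<alpha>) \<and> s_of (G i) \<alpha> ! n = k)"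
proof
  assume "ev (\<P> R x) G (c_name R (\<P> R x) \<alpha>) n k"
  then obtain i q where q: "q \<in> conds (\<P> R x)" "\<alpha> \<in> ranks R (supp q)" "n < length (s_part q \<alpha>)" "k = s_part q \<alpha> ! n"
    "leq (\<P> R x) (G i) q" by (auto simp: ev_def c_name_def)
  then have g: "good R q" and le: "le R (G i) q" by (simp_all add: conds_P leq_P)
  have "prefix (s_part q \<alpha>) (s_of (G i) \<alpha>)"
    using s_of_prefix[OF descending_P(1)[OF G] g le, of \<alpha>] s_of_eq[OF g q(2)] by simp
  then show "\<exists>i. n < length (s_of (G i) \<alpha>) \<and> s_of (G i) \<alpha> ! n = k"
    using q(3,4) by (intro exI[of _ i]) (auto simp: prefix_def nth_append)
next
  assume "\<exists>i. n < length (s_of (G i) \<alpha>) \<and> s_of (G i) \<alpha> ! n = k"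
  then obtain i where i: "n < length (s_of (G i) \<alpha>)" "s_of (G i) \<alpha> ! n = k" by blast
  have c: "G i \<in> conds (\<P> R x)" using G by (simp add: descending_def)
  have g: "good R (G i)" by (rule descending_P(1)[OF G])
  have "\<alpha> \<in> dom (side (G i))" using i(1) by (auto simp: s_of_def split: option.splits)
  then have "\<alpha> \<in> ranks R (supp (G i))" using g by (simp add: good_def)
  then have "(G i, n, k) \<in> c_name R (\<P> R x) \<alpha>" using i c s_of_eq[OF g] by (simp add: c_name_def)
  then show "ev (\<P> R x) G (c_name R (\<P> R x) \<alpha>) n k"
    using c leq_refl[OF forcing_notion_P[OF R] c] unfolding ev_def by blast
qed

text \<open>The sequence \<open>t_a\<close> gets arbitrarily long by iterating
  \<open>extend_t\<close>. The third clause is kept because later arguments look for a condition in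
  which a given value of \<open>d_a\<close> is already fixed.\<close>

lemma generic_d:
  assumes a: "a \<in> Qbelow R x"
  shows "\<forall>\<^sub>F G in gen (\<P> R x :: ('a, 'i) cond forcing). total_name (\<P> R x) G (d_name (\<P> R x) a) \<and>
    strict_mono (fn (\<P> R x) G (d_name (\<P> R x) a)) \<and> (\<forall>n. \<exists>i. a \<in> supp (G i) \<and> n < length (t_part (G i) a))"
proof -
  let ?P = "\<P> R x :: ('a, 'i) cond forcing"
  have "\<forall>\<^sub>F G in gen ?P. \<forall>n. \<exists>i. G i \<in> {r. a \<in> supp r \<and> n < length (t_part r a)}"
  proof (intro eventually_gen_all eventually_dense dense_P[OF R index a])
    fix n and p :: "('a, 'i) cond" assume p: "good R p" "supp p \<subseteq> Qbelow R x" "a \<in> supp p"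
    have "\<exists>r. good R r \<and> supp r \<subseteq> Qbelow R x \<and> le R r p \<and> a \<in> supp r \<and> m \<le> length (t_part r a)" for m
    proof (induction m)
      case 0
      show ?case using p le_refl[OF R p(1)] by blast
    next
      case (Suc m)
      then obtain r where r: "good R r" "supp r \<subseteq> Qbelow R x" "le R r p" "a \<in> supp r" "m \<le> length (t_part r a)" by blast
      obtain r' v where r': "good R r'" "supp r' \<subseteq> Qbelow R x" "le R r' r" "t_part r' a = t_part r a @ [v]"
        using extend_t[OF R index r(1,2,4)] by blast
      have "le R r' p" by (rule le_trans[OF R index r'(1) r(1) p(1) r'(2) r'(3) r(3)])
      moreover have "a \<in> supp r'" using r'(3) r(4) by (auto simp: le_def)
      moreover have "Suc m \<le> length (t_part r' a)" using r(5) r'(4) by simp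
      ultimately show ?case using r'(1,2) by blast
    qed
    from this[of "Suc n"]
    show "\<exists>r. good R r \<and> supp r \<subseteq> Qbelow R x \<and> le R r p \<and> r \<in> {r. a \<in> supp r \<and> n < length (t_part r a)}"
      by (simp add: Suc_le_eq)
  qed
  with eventually_descending[of ?P] show ?thesis
  proof eventually_elim
    case (elim G)
    let ?d = "d_name ?P a" and ?L = "\<lambda>i. t_of (G i) a"
    have len: "\<exists>i. n < length (?L i)" for n using elim(2) by (simp add: t_of_def) metis
    have pre: "prefix (?L i) (?L j)" if "i \<le> j" for i j by (rule t_of_prefix[OF descending_P(3)[OF elim(1) that]])
    have tot: "total_name ?P G ?d" unfolding total_name_def ev_d[OF elim(1)] using chain_limit[of ?L, OF pre len] by blast
    have fnd: "fn ?P G ?d n = ?L i ! n" if "n < length (?L i)" for n i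
      using that ev_d[OF elim(1), of a n "?L i ! n"] fn_iff[OF tot] by blast
    have "strict_mono (fn ?P G ?d)" unfolding strict_mono_Suc_iff
    proof
      fix n
      obtain i where i: "Suc n < length (?L i)" using len by blast
      have "a \<in> supp (G i)" using i by (auto simp: t_of_def split: if_splits)
      then have "sorted_wrt (<) (?L i)" using descending_P(1)[OF elim(1), of i] by (simp add: good_def t_of_def)
      then have "?L i ! n < ?L i ! Suc n" using i by (simp add: sorted_wrt_iff_nth_less)
      then show "fn ?P G ?d n < fn ?P G ?d (Suc n)"
        using fnd[of n i] fnd[of "Suc n" i] i by simp
    qed
    then show ?case using tot elim(2) by simp
  qed
qed

lemma fn_d:
  fixes G :: "nat \<Rightarrow> ('a, 'i) cond"
  assumes G: "descending (\<P> R x) G" and tot: "total_name (\<P> R x) G (d_name (\<P> R x) a)"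
    and "a \<in> supp (G i)" "n < length (t_part (G i) a)"
  shows "fn (\<P> R x) G (d_name (\<P> R x) a) n = t_part (G i) a ! n"
proof -
  have "ev (\<P> R x) G (d_name (\<P> R x) a) n (t_part (G i) a ! n)"
    unfolding ev_d[OF G] using assms(3,4) by (intro exI[of _ i]) (simp add: t_of_def)
  then show ?thesis using fn_iff[OF tot] by blast
qed

lemma generic_c:
  assumes b: "b \<in> Qbelow R x"
  shows "\<forall>\<^sub>F G in gen (\<P> R x :: ('a, 'i) cond forcing). total_name (\<P> R x) G (c_name R (\<P> R x) (rank R (El b))) \<and>
    fn (\<P> R x) G (c_name R (\<P> R x) (rank R (El b))) = cohen (proj R b \<circ> G)"
proof -
  let ?P = "\<P> R x :: ('a, 'i) cond forcing"
  from gen_proj[OF R index b cohen_total[OF forcing_notion_P[OF R]]] eventually_descending[of ?P]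
  show ?thesis
  proof eventually_elim
    case (elim G)
    let ?c = "c_name R ?P (rank R (El b))"
    have e: "ev ?P G ?c n v \<longleftrightarrow> (\<exists>i. n < length (snd ((proj R b \<circ> G) i)) \<and> snd ((proj R b \<circ> G) i) ! n = v)" for n v
      unfolding ev_c[OF elim(2)] by (simp add: proj_def)
    have "total_name ?P G ?c" unfolding total_name_def e using elim(1) .
    moreover have "fn ?P G ?c = cohen (proj R b \<circ> G)" unfolding fn_def cohen_def e by (rule ext) simp
    ultimately show ?case by simp
  qed
qed

text \<open>A condition can be strengthened to one whose \<open>f_a\<close> dominates
  \<open>g\<close>, by merging the names and leaving \<open>t_a\<close> alone. From then on (3b)
  puts an interval of \<open>f_a\<close>, and hence one of \<open>g\<close>, into every new interval
  of \<open>t_a\<close>.\<close>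

lemma generic_dominates:
  fixes g :: "'i \<Rightarrow> (('a, 'i) cond \<times> bool list) \<times> nat \<times> nat"
  assumes a: "a \<in> Qbelow R x" and g: "incr_name (with_Cohen (\<P> R (El a))) (range g)"
  shows "\<forall>\<^sub>F G in gen (\<P> R x :: ('a, 'i) cond forcing). \<exists>m. \<forall>n\<ge>m. \<exists>k.
    {fn (with_Cohen (\<P> R (El a))) (proj R a \<circ> G) (range g) k..<fn (with_Cohen (\<P> R (El a))) (proj R a \<circ> G) (range g) (Suc k)}
    \<subseteq> {fn (\<P> R x) G (d_name (\<P> R x) a) n..<fn (\<P> R x) G (d_name (\<P> R x) a) (Suc n)}"
proof -
  let ?P = "\<P> R x :: ('a, 'i) cond forcing"
  let ?C = "with_Cohen (\<P> R (El a)) :: (('a, 'i) cond \<times> bool list) forcing"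
  note C = forcing_notion_PC[OF R, of "El a"]
  let ?D = "{r. a \<in> supp r \<and> (\<forall>y\<in>conds ?C. dominates (f_part r a) (range g) ?C y)}"
  have "dense_in ?P ?D"
  proof (rule dense_P[OF R index a])
    fix p :: "('a, 'i) cond" assume p: "good R p" "supp p \<subseteq> Qbelow R x" "a \<in> supp p"
    have inc: "incr_name ?C (f_part p a)" and srt: "sorted_wrt (<) (t_part p a)" using p by (simp_all add: good_def)
    obtain h :: "'i \<Rightarrow> (('a, 'i) cond \<times> bool list) \<times> nat \<times> nat" where h: "incr_name ?C (range h)"
      "\<forall>y\<in>conds ?C. dominates (range h) (f_part p a) ?C y \<and> dominates (range h) (range g) ?C y"
      using merge_names[OF index C ccc_PC[OF R index] inc g] by blast
    let ?r = "upd p a (t_part p a) h"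
    let ?y = "(restr R p (El a), s_part p (rank R (El a)))"
    have y: "?y \<in> conds ?C" by (rule stage_conds_pair[OF p(1)])
    have r: "good R ?r" by (rule upd_extends(1)[OF R p(1,3) srt h(1)])
    have "le R ?r p"
    proof (rule upd_extends(2)[OF R p(1,3) srt h(1)])
      show "dominates (range h) (f_part p a) ?C ?y" using h(2) y by blast
      show "fresh (f_part p a) (t_part p a) (t_part p a) ?C ?y" by (rule fresh_trivial[OF C y]) simp
      show "le4 ?r p c a" for c by (simp add: le4_def parts_upd)
    qed simp
    moreover have "supp ?r = supp p" using p(3) by (auto simp: supp_upd)
    moreover have "f_part ?r a = range h" by (simp add: parts_upd)
    ultimately show "\<exists>r. good R r \<and> supp r \<subseteq> Qbelow R x \<and> le R r p \<and> r \<in> ?D"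
      using r p h(2) by (intro exI[of _ ?r]) simp
  qed
  note dense = eventually_dense[OF this]
  have "\<forall>\<^sub>F \<rho> in gen ?C. \<forall>t t'. holds ?C \<rho> (fresh (range g) t t') \<longleftrightarrow>
    (\<forall>n. 1 \<le> n \<and> length t \<le> n \<and> n < length t' \<longrightarrow> (\<exists>k. \<forall>j. in_int ?C \<rho> (range g) k j \<longrightarrow> t' ! (n - 1) \<le> j \<and> j < t' ! n))"
    using repr_fresh[OF C, of "range g"] unfolding repr_def by (intro eventually_gen_all) blast
  from gen_proj[OF R index a this] gen_proj[OF R index a incr_name_total[OF C g]] dense generic_d[OF a]
    eventually_descending[of ?P]
  show ?thesis
  proof eventually_elim
    case (elim G)
    let ?\<rho> = "proj R a \<circ> G" and ?d = "d_name ?P a"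
    have tot: "total_name ?P G ?d" using elim(4) by simp
    obtain i where i: "a \<in> supp (G i)" "\<forall>y\<in>conds ?C. dominates (f_part (G i) a) (range g) ?C y" using elim(3) by blast
    let ?t = "t_part (G i) a"
    show ?case
    proof (rule exI[of _ "length ?t"], intro allI impI)
      fix n assume n: "length ?t \<le> n"
      obtain j0 where j0: "a \<in> supp (G j0)" "Suc n < length (t_part (G j0) a)" using elim(4) by blast
      define j where "j = max i j0"
      have le: "le R (G j) (G i)" "le R (G j) (G j0)" using descending_P(3)[OF elim(5)] by (simp_all add: j_def)
      have aj: "a \<in> supp (G j)" using le(1) i(1) by (auto simp: le_def)
      let ?t' = "t_part (G j) a"
      have len: "Suc n < length ?t'" using t_part_prefix[OF le(2) j0(1)] j0(2) prefix_length_le by fastforce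
      have gj: "good R (G j)" by (rule descending_P(1)[OF elim(5)])
      have \<rho>j: "?\<rho> j = (restr R (G j) (El a), s_part (G j) (rank R (El a)))"
        using s_of_eq[OF gj ranksI[OF aj]] by (simp add: proj_def)
      have y: "?\<rho> j \<in> conds ?C" unfolding \<rho>j by (rule stage_conds_pair[OF gj])
      have "le3 R (G j) (G i) a" using le(1) i(1) by (simp add: le_def)
      then have fr: "fresh (f_part (G i) a) ?t ?t' ?C (?\<rho> j)" and pre: "prefix ?t ?t'"
        unfolding le3_def fconj_def \<rho>j by simp_all
      \<comment> \<open>\<open>fresh_trans\<close> with the middle sequence equal to the initial one
        merely replaces the name \<open>f_a\<close> by the dominated name \<open>g\<close>.\<close>
      have "fresh (range g) ?t ?t' ?C (?\<rho> j)"
        by (rule fresh_trans[OF C y prefix_order.refl pre bspec[OF i(2) y] fresh_trivial[OF C y order.refl] fr])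
      then have "holds ?C ?\<rho> (fresh (range g) ?t ?t')" unfolding holds_def by (rule exI)
      then have "\<forall>n. 1 \<le> n \<and> length ?t \<le> n \<and> n < length ?t' \<longrightarrow>
        (\<exists>k. \<forall>j. in_int ?C ?\<rho> (range g) k j \<longrightarrow> ?t' ! (n - 1) \<le> j \<and> j < ?t' ! n)"
        using elim(1) by blast
      from spec[OF this, of "Suc n"] obtain k where k: "\<forall>l. in_int ?C ?\<rho> (range g) k l \<longrightarrow> ?t' ! n \<le> l \<and> l < ?t' ! Suc n"
        using len n by auto
      have "fn ?P G ?d n = ?t' ! n" "fn ?P G ?d (Suc n) = ?t' ! Suc n"
        using fn_d[OF elim(5) tot aj] len by simp_all
      then show "\<exists>k. {fn ?C ?\<rho> (range g) k..<fn ?C ?\<rho> (range g) (Suc k)} \<subseteq> {fn ?P G ?d n..<fn ?P G ?d (Suc n)}"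
        using k elim(2) by (intro exI[of _ k] subsetI) (simp add: in_int_iff)
    qed
  qed
qed

lemma generic_same_rank:
  assumes a: "a \<in> Qbelow R x" and b: "b \<in> Qbelow R x" and ab: "a < b" "rank R (El a) = rank R (El b)"
  shows "\<forall>\<^sub>F G in gen (\<P> R x :: ('a, 'i) cond forcing). \<exists>m. \<forall>n\<ge>m. \<exists>k.
    {fn (\<P> R x) G (d_name (\<P> R x) a) k..<fn (\<P> R x) G (d_name (\<P> R x) a) (Suc k)}
    \<subseteq> {fn (\<P> R x) G (d_name (\<P> R x) b) n..<fn (\<P> R x) G (d_name (\<P> R x) b) (Suc n)}"
proof -
  let ?P = "\<P> R x :: ('a, 'i) cond forcing"
  from generic_d[OF a] generic_d[OF b] eventually_descending[of ?P]
  show ?thesis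
  proof eventually_elim
    case (elim G)
    let ?d = "\<lambda>a. fn ?P G (d_name ?P a)"
    obtain ia ib where "a \<in> supp (G ia)" "b \<in> supp (G ib)" using elim by blast
    moreover define i where "i = max ia ib"
    moreover have "le R (G i) (G ia)" "le R (G i) (G ib)" using descending_P(3)[OF elim(3)] by (simp_all add: i_def)
    ultimately have i: "a \<in> supp (G i)" "b \<in> supp (G i)" by (auto simp: le_def)
    show ?case
    proof (rule exI[of _ "length (t_part (G i) b)"], intro allI impI)
      fix n assume n: "length (t_part (G i) b) \<le> n"
      obtain j0 where j0: "b \<in> supp (G j0)" "Suc n < length (t_part (G j0) b)" using elim(2) by blast
      define j where "j = max i j0"
      have le: "le R (G j) (G i)" "le R (G j) (G j0)" using descending_P(3)[OF elim(3)] by (simp_all add: j_def)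
      have j: "a \<in> supp (G j)" "b \<in> supp (G j)" using le(1) i by (auto simp: le_def)
      have len: "Suc n < length (t_part (G j) b)"
        using t_part_prefix[OF le(2) j0(1)] j0(2) prefix_length_le by fastforce
      have "le4 (G j) (G i) a b" using le(1) i ab unfolding le_def by blast
      \<comment> \<open>Clause (4) names an interval by the index of its right end, so the
        \<open>n\<close>-th interval of \<open>d_b\<close> is reached at \<open>Suc n\<close>, and
        the interval of \<open>d_a\<close> inside it has index \<open>k - 1\<close>.\<close>
      then obtain k where k: "1 \<le> k" "k < length (t_part (G j) a)"
        "{t_part (G j) a ! (k - 1)..<t_part (G j) a ! k} \<subseteq> {t_part (G j) b ! (Suc n - 1)..<t_part (G j) b ! Suc n}"
        using len n unfolding le4_def by (elim allE[of _ "Suc n"]) auto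
      have "?d b n = t_part (G j) b ! n" "?d b (Suc n) = t_part (G j) b ! Suc n"
        using fn_d[OF elim(3) _ j(2)] elim(2) len by simp_all
      moreover have "?d a (k - 1) = t_part (G j) a ! (k - 1)" "?d a (Suc (k - 1)) = t_part (G j) a ! k"
        using fn_d[OF elim(3) _ j(1)] elim(1) k(1,2) by simp_all
      ultimately show "\<exists>k. {?d a k..<?d a (Suc k)} \<subseteq> {?d b n..<?d b (Suc n)}"
        using k(3) by (intro exI[of _ "k - 1"]) simp
    qed
  qed
qed

text \<open>As \<open>a\<close> is not below \<open>b\<close>, prolonging \<open>t_b\<close> by
  \<open>extend_t\<close> leaves \<open>t_a\<close> alone. In the outcome, two consecutive values of
  \<open>d_a\<close> strictly enclose a whole interval of \<open>d_b\<close>, which therefore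
  contains no interval of \<open>d_a\<close>.\<close>

lemma generic_incomparable:
  assumes a: "a \<in> Qbelow R x" and b: "b \<in> Qbelow R x" and ab: "\<not> a \<le> b"
  shows "\<forall>\<^sub>F G in gen (\<P> R x :: ('a, 'i) cond forcing). \<forall>m. \<exists>n\<ge>m. \<forall>k. \<not>
    {fn (\<P> R x) G (d_name (\<P> R x) a) k..<fn (\<P> R x) G (d_name (\<P> R x) a) (Suc k)}
    \<subseteq> {fn (\<P> R x) G (d_name (\<P> R x) b) n..<fn (\<P> R x) G (d_name (\<P> R x) b) (Suc n)}"
proof -
  let ?P = "\<P> R x :: ('a, 'i) cond forcing"
  let ?D = "\<lambda>m. {r. a \<in> supp r \<and> b \<in> supp r \<and> (\<exists>n K. m \<le> n \<and> Suc n < length (t_part r b) \<and> Suc K < length (t_part r a) \<and>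
    t_part r a ! K < t_part r b ! n \<and> t_part r b ! Suc n < t_part r a ! Suc K)}"
  have "\<forall>\<^sub>F G in gen ?P. \<forall>m. \<exists>i. G i \<in> ?D m"
  proof (intro eventually_gen_all eventually_dense dense_P[OF R index a])
    fix m and p :: "('a, 'i) cond" assume p: "good R p" "supp p \<subseteq> Qbelow R x" "a \<in> supp p"
    have "p \<in> conds ?P" using p by (simp add: conds_P)
    \<comment> \<open>A generic sequence is used merely to find an extension in which
      \<open>t_a\<close> is nonempty and \<open>t_b\<close> is longer than \<open>m\<close>.\<close>
    then obtain G where G: "descending ?P G" "G 0 = p"
      "\<forall>n. \<exists>i. a \<in> supp (G i) \<and> n < length (t_part (G i) a)" "\<forall>n. \<exists>i. b \<in> supp (G i) \<and> n < length (t_part (G i) b)"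
      using generic_exists[OF forcing_notion_P[OF R] _ eventually_conj[OF generic_d[OF a] generic_d[OF b]]] by blast
    obtain i1 i2 where i1: "a \<in> supp (G i1)" "0 < length (t_part (G i1) a)"
      and i2: "b \<in> supp (G i2)" "m < length (t_part (G i2) b)" using G(3,4) by blast
    define q where "q = G (max i1 i2)"
    have q: "good R q" "supp q \<subseteq> Qbelow R x" using descending_P[OF G(1)] by (simp_all add: q_def)
    have qp: "le R q p" "le R q (G i1)" "le R q (G i2)"
      using descending_P(3)[OF G(1), of 0 "max i1 i2"] descending_P(3)[OF G(1), of i1 "max i1 i2"]
        descending_P(3)[OF G(1), of i2 "max i1 i2"] G(2) by (simp_all add: q_def)
    have qs: "a \<in> supp q" "b \<in> supp q" using qp(2,3) i1 i2 by (auto simp: le_def)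
    have ta: "t_part q a \<noteq> []" using t_part_prefix[OF qp(2) i1(1)] i1(2) by auto
    have tb: "m < length (t_part q b)"
      using t_part_prefix[OF qp(3) i2(1)] i2(2) prefix_length_le by fastforce
    obtain r1 u where r1: "good R r1" "supp r1 \<subseteq> Qbelow R x" "le R r1 q" "t_part r1 b = t_part q b @ [u]"
      "last (t_part q a) < u" "\<forall>e\<in>supp q. \<not> e \<le> b \<longrightarrow> main r1 e = main q e"
      using extend_t[OF R index q qs(2), of "last (t_part q a)"] by blast
    have s1: "a \<in> supp r1" "b \<in> supp r1" using r1(3) qs by (auto simp: le_def)
    obtain r2 v where r2: "good R r2" "supp r2 \<subseteq> Qbelow R x" "le R r2 r1" "t_part r2 b = t_part r1 b @ [v]"
      "\<forall>e\<in>supp r1. \<not> e \<le> b \<longrightarrow> main r2 e = main r1 e"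
      using extend_t[OF R index r1(1,2) s1(2), of 0] by blast
    have s2: "a \<in> supp r2" "b \<in> supp r2" using r2(3) s1 by (auto simp: le_def)
    have "main r2 a = main q a" using r1(6) r2(5) ab qs(1) s1(1) by simp
    then have ta2: "t_part r2 a = t_part q a" by (simp add: t_part_def)
    obtain r3 w where r3: "good R r3" "supp r3 \<subseteq> Qbelow R x" "le R r3 r2" "t_part r3 a = t_part r2 a @ [w]" "v < w"
      using extend_t[OF R index r2(1,2) s2(1), of v] by blast
    have s3: "a \<in> supp r3" "b \<in> supp r3" using r3(3) s2 by (auto simp: le_def)
    have pre: "prefix (t_part r2 b) (t_part r3 b)" by (rule t_part_prefix[OF r3(3) s2(2)])
    let ?n = "length (t_part q b)" and ?K = "length (t_part q a) - 1"
    have b2: "t_part r2 b = t_part q b @ [u, v]" using r1(4) r2(4) by simp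
    have "Suc ?n < length (t_part r3 b)" "t_part r3 b ! ?n = u" "t_part r3 b ! Suc ?n = v"
      using prefix_nth[OF pre, of ?n] prefix_nth[OF pre, of "Suc ?n"] by (simp_all add: b2 nth_append)
    moreover have "Suc ?K < length (t_part r3 a)" "t_part r3 a ! ?K = last (t_part q a)" "t_part r3 a ! Suc ?K = w"
      using ta by (simp_all add: r3(4) ta2 nth_append last_conv_nth)
    ultimately have "r3 \<in> ?D m" using s3 tb r1(5) r3(5) by (intro CollectI conjI exI[of _ ?n] exI[of _ ?K]) simp_all
    moreover have "le R r3 p"
    proof -
      have "le R r3 r1" by (rule le_trans[OF R index r3(1) r2(1) r1(1) r3(2) r3(3) r2(3)])
      then have "le R r3 q" by (rule le_trans[OF R index r3(1) r1(1) q(1) r3(2) _ r1(3)])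
      then show ?thesis by (rule le_trans[OF R index r3(1) q(1) p(1) r3(2) _ qp(1)])
    qed
    ultimately show "\<exists>r. good R r \<and> supp r \<subseteq> Qbelow R x \<and> le R r p \<and> r \<in> ?D m" using r3(1,2) by blast
  qed
  from this generic_d[OF a] generic_d[OF b] eventually_descending[of ?P]
  show ?thesis
  proof eventually_elim
    case (elim G)
    let ?d = "\<lambda>a. fn ?P G (d_name ?P a)"
    have sa: "strict_mono (?d a)" using elim(2) by simp
    show ?case
    proof
      fix m
      obtain i n K where i: "a \<in> supp (G i)" "b \<in> supp (G i)" "m \<le> n" "Suc n < length (t_part (G i) b)"
        "Suc K < length (t_part (G i) a)" "t_part (G i) a ! K < t_part (G i) b ! n"
        "t_part (G i) b ! Suc n < t_part (G i) a ! Suc K" using elim(1) by blast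
      have d: "?d a K < ?d b n" "?d b (Suc n) < ?d a (Suc K)"
        using fn_d[OF elim(4) _ i(1)] fn_d[OF elim(4) _ i(2)] elim(2,3) i(4-7) by simp_all
      have "\<not> {?d a k..<?d a (Suc k)} \<subseteq> {?d b n..<?d b (Suc n)}" for k
      proof
        assume sub: "{?d a k..<?d a (Suc k)} \<subseteq> {?d b n..<?d b (Suc n)}"
        have "?d a k < ?d a (Suc k)" using sa by (simp add: strict_mono_Suc_iff)
        then have k: "?d b n \<le> ?d a k" "?d a k < ?d b (Suc n)" using sub by (auto simp: subset_iff)
        show False
        proof (cases "k \<le> K")
          case True
          then have "?d a k \<le> ?d a K" using strict_mono_less_eq[OF sa] by simp
          then show False using k(1) d(1) by linarith
        next
          case False
          then have "?d a (Suc K) \<le> ?d a k" using strict_mono_less_eq[OF sa] by simp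
          then show False using k(2) d(2) by linarith
        qed
      qed
      then show "\<exists>n\<ge>m. \<forall>k. \<not> {?d a k..<?d a (Suc k)} \<subseteq> {?d b n..<?d b (Suc n)}" using i(3) by blast
    qed
  qed
qed

text \<open>The inclusion is composed of two: from \<open>f\<close> to its grouping \<open>V\<close>
  the real changes from \<open>x\<close> to \<open>c_b\<close>, and from \<open>V\<close> to
  \<open>d_b\<close> only the partition changes. The grouping depends on the \<open>P_b\<close>-part
  and on the Cohen real, hence has a name of exactly the kind that \<open>d_b\<close>
  dominates.\<close>

lemma generic_cover:
  fixes X :: "(('a, 'i) cond, bool) fun_name"
  assumes b: "b \<in> Qbelow R x"
    and X: "\<forall>\<^sub>F G in gen (\<P> R (El b)). total_name (\<P> R (El b)) G X"
    and f: "\<forall>\<^sub>F G in gen (\<P> R (El b)). total_name (\<P> R (El b)) G f \<and> strict_mono (fn (\<P> R (El b)) G f)"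
  shows "\<forall>\<^sub>F G in gen (\<P> R x).
    E_set (fn (\<P> R (El b)) ((\<lambda>p. restr R p (El b)) \<circ> G) X) (fn (\<P> R (El b)) ((\<lambda>p. restr R p (El b)) \<circ> G) f) \<subseteq>
    E_set (fn (\<P> R x) G (c_name R (\<P> R x) (rank R (El b)))) (fn (\<P> R x) G (d_name (\<P> R x) b))"
proof -
  let ?B = "\<P> R (El b) :: ('a, 'i) cond forcing" and ?P = "\<P> R x :: ('a, 'i) cond forcing"
  let ?C = "with_Cohen ?B"
  note B = forcing_notion_P[OF R, of "El b"] and C = forcing_notion_PC[OF R, of "El b"]
  define V where "V = (\<lambda>\<rho>. agree_seq (cohen \<rho>) (fn ?B (fst \<circ> \<rho>) X) (fn ?B (fst \<circ> \<rho>) f))"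
  have tf: "\<forall>\<^sub>F G in gen ?B. total_name ?B G f" using f by (rule eventually_mono) simp
  have mV: "meas ?C (\<lambda>\<rho>. V \<rho> n)" for n
    unfolding V_def by (intro meas_agree_seq[OF C] meas_cohen[OF B] meas_fn_fst[OF B] X tf)
  note ag = cohen_agree[OF B X f] and fst_f = gen_fst[OF B f]
  from ag fst_f have "\<forall>\<^sub>F \<rho> in gen ?C. strict_mono (V \<rho>)"
    by eventually_elim (simp add: V_def agree_seq_intervals(1))
  then obtain g :: "'i \<Rightarrow> (('a, 'i) cond \<times> bool list) \<times> nat \<times> nat" where g: "incr_name ?C (range g)"
    "\<forall>\<^sub>F \<rho> in gen ?C. total_name ?C \<rho> (range g) \<and> fn ?C \<rho> (range g) = V \<rho>"
    using incr_name_exists[OF index C ccc_PC[OF R index], of V, OF mV] by blast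
  from generic_dominates[OF b g(1)] gen_proj[OF R index b g(2)] gen_proj[OF R index b ag]
    gen_proj[OF R index b fst_f] generic_d[OF b] generic_c[OF b]
  show ?thesis
  proof eventually_elim
    case (elim G)
    let ?\<rho> = "proj R b \<circ> G" and ?d = "fn ?P G (d_name ?P b)"
    let ?x = "fn ?B (fst \<circ> ?\<rho>) X" and ?f = "fn ?B (fst \<circ> ?\<rho>) f" and ?c = "cohen ?\<rho>"
    have fst: "fst \<circ> ?\<rho> = (\<lambda>p. restr R p (El b)) \<circ> G" by (auto simp: proj_def)
    have sf: "strict_mono ?f" using elim(4) by simp
    have V: "strict_mono (V ?\<rho>)" and
      VI: "\<And>n. \<exists>k. {?f k..<?f (Suc k)} \<subseteq> {V ?\<rho> n..<V ?\<rho> (Suc n)} \<and> agree ?c ?x ?f k"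
      using agree_seq_intervals[OF sf, of ?c ?x] elim(3) unfolding V_def by blast+
    have "E_set ?x ?f \<subseteq> E_set ?c (V ?\<rho>)"
    proof (rule E_set_mono[OF sf V], rule exI[of _ 0], intro allI impI)
      fix n
      obtain k where k: "{?f k..<?f (Suc k)} \<subseteq> {V ?\<rho> n..<V ?\<rho> (Suc n)}" "agree ?c ?x ?f k" using VI by blast
      then show "\<exists>k. {?f k..<?f (Suc k)} \<subseteq> {V ?\<rho> n..<V ?\<rho> (Suc n)} \<and> (\<forall>j\<in>{?f k..<?f (Suc k)}. ?x j = ?c j)"
        by (intro exI[of _ k]) (simp add: agree_def)
    qed
    also have "\<dots> \<subseteq> E_set ?c ?d"
      by (rule E_set_mono[OF V]) (use elim(1,2,5) in auto)
    finally show ?case unfolding fst using elim(6) by simp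
  qed
qed

end

section \<open>The order on the sets \<open>E\<^sub>a\<close>\<close>

lemma mem_mono:
  assumes P: "forcing_notion P" and "mem z X P p" "leq P q p" "p \<in> conds P" "q \<in> conds P"
  shows "mem z X P q"
  using assms(2-) leq_trans[OF P] unfolding mem_def dense_below_def by blast

lemma regular_mem: "forcing_notion P \<Longrightarrow> regular P (mem z X)"
  by (rule regular_dense_below) (auto simp: mem_def)

lemma repr_self: "regular P \<phi> \<Longrightarrow> repr P \<phi> (\<lambda>G. holds P G \<phi>)"
  by (simp add: repr_def)

text \<open>\<open>mem\<close> identifies names with the same evaluation, so the comprehension
  defines the expected set when \<open>\<phi>\<close> depends on \<open>z\<close> only through
  \<open>ev P G z\<close>. The form of \<open>\<Psi>\<close> expresses this.\<close>

lemma mem_comprehension: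
  fixes z :: "'p real_name"
  assumes P: "forcing_notion P" and rp: "\<And>z. repr P (\<phi> z) (\<lambda>G. \<Psi> (ev P G z) G)" and q: "q \<in> conds P"
  shows "mem z {(z, p). p \<in> conds P \<and> \<phi> z P p} P q \<longleftrightarrow> \<phi> z P q"
proof
  have refl: "same_fun z z P r" if "r \<in> conds P" for r
    unfolding repr_forces[OF P repr_same_fun[OF P] that] by (intro always_eventually) simp
  assume \<phi>: "\<phi> z P q"
  show "mem z {(z, p). p \<in> conds P \<and> \<phi> z P p} P q"
    unfolding mem_def dense_below_def
  proof (intro ballI impI)
    fix r assume r: "r \<in> conds P" "leq P r q"
    show "\<exists>s\<in>conds P. leq P s r \<and> (\<exists>(y, p)\<in>{(z, p). p \<in> conds P \<and> \<phi> z P p}. p \<in> conds P \<and> leq P s p \<and> same_fun z y P s)"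
      using r refl[OF r(1)] \<phi> q leq_refl[OF P r(1)] by (intro bexI[of _ r] conjI bexI[of _ "(z, q)"]) auto
  qed
next
  assume m: "mem z {(z, p). p \<in> conds P \<and> \<phi> z P p} P q"
  have "dense_below (\<phi> z P) P q" unfolding dense_below_def
  proof (intro ballI impI)
    fix r assume "r \<in> conds P" "leq P r q"
    then obtain s y p where s: "s \<in> conds P" "leq P s r" "p \<in> conds P" "\<phi> y P p" "leq P s p" "same_fun z y P s"
      using m unfolding mem_def dense_below_def by fast
    have reg: "regular P (\<phi> y)" using rp by (simp add: repr_def)
    have "\<phi> y P s" by (rule regular_mono[OF P reg s(4,5,3,1)])
    then have "\<forall>\<^sub>F G in gen P. met P G s \<longrightarrow> \<Psi> (ev P G y) G" using repr_forces[OF P rp s(1)] by blast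
    moreover have "\<forall>\<^sub>F G in gen P. met P G s \<longrightarrow> (\<forall>n v. ev P G z n v \<longleftrightarrow> ev P G y n v)"
      using repr_forces[OF P repr_same_fun[OF P] s(1)] s(6) by blast
    ultimately have "\<forall>\<^sub>F G in gen P. met P G s \<longrightarrow> \<Psi> (ev P G z) G"
    proof eventually_elim
      case (elim G)
      show ?case
      proof
        assume "met P G s"
        then have "ev P G z = ev P G y" using elim by (intro ext) blast
        then show "\<Psi> (ev P G z) G" using elim \<open>met P G s\<close> by simp
      qed
    qed
    then have "\<phi> z P s" using repr_forces[OF P rp s(1)] by blast
    then show "\<exists>s\<in>conds P. leq P s r \<and> \<phi> z P s" using s by blast
  qed
  then show "\<phi> z P q" using bspec[OF rp[unfolded repr_def regular_def, THEN conjunct1] q] by blast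
qed

lemma mem_E_name:
  assumes P: "forcing_notion P" and q: "q \<in> conds P"
  shows "mem z (E_name P x f) P q \<longleftrightarrow> in_E z x f P q"
proof -
  have "repr P (in_E z x f) (\<lambda>G. (\<forall>n. \<exists>!v. ev P G z n v) \<and> (\<exists>m. \<forall>n. m \<le> n \<longrightarrow>
     (\<exists>j. (\<exists>k l. ev P G f n k \<and> ev P G f (Suc n) l \<and> k \<le> j \<and> j < l) \<and>
       \<not> (\<exists>v. ev P G z j v \<and> ev P G x j v))))" for z
    using repr_in_E[OF P, of z x f] by (simp add: total_name_def)
  from mem_comprehension[OF P, of "\<lambda>z. in_E z x f" "\<lambda>e G. (\<forall>n. \<exists>!v. e n v) \<and> (\<exists>m. \<forall>n. m \<le> n \<longrightarrow>
     (\<exists>j. (\<exists>k l. ev P G f n k \<and> ev P G f (Suc n) l \<and> k \<le> j \<and> j < l) \<and>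
       \<not> (\<exists>v. e j v \<and> ev P G x j v)))", OF this q]
  show ?thesis by (simp add: E_name_def forces_def)
qed

lemma in_E_iff:
  assumes "total_name P G z" "total_name P G x" "total_name P G f"
  shows "(\<exists>m. \<forall>n. m \<le> n \<longrightarrow> (\<exists>j. (\<exists>k l. ev P G f n k \<and> ev P G f (Suc n) l \<and> k \<le> j \<and> j < l) \<and>
       \<not> (\<exists>v. ev P G z j v \<and> ev P G x j v))) \<longleftrightarrow> fn P G z \<in> E_set (fn P G x) (fn P G f)"
proof -
  have "(\<exists>v. ev P G z j v \<and> ev P G x j v) \<longleftrightarrow> fn P G z j = fn P G x j" for j
    using assms(1,2) by (auto simp: fn_iff)
  then show ?thesis using assms(3) by (simp add: fn_iff E_set_def Bex_def conj_assoc)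
qed

lemma forces_in_E:
  assumes P: "forcing_notion P" and p: "p \<in> conds P"
    and x: "\<forall>\<^sub>F G in gen P. total_name P G x" and f: "\<forall>\<^sub>F G in gen P. total_name P G f"
  shows "in_E z x f P p \<longleftrightarrow>
    (\<forall>\<^sub>F G in gen P. met P G p \<longrightarrow> total_name P G z \<and> fn P G z \<in> E_set (fn P G x) (fn P G f))"
  unfolding repr_forces[OF P repr_in_E[OF P] p]
proof (rule eventually_subst)
  from x f show "\<forall>\<^sub>F G in gen P. (met P G p \<longrightarrow> total_name P G z \<and> (\<exists>m. \<forall>n. m \<le> n \<longrightarrow>
     (\<exists>j. (\<exists>k l. ev P G f n k \<and> ev P G f (Suc n) l \<and> k \<le> j \<and> j < l) \<and>
       \<not> (\<exists>v. ev P G z j v \<and> ev P G x j v)))) =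
    (met P G p \<longrightarrow> total_name P G z \<and> fn P G z \<in> E_set (fn P G x) (fn P G f))"
    by eventually_elim (use in_E_iff in blast)
qed

lemma extends_iff:
  assumes P: "forcing_notion P" and p: "p \<in> conds P"
  shows "extends z s P p \<longleftrightarrow> (\<forall>j<length s. val z j (s ! j) P p)"
proof
  assume "extends z s P p"
  then show "\<forall>j<length s. val z j (s ! j) P p"
    using leq_refl[OF P p] p unfolding extends_def fall_def fimp_def ground_def by blast
next
  have reg: "regular P (val z j v)" for j v using repr_val[OF P, of z j v] by (simp add: repr_def)
  assume "\<forall>j<length s. val z j (s ! j) P p"
  then show "extends z s P p"
    using regular_mono[OF P reg] p unfolding extends_def fall_def fimp_def ground_def by blast
qed

context
  fixes R :: "'a::order set"
  assumes R: "wfp_on R (<)" and index: "infinite (UNIV :: 'i set)"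
begin

lemma restr_le_iff:
  fixes p q :: "('a, 'i) cond"
  assumes p: "good R p" "supp p \<subseteq> Qbelow R x" and q: "good R q" "supp q \<subseteq> Qbelow R (El b)"
  shows "le R (restr R p (El b)) q \<longleftrightarrow> le R p q"
proof
  assume "le R (restr R p (El b)) q"
  then show "le R p q" by (rule le_trans[OF R index p(1) good_restr[OF p(1)] q(1) p(2) le_restr_self[OF R p(1)]])
next
  assume "le R p q"
  from le_restr[OF R this, of "El b"] show "le R (restr R p (El b)) q" by (simp add: restr_eq_self[OF q])
qed

text \<open>A condition with support in \<open>Q_b\<close> is weaker than \<open>p\<close> iff it is
  weaker than the restriction of \<open>p\<close>, so a \<open>P_b\<close>-name has the same value
  at both stages.\<close>

lemma ev_restr:
  fixes G :: "nat \<Rightarrow> ('a, 'i) cond"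
  assumes b: "b \<in> Qbelow R x" and G: "descending (\<P> R x) G" and \<tau>: "fst ` \<tau> \<subseteq> conds (\<P> R (El b))"
  shows "ev (\<P> R (El b)) ((\<lambda>p. restr R p (El b)) \<circ> G) \<tau> n v \<longleftrightarrow> ev (\<P> R x) G \<tau> n v"
proof -
  have "q \<in> conds (\<P> R (El b)) \<and> leq (\<P> R (El b)) (restr R (G i) (El b)) q \<longleftrightarrow> q \<in> conds (\<P> R x) \<and> leq (\<P> R x) (G i) q"
    if "(q, n, v) \<in> \<tau>" for q i
  proof -
    have "q \<in> conds (\<P> R (El b))" using \<tau> that by force
    then have q: "good R q" "supp q \<subseteq> Qbelow R (El b)" by (simp_all add: conds_P)
    moreover have "supp q \<subseteq> Qbelow R x" using q(2) Qbelow_trans[OF R b] by blast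
    ultimately show ?thesis
      using restr_le_iff[OF descending_P(1,2)[OF R index G] q] by (simp add: conds_P leq_P)
  qed
  then show ?thesis unfolding ev_def by auto
qed

text \<open>Otherwise some \<open>q\<close> in \<open>P_b\<close> forces the negation. As
  \<open>q\<close> is also a condition of \<open>P_x\<close>, there is a generic sequence of
  \<open>P_x\<close> from \<open>q\<close>, and along its restriction \<open>\<Psi>\<close> would be
  false.\<close>

lemma reflect:
  fixes \<Psi> :: "(nat \<Rightarrow> ('a, 'i) cond) \<Rightarrow> bool"
  assumes b: "b \<in> Qbelow R x" and rp: "repr (\<P> R (El b)) \<phi> \<Psi>"
    and \<Psi>: "\<forall>\<^sub>F G in gen (\<P> R x). \<Psi> ((\<lambda>p. restr R p (El b)) \<circ> G)"
  shows "\<forall>\<^sub>F G in gen (\<P> R (El b)). \<Psi> G"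
proof -
  let ?B = "\<P> R (El b) :: ('a, 'i) cond forcing" and ?P = "\<P> R x :: ('a, 'i) cond forcing"
  note B = forcing_notion_P[OF R, of "El b"] and P = forcing_notion_P[OF R, of x]
  have "\<phi> ?B p" if p: "p \<in> conds ?B" for p
  proof (rule ccontr)
    assume "\<not> \<phi> ?B p"
    then have "\<not> dense_below (\<phi> ?B) ?B p"
      using bspec[OF rp[unfolded repr_def regular_def, THEN conjunct1] p] by blast
    then obtain q where q: "q \<in> conds ?B" "(\<^bold>\<not> \<phi>) ?B q" by (auto simp: dense_below_def fneg_def)
    then have "\<forall>\<^sub>F G in gen ?B. met ?B G q \<longrightarrow> \<not> \<Psi> G" using repr_forces[OF B repr_neg[OF B rp] q(1)] by blast
    from eventually_conj[OF gen_restr[OF R index b this] \<Psi>]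
    have ae: "\<forall>\<^sub>F G in gen ?P. (met ?B ((\<lambda>p. restr R p (El b)) \<circ> G) q \<longrightarrow> \<not> \<Psi> ((\<lambda>p. restr R p (El b)) \<circ> G)) \<and>
       \<Psi> ((\<lambda>p. restr R p (El b)) \<circ> G)" .
    have g: "good R q" "supp q \<subseteq> Qbelow R (El b)" using q(1) by (simp_all add: conds_P)
    then have "q \<in> conds ?P" using Qbelow_trans[OF R b] by (auto simp: conds_P)
    then obtain G where G: "G 0 = q" "\<not> met ?B ((\<lambda>p. restr R p (El b)) \<circ> G) q"
      using generic_exists[OF P _ ae] by blast
    have "((\<lambda>p. restr R p (El b)) \<circ> G) 0 = q" using restr_eq_self[OF g] G(1) by simp
    then have "met ?B ((\<lambda>p. restr R p (El b)) \<circ> G) q" using leq_refl[OF B q(1)] unfolding met_def by metis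
    then show False using G(2) by blast
  qed
  then have "forced ?B \<phi>" by (simp add: forced_def forces_def)
  then show ?thesis using repr_forced[OF B rp] by blast
qed

lemma name_bounded:
  fixes \<tau> :: "(('a, 'i) cond, 'v) fun_name"
  assumes "countable \<tau>" "fst ` \<tau> \<subseteq> conds (\<P> R x)"
  shows "countable (\<Union>p\<in>fst ` \<tau>. supp p)" "(\<Union>p\<in>fst ` \<tau>. supp p) \<subseteq> Qbelow R (El b) \<Longrightarrow> fst ` \<tau> \<subseteq> conds (\<P> R (El b))"
proof -
  have g: "good R p" if "p \<in> fst ` \<tau>" for p using that assms(2) by (auto simp: conds_P subset_iff)
  show "countable (\<Union>p\<in>fst ` \<tau>. supp p)"
    by (rule countable_UN[OF countable_image[OF assms(1)] countable_finite[OF finite_supp[OF g]]])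
  show "fst ` \<tau> \<subseteq> conds (\<P> R (El b))" if "(\<Union>p\<in>fst ` \<tau>. supp p) \<subseteq> Qbelow R (El b)"
  proof
    fix p assume p: "p \<in> fst ` \<tau>"
    then have "supp p \<subseteq> Qbelow R (El b)" using that by blast
    then show "p \<in> conds (\<P> R (El b))" using g[OF p] by (simp add: conds_P)
  qed
qed

lemma real_covered:
  fixes x :: "(nat \<Rightarrow> ('a, 'i) cond) \<Rightarrow> nat \<Rightarrow> bool"
  assumes bound: "\<And>A :: 'a set. countable A \<Longrightarrow> \<exists>b. A \<subseteq> Qbelow R (El b)" and whole: "\<And>b. b \<in> Qbelow R w"
    and x: "\<And>n. meas (\<P> R w) (\<lambda>G. x G n)" and f: "\<And>n. meas (\<P> R w) (\<lambda>G. f G n)"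
    and mono: "\<forall>\<^sub>F G in gen (\<P> R w). strict_mono (f G)"
  shows "\<exists>b. \<forall>\<^sub>F G in gen (\<P> R w). E_set (x G) (f G) \<subseteq>
    E_set (fn (\<P> R w) G (c_name R (\<P> R w) (rank R (El b)))) (fn (\<P> R w) G (d_name (\<P> R w) b))"
proof -
  let ?P = "\<P> R w :: ('a, 'i) cond forcing"
  note P = forcing_notion_P[OF R, of w] and ccc = ccc_P[OF R index, of w]
  obtain X :: "(('a, 'i) cond, bool) fun_name" where X: "countable X" "fst ` X \<subseteq> conds ?P"
    "\<forall>\<^sub>F G in gen ?P. \<forall>n v. ev ?P G X n v \<longleftrightarrow> x G n = v"
    by (rule name_exists[OF P ccc x])
  obtain g :: "(('a, 'i) cond, nat) fun_name" where g: "countable g" "fst ` g \<subseteq> conds ?P"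
    "\<forall>\<^sub>F G in gen ?P. \<forall>n v. ev ?P G g n v \<longleftrightarrow> f G n = v"
    by (rule name_exists[OF P ccc f])
  obtain b where b: "(\<Union>p\<in>fst ` X. supp p) \<union> (\<Union>p\<in>fst ` g. supp p) \<subseteq> Qbelow R (El b)"
    using bound[of "(\<Union>p\<in>fst ` X. supp p) \<union> (\<Union>p\<in>fst ` g. supp p)"]
      name_bounded(1)[OF X(1,2)] name_bounded(1)[OF g(1,2)] by blast
  let ?B = "\<P> R (El b) :: ('a, 'i) cond forcing" and ?\<pi> = "\<lambda>p :: ('a, 'i) cond. restr R p (El b)"
  note B = forcing_notion_P[OF R, of "El b"]
  from b have "(\<Union>p\<in>fst ` X. supp p) \<subseteq> Qbelow R (El b)" "(\<Union>p\<in>fst ` g. supp p) \<subseteq> Qbelow R (El b)"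
    by (simp_all only: Un_subset_iff)
  from name_bounded(2)[OF X(1,2) this(1)] name_bounded(2)[OF g(1,2) this(2)]
  have XB: "fst ` X \<subseteq> conds ?B" and gB: "fst ` g \<subseteq> conds ?B" .
  note bw = whole[of b]
  from X(3) g(3) mono eventually_descending[of ?P]
  have ae: "\<forall>\<^sub>F G in gen ?P. (total_name ?B (?\<pi> \<circ> G) X \<and> fn ?B (?\<pi> \<circ> G) X = x G) \<and>
    (total_name ?B (?\<pi> \<circ> G) g \<and> fn ?B (?\<pi> \<circ> G) g = f G \<and> strict_mono (f G))"
  proof eventually_elim
    case (elim G)
    have eX: "ev ?B (?\<pi> \<circ> G) X n v \<longleftrightarrow> x G n = v" for n v
      using ev_restr[OF bw elim(4) XB] elim(1) by simp
    have eg: "ev ?B (?\<pi> \<circ> G) g n v \<longleftrightarrow> f G n = v" for n v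
      using ev_restr[OF bw elim(4) gB] elim(2) by simp
    have "fn ?B (?\<pi> \<circ> G) X = x G" by (rule ext, rule fn_eqI, rule eX)
    moreover have "fn ?B (?\<pi> \<circ> G) g = f G" by (rule ext, rule fn_eqI, rule eg)
    ultimately show ?case using elim(3) by (simp add: total_name_def eX eg)
  qed
  \<comment> \<open>The names were obtained over the whole forcing; that they are total already as
    \<open>P_b\<close>-names has to be reflected.\<close>
  have tX: "\<forall>\<^sub>F G in gen ?B. total_name ?B G X"
    by (rule reflect[OF bw repr_is_fun[OF B]], rule eventually_mono[OF ae]) simp
  have tg: "\<forall>\<^sub>F G in gen ?B. total_name ?B G g \<and> strict_mono (fn ?B G g)"
    by (rule reflect[OF bw repr_in_incr[OF B]], rule eventually_mono[OF ae]) simp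
  from generic_cover[OF R index bw tX tg] ae
  have "\<forall>\<^sub>F G in gen ?P. E_set (x G) (f G) \<subseteq> E_set (fn ?P G (c_name R ?P (rank R (El b)))) (fn ?P G (d_name ?P b))"
    by eventually_elim simp
  then show ?thesis by blast
qed

text \<open>Elements of equal rank share the Cohen real, and (4) compares their partitions. If the
  rank increases, \<open>c_a\<close> and \<open>d_a\<close> have names in \<open>P_b\<close> and are
  covered like any other pair there.\<close>

lemma generic_sub:
  assumes whole: "\<And>b. b \<in> Qbelow R w" and ab: "a \<le> b"
  shows "\<forall>\<^sub>F G in gen (\<P> R w :: ('a, 'i) cond forcing).
    E_set (fn (\<P> R w) G (c_name R (\<P> R w) (rank R (El a)))) (fn (\<P> R w) G (d_name (\<P> R w) a)) \<subseteq>
    E_set (fn (\<P> R w) G (c_name R (\<P> R w) (rank R (El b)))) (fn (\<P> R w) G (d_name (\<P> R w) b))"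
proof -
  let ?P = "\<P> R w :: ('a, 'i) cond forcing"
  note da = generic_d[OF R index whole[of a]] and db = generic_d[OF R index whole[of b]]
  consider "a = b" | "a < b" "rank R (El a) = rank R (El b)" | "a \<in> Qbelow R (El b)"
    using ab rank_mono[OF R, of "El a" "El b"] by (auto simp: Qbelow_def ll_def le_less)
  then show ?thesis
  proof cases
    case 1
    then show ?thesis by simp
  next
    case 2
    from generic_same_rank[OF R index whole whole 2] da db show ?thesis
    proof eventually_elim
      case (elim G)
      show ?case unfolding 2(2) by (rule E_set_mono) (use elim in auto)
    qed
  next
    case 3
    let ?B = "\<P> R (El b) :: ('a, 'i) cond forcing" and ?\<pi> = "\<lambda>p :: ('a, 'i) cond. restr R p (El b)"
    let ?\<alpha> = "rank R (El a)"
    note dB = generic_d[OF R index 3] and cB = generic_c[OF R index 3]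
    have tX: "\<forall>\<^sub>F G in gen ?B. total_name ?B G (c_name R ?B ?\<alpha>)" by (rule eventually_mono[OF cB]) simp
    have td: "\<forall>\<^sub>F G in gen ?B. total_name ?B G (d_name ?B a) \<and> strict_mono (fn ?B G (d_name ?B a))"
      by (rule eventually_mono[OF dB]) simp
    from generic_cover[OF R index whole tX td] gen_restr[OF R index whole tX] gen_restr[OF R index whole td]
      da generic_c[OF R index whole[of a]] gen_restr[OF R index whole eventually_descending[of ?B]] eventually_descending[of ?P]
    show ?thesis
    proof eventually_elim
      case (elim G)
      \<comment> \<open>A restriction omits the Cohen part of a rank that occurs only outside
        \<open>Q_b\<close>, so the evaluations agree at first in one direction only; totality of
        both names yields equality.\<close>
      have "fn ?B (?\<pi> \<circ> G) (c_name R ?B ?\<alpha>) n = fn ?P G (c_name R ?P ?\<alpha>) n" for n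
      proof -
        have "ev ?B (?\<pi> \<circ> G) (c_name R ?B ?\<alpha>) n (fn ?B (?\<pi> \<circ> G) (c_name R ?B ?\<alpha>) n)"
          using fn_iff[OF elim(2)] by blast
        then obtain i where i: "n < length (s_of (?\<pi> (G i)) ?\<alpha>)"
          "s_of (?\<pi> (G i)) ?\<alpha> ! n = fn ?B (?\<pi> \<circ> G) (c_name R ?B ?\<alpha>) n"
          unfolding ev_c[OF R index elim(6)] by auto
        have "s_of (?\<pi> (G i)) ?\<alpha> = s_of (G i) ?\<alpha>"
          using i(1) by (auto simp: s_of_def restr_def Let_def restrict_map_def split: if_splits)
        then have "ev ?P G (c_name R ?P ?\<alpha>) n (fn ?B (?\<pi> \<circ> G) (c_name R ?B ?\<alpha>) n)"
          unfolding ev_c[OF R index elim(7)] using i by (intro exI[of _ i]) simp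
        then show ?thesis using elim(5) fn_iff by metis
      qed
      then have c: "fn ?B (?\<pi> \<circ> G) (c_name R ?B ?\<alpha>) = fn ?P G (c_name R ?P ?\<alpha>)" by blast
      have "t_of (?\<pi> (G i)) a = t_of (G i) a" for i
        using 3 by (simp add: t_of_def supp_restr parts_restr)
      then have "ev ?B (?\<pi> \<circ> G) (d_name ?B a) n k \<longleftrightarrow> ev ?P G (d_name ?P a) n k" for n k
        unfolding ev_d[OF R index elim(6)] ev_d[OF R index elim(7)] by simp
      then have d: "fn ?B (?\<pi> \<circ> G) (d_name ?B a) = fn ?P G (d_name ?P a)" by (intro ext) (simp add: fn_def)
      show ?case using elim(1) unfolding c d .
    qed
  qed
qed

end

section \<open>Meager sets\<close>

text \<open>The threshold \<open>m\<close> of \<open>in_E\<close> is fixed here. For an interval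
  partition \<open>f\<close> this gives a closed nowhere dense set, and \<open>E_{x,f}\<close> is
  the union over all \<open>m\<close>.\<close>

definition eventually_different :: "'p real_name \<Rightarrow> 'p real_name \<Rightarrow> ('p, nat) fun_name \<Rightarrow> nat \<Rightarrow> 'p formula" where
  "eventually_different z x f m = (in_Cantor z \<^bold>\<and>
     (\<^bold>\<forall>n. ground (m \<le> n) \<^bold>\<longrightarrow> (\<^bold>\<exists>j. in_interval j f n \<^bold>\<and> (\<^bold>\<not> eq_at z x j))))"

definition E_layer :: "'p forcing \<Rightarrow> 'p real_name \<Rightarrow> ('p, nat) fun_name \<Rightarrow> nat \<Rightarrow> 'p set_name" where
  "E_layer P x f m = {(z, p). p \<in> conds P \<and> eventually_different z x f m P p}"

context
  fixes P :: "'p forcing"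
  assumes P: "forcing_notion P"
begin

lemma fexI:
  assumes "regular P (\<phi> x)" "\<phi> x P p" "p \<in> conds P" shows "(\<^bold>\<exists>x. \<phi> x) P p"
  unfolding fex_def dense_below_def
proof (intro ballI impI)
  fix q assume q: "q \<in> conds P" "leq P q p"
  then have "\<phi> x P q" using regular_mono[OF P assms(1,2)] assms(3) by blast
  then show "\<exists>r\<in>conds P. leq P r q \<and> (\<exists>x. \<phi> x P r)" using q(1) leq_refl[OF P q(1)] by blast
qed

lemma fexE:
  assumes "(\<^bold>\<exists>x. \<phi> x) P p" "q \<in> conds P" "leq P q p"
  obtains r x where "r \<in> conds P" "leq P r q" "\<phi> x P r"
  using assms unfolding fex_def dense_below_def by blast

lemma repr_eventually_different:
  "repr P (eventually_different z x f m) (\<lambda>G. (\<forall>n. \<exists>!v. ev P G z n v) \<and> (\<forall>n. m \<le> n \<longrightarrow>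
     (\<exists>j. (\<exists>k l. ev P G f n k \<and> ev P G f (Suc n) l \<and> k \<le> j \<and> j < l) \<and>
       \<not> (\<exists>v. ev P G z j v \<and> ev P G x j v))))"
proof -
  have "repr P (in_Cantor z) (\<lambda>G. \<forall>n. \<exists>!v. ev P G z n v)"
    using repr_is_fun[OF P, of z] unfolding in_Cantor_def total_name_def .
  then show ?thesis unfolding eventually_different_def
    by (intro repr_intros[OF P] repr_in_interval[OF P] repr_eq_at[OF P])
qed

lemma mem_E_layer:
  "q \<in> conds P \<Longrightarrow> mem z (E_layer P x f m) P q \<longleftrightarrow> eventually_different z x f m P q"
  unfolding E_layer_def
  by (rule mem_comprehension[OF P, of "\<lambda>z. eventually_different z x f m" "\<lambda>e G. (\<forall>n. \<exists>!v. e n v) \<and> (\<forall>n. m \<le> n \<longrightarrow>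
     (\<exists>j. (\<exists>k l. ev P G f n k \<and> ev P G f (Suc n) l \<and> k \<le> j \<and> j < l) \<and>
       \<not> (\<exists>v. e j v \<and> ev P G x j v)))", OF repr_eventually_different])

lemma E_layer_Cantor: "p \<in> conds P \<Longrightarrow> sub_Cantor (E_layer P x f m) P p"
  unfolding sub_Cantor_def fall_def fimp_def
  by (simp add: mem_E_layer eventually_different_def fconj_def)

lemma E_name_Cantor: "p \<in> conds P \<Longrightarrow> sub_Cantor (E_name P x f) P p"
  unfolding sub_Cantor_def fall_def fimp_def
  by (simp add: mem_E_name[OF P] in_E_def fconj_def)

lemma E_name_layers:
  assumes p: "p \<in> conds P"
  shows "(\<^bold>\<forall>z. mem z (E_name P x f) \<^bold>\<longleftrightarrow> (\<^bold>\<exists>m. mem z (E_layer P x f m))) P p"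
proof -
  have "mem z (E_name P x f) P q \<longleftrightarrow> (\<^bold>\<exists>m. mem z (E_layer P x f m)) P q" if q: "q \<in> conds P" for z q
  proof -
    let ?\<phi> = "\<lambda>m. \<^bold>\<forall>n. ground (m \<le> n) \<^bold>\<longrightarrow> (\<^bold>\<exists>j. in_interval j f n \<^bold>\<and> (\<^bold>\<not> eq_at z x j))"
    have reg: "regular P (in_Cantor z)" using repr_is_fun[OF P, of z] by (simp add: repr_def in_Cantor_def)
    show ?thesis
    proof
      assume "mem z (E_name P x f) P q"
      then have e: "in_Cantor z P q" "(\<^bold>\<exists>m. ?\<phi> m) P q" using mem_E_name[OF P q] by (simp_all add: in_E_def fconj_def)
      show "(\<^bold>\<exists>m. mem z (E_layer P x f m)) P q" unfolding fex_def dense_below_def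
      proof (intro ballI impI)
        fix r assume r: "r \<in> conds P" "leq P r q"
        obtain s m where s: "s \<in> conds P" "leq P s r" "?\<phi> m P s"
          by (rule fexE[OF e(2) r])
        have "leq P s q" by (rule leq_trans[OF P s(2) r(2) s(1) r(1) q])
        then have "in_Cantor z P s" using regular_mono[OF P reg e(1)] q s(1) by blast
        then have "mem z (E_layer P x f m) P s"
          using s(3) mem_E_layer[OF s(1)] by (simp add: eventually_different_def fconj_def)
        then show "\<exists>s\<in>conds P. leq P s r \<and> (\<exists>m. mem z (E_layer P x f m) P s)" using s by blast
      qed
    next
      assume e: "(\<^bold>\<exists>m. mem z (E_layer P x f m)) P q"
      have "dense_below (mem z (E_name P x f) P) P q" unfolding dense_below_def
      proof (intro ballI impI)
        fix r assume r: "r \<in> conds P" "leq P r q"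
        obtain s m where s: "s \<in> conds P" "leq P s r" "mem z (E_layer P x f m) P s"
          by (rule fexE[OF e r])
        from s(3) have ed: "in_Cantor z P s" "?\<phi> m P s" using mem_E_layer[OF s(1)]
          by (simp_all add: eventually_different_def fconj_def)
        have rp: "repr P (?\<phi> m) (\<lambda>G. \<forall>n. m \<le> n \<longrightarrow> (\<exists>j. (\<exists>k l. ev P G f n k \<and> ev P G f (Suc n) l \<and> k \<le> j \<and> j < l) \<and>
          \<not> (\<exists>v. ev P G z j v \<and> ev P G x j v)))"
          by (intro repr_intros[OF P] repr_in_interval[OF P] repr_eq_at[OF P])
        then have reg': "regular P (?\<phi> m)" by (simp add: repr_def)
        have "(\<^bold>\<exists>m. ?\<phi> m) P s" by (rule fexI[where \<phi> = ?\<phi>, OF reg' ed(2) s(1)])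
        then have "mem z (E_name P x f) P s" using ed(1) mem_E_name[OF P s(1)] by (simp add: in_E_def fconj_def)
        then show "\<exists>s\<in>conds P. leq P s r \<and> mem z (E_name P x f) P s" using s by blast
      qed
      then show "mem z (E_name P x f) P q" using bspec[OF regular_mem[OF P, unfolded regular_def] q] by blast
    qed
  qed
  then show ?thesis unfolding fall_def fiff_def fconj_def fimp_def by blast
qed

text \<open>Given \<open>s\<close>, the real \<open>z\<close> that continues \<open>s\<close> by
  \<open>x\<close> is not in the closure: a member of the layer that agrees with \<open>z\<close> up
  to the end of a late interval would agree with \<open>x\<close> on that interval.\<close>

lemma E_layer_nowhere_dense:
  assumes ccc: "ccc P" and x: "\<forall>\<^sub>F G in gen P. total_name P G x"
    and f: "\<forall>\<^sub>F G in gen P. total_name P G f \<and> strict_mono (fn P G f)" and p: "p \<in> conds P"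
  shows "nowhere_dense (E_layer P x f m) P p"
proof -
  let ?A = "E_layer P x f m"
  have False if q: "q \<in> conds P" and H: "(\<^bold>\<forall>z. (in_Cantor z \<^bold>\<and> extends z s) \<^bold>\<longrightarrow> in_closure z ?A) P q" for q s
  proof -
    define V where "V G j = (if j < length s then s ! j else fn P G x j)" for G j
    have "meas P (\<lambda>G. V G j)" for j
      unfolding V_def using meas_const[OF P] meas_fn[OF P x] by (cases "j < length s") auto
    then obtain z where z: "\<forall>\<^sub>F G in gen P. \<forall>n v. ev P G z n v \<longleftrightarrow> V G n = v"
      using name_exists[OF P ccc, of V] by blast
    have tz: "\<forall>\<^sub>F G in gen P. total_name P G z \<and> fn P G z = V G"
      using z
    proof eventually_elim
      case (elim G)
      have "fn P G z = V G" by (rule ext, rule fn_eqI) (use elim in blast)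
      then show ?case using elim by (simp add: total_name_def)
    qed
    have "in_Cantor z P q" unfolding in_Cantor_def repr_forces[OF P repr_is_fun[OF P] q]
      by (rule eventually_mono[OF tz]) simp
    moreover have "extends z s P q" unfolding repr_forces[OF P repr_extends[OF P] q]
      using z by eventually_elim (simp add: V_def)
    ultimately have cl: "in_closure z ?A P q"
      using H q leq_refl[OF P q] unfolding fall_def fimp_def fconj_def by blast
    have "\<forall>\<^sub>F G in gen P. \<forall>n k l t. holds P G (decides f z n k l t) \<longleftrightarrow> ev P G f n k \<and> ev P G f (Suc n) l \<and>
        (\<forall>j. j < length t \<longrightarrow> ev P G z j (t ! j))"
      using repr_decides[OF P, of f z] unfolding repr_def by (intro eventually_gen_all) blast
    then obtain G where G: "descending P G" "G 0 = q" "total_name P G z" "total_name P G f" "strict_mono (fn P G f)"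
      "\<forall>n k l t. holds P G (decides f z n k l t) \<longleftrightarrow> ev P G f n k \<and> ev P G f (Suc n) l \<and>
        (\<forall>j. j < length t \<longrightarrow> ev P G z j (t ! j))"
      using generic_exists[OF P q eventually_conj[OF eventually_conj[OF tz f]]] by blast
    \<comment> \<open>The \<open>n\<close>-th interval counts for the layer because
      \<open>m \<le> n\<close>, and it begins beyond \<open>s\<close> because
      \<open>length s \<le> n\<close>.\<close>
    define n where "n = max m (length s)"
    let ?k = "fn P G f n" and ?l = "fn P G f (Suc n)"
    define t where "t = map (fn P G z) [0..<?l]"
    have "length s \<le> ?k" using strict_mono_ge[OF G(5), of n] by (simp add: n_def)
    have "holds P G (decides f z n ?k ?l t)" using G(3,4,6) by (simp add: fn_iff t_def)
    then obtain i where i: "decides f z n ?k ?l t P (G i)" by (auto simp: holds_def)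
    let ?r = "G i"
    have r: "?r \<in> conds P" "leq P ?r q" using G(1,2) descending_le[OF P G(1), of 0 i] by (auto simp: descending_def)
    have "extends z t P ?r" using i by (simp add: decides_def extends_def fconj_def)
    moreover have "(extends z t \<^bold>\<longrightarrow> (\<^bold>\<exists>y. mem y ?A \<^bold>\<and> extends y t)) P q"
      using cl unfolding in_closure_def fall_def fconj_def by blast
    ultimately have "(\<^bold>\<exists>y. mem y ?A \<^bold>\<and> extends y t) P ?r" using r unfolding fimp_def by blast
    from fexE[OF this r(1) leq_refl[OF P r(1)]] obtain u y where
      u: "u \<in> conds P" "leq P u ?r" "mem y ?A P u" "extends y t P u" unfolding fconj_def by blast
    have "regular P (decides f z n ?k ?l t)" using repr_decides[OF P, of f z n ?k ?l t] by (simp add: repr_def)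
    from regular_mono[OF P this i u(2) r(1) u(1)] have dec: "decides f z n ?k ?l t P u" .
    have "eventually_different y x f m P u" using u(3) mem_E_layer[OF u(1)] by simp
    note 1 = this[unfolded repr_forces[OF P repr_eventually_different u(1)]]
      and 2 = u(4)[unfolded repr_forces[OF P repr_extends[OF P] u(1)]]
      and 3 = dec[unfolded repr_forces[OF P repr_decides[OF P] u(1)]]
    from 1 2 3 tz f x have "\<forall>\<^sub>F \<tau> in gen P. met P \<tau> u \<longrightarrow> False"
    proof eventually_elim
      case (elim \<tau>)
      show ?case
      proof
        assume mu: "met P \<tau> u"
        have "m \<le> n" by (simp add: n_def)
        then obtain j where j: "\<exists>k l. ev P \<tau> f n k \<and> ev P \<tau> f (Suc n) l \<and> k \<le> j \<and> j < l"
          "\<not> (\<exists>v. ev P \<tau> y j v \<and> ev P \<tau> x j v)" using elim(1) mu by blast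
        have "fn P \<tau> f n = ?k" "fn P \<tau> f (Suc n) = ?l" using elim(3,5) mu by (simp_all add: fn_iff)
        then have jb: "?k \<le> j" "j < ?l" using j(1) elim(5) by (auto simp: fn_iff)
        then have jt: "j < length t" by (simp add: t_def)
        have "ev P \<tau> y j (t ! j)" using elim(2) mu jt by blast
        moreover have "ev P \<tau> z j (t ! j)" using elim(3) mu jt by blast
        then have "V \<tau> j = t ! j" using elim(4) by (simp add: fn_iff)
        then have "fn P \<tau> x j = t ! j" using jb \<open>length s \<le> ?k\<close> by (simp add: V_def)
        then have "ev P \<tau> x j (t ! j)" using elim(6) by (simp add: fn_iff)
        ultimately show False using j(2) by blast
      qed
    qed
    from generic_below[OF P u(1) this] show False by blast
  qed
  then show ?thesis unfolding nowhere_dense_def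
    using E_layer_Cantor[OF p] unfolding fconj_def fall_def[of "\<lambda>s. \<^bold>\<not> _ s"] fneg_def by blast
qed

lemma E_name_meager:
  assumes ccc: "ccc P" and x: "\<forall>\<^sub>F G in gen P. total_name P G x"
    and f: "\<forall>\<^sub>F G in gen P. total_name P G f \<and> strict_mono (fn P G f)" and p: "p \<in> conds P"
  shows "meager (E_name P x f) P p"
proof -
  let ?X = "E_name P x f"
  have "((\<^bold>\<forall>n::nat. nowhere_dense (E_layer P x f n)) \<^bold>\<and> (\<^bold>\<forall>z. mem z ?X \<^bold>\<longleftrightarrow> (\<^bold>\<exists>n. mem z (E_layer P x f n)))) P q"
    if "q \<in> conds P" for q
    using E_layer_nowhere_dense[OF ccc x f that] E_name_layers[OF that] by (simp add: fconj_def fall_def)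
  then have "(\<^bold>\<exists>A. (\<^bold>\<forall>n::nat. nowhere_dense (A n)) \<^bold>\<and> (\<^bold>\<forall>z. mem z ?X \<^bold>\<longleftrightarrow> (\<^bold>\<exists>n. mem z (A n)))) P p"
    unfolding fex_def[of "\<lambda>A. (\<^bold>\<forall>n::nat. nowhere_dense (A n)) \<^bold>\<and> _ A"] dense_below_def using leq_refl[OF P] by blast
  then show ?thesis unfolding meager_def fconj_def[of "sub_Cantor ?X"] using E_name_Cantor[OF p] by blast
qed

section \<open>Meager sets are included in some \<open>E_{x,f}\<close>\<close>

definition avoids :: "'p set_name \<Rightarrow> bool list \<Rightarrow> 'p formula" where
  "avoids A u = (\<^bold>\<forall>z. extends z u \<^bold>\<longrightarrow> (\<^bold>\<not> (mem z A)))"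

lemma regular_avoids: "regular P (avoids A u)"
  unfolding avoids_def
proof (rule regular_all[OF P])
  fix z
  have "repr P (extends z u \<^bold>\<longrightarrow> (\<^bold>\<not> (mem z A))) (\<lambda>G. (\<forall>j. j < length u \<longrightarrow> ev P G z j (u ! j)) \<longrightarrow> \<not> holds P G (mem z A))"
    by (intro repr_imp[OF P] repr_neg[OF P] repr_extends[OF P] repr_self regular_mem[OF P])
  then show "regular P (extends z u \<^bold>\<longrightarrow> (\<^bold>\<not> (mem z A)))" by (simp add: repr_def)
qed

lemma avoids_weaken:
  assumes p: "p \<in> conds P" and av: "avoids A s P p" and len: "length s \<le> length t"
    and eq: "\<And>j. j < length s \<Longrightarrow> t ! j = s ! j"
  shows "avoids A t P p"
proof -
  have "extends z s P q" if q: "q \<in> conds P" "extends z t P q" for z q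
    unfolding extends_iff[OF P q(1)]
  proof (intro allI impI)
    fix j assume j: "j < length s"
    then have "val z j (t ! j) P q" using q(2)[unfolded extends_iff[OF P q(1)]] len by simp
    then show "val z j (s ! j) P q" using eq[OF j] by simp
  qed
  then show ?thesis using av unfolding avoids_def fall_def fimp_def by blast
qed

text \<open>Some real \<open>z\<close> beginning with \<open>u\<close> is separated from
  \<open>A\<close> by a word \<open>s\<close>. Both words are initial segments of \<open>z\<close>,
  so the longer one extends \<open>u\<close> and avoids \<open>A\<close>.\<close>

lemma nowhere_dense_avoids:
  assumes p: "p \<in> conds P" and nd: "nowhere_dense A P p"
  shows "\<exists>q\<in>conds P. leq P q p \<and> (\<exists>w. avoids A (u @ w) P q)"
proof -
  have "\<not> (\<^bold>\<forall>z. (in_Cantor z \<^bold>\<and> extends z u) \<^bold>\<longrightarrow> in_closure z A) P p"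
    using nd p leq_refl[OF P p] unfolding nowhere_dense_def fconj_def[of "sub_Cantor A"] fall_def[of "\<lambda>s. \<^bold>\<not> _ s"] fneg_def
    by blast
  then obtain z q where q: "q \<in> conds P" "leq P q p" "in_Cantor z P q" "extends z u P q" "\<not> in_closure z A P q"
    unfolding fall_def fimp_def fconj_def by blast
  then have "\<not> (\<^bold>\<forall>s. extends z s \<^bold>\<longrightarrow> (\<^bold>\<exists>y. mem y A \<^bold>\<and> extends y s)) P q"
    unfolding in_closure_def fconj_def[of "in_Cantor z"] by blast
  then obtain s r where r: "r \<in> conds P" "leq P r q" "extends z s P r" "\<not> (\<^bold>\<exists>y. mem y A \<^bold>\<and> extends y s) P r"
    unfolding fall_def fimp_def by blast
  then obtain t where t: "t \<in> conds P" "leq P t r"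
    "\<And>t' y. t' \<in> conds P \<Longrightarrow> leq P t' t \<Longrightarrow> \<not> (mem y A P t' \<and> extends y s P t')"
    unfolding fex_def dense_below_def fconj_def by blast
  have tq: "leq P t q" by (rule leq_trans[OF P t(2) r(2) t(1) r(1) q(1)])
  have tp: "leq P t p" by (rule leq_trans[OF P tq q(2) t(1) q(1) p])
  have av: "avoids A s P t" unfolding avoids_def fall_def fimp_def fneg_def
  proof (intro allI ballI impI notI)
    fix y t1 t2
    assume a: "t1 \<in> conds P" "leq P t1 t" "extends y s P t1" "t2 \<in> conds P" "leq P t2 t1" "mem y A P t2"
    have "regular P (extends y s)" using repr_extends[OF P, of y s] by (simp add: repr_def)
    from regular_mono[OF P this a(3,5,1,4)] have "extends y s P t2" .
    moreover have "leq P t2 t" by (rule leq_trans[OF P a(5,2,4,1) t(1)])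
    ultimately show False using t(3)[OF a(4)] a(6) by blast
  qed
  have eq: "(u @ drop (length u) s) ! j = s ! j" if j: "j < length s" for j
  proof (cases "j < length u")
    case True
    have reg: "regular P (val z j v)" "regular P (is_fun z)" for v
      using repr_val[OF P, of z j v] repr_is_fun[OF P, of z] by (simp_all add: repr_def)
    have "val z j (u ! j) P q" using q(4) True unfolding extends_iff[OF P q(1)] by blast
    then have 1: "val z j (u ! j) P t" using regular_mono[OF P reg(1) _ tq q(1) t(1)] by blast
    have "val z j (s ! j) P r" using r(3) j unfolding extends_iff[OF P r(1)] by blast
    then have 2: "val z j (s ! j) P t" using regular_mono[OF P reg(1) _ t(2) r(1) t(1)] by blast
    have "is_fun z P t" using regular_mono[OF P reg(2) _ tq q(1) t(1)] q(3) by (simp add: in_Cantor_def)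
    then have "u ! j = s ! j"
      using 1 2 t(1) leq_refl[OF P t(1)] unfolding is_fun_def fconj_def fall_def fimp_def ground_def by blast
    then show ?thesis using True by (simp add: nth_append)
  next
    case False
    then show ?thesis using j by (simp add: nth_append)
  qed
  have "avoids A (u @ drop (length u) s) P t" by (rule avoids_weaken[OF t(1) av _ eq]) simp
  then show ?thesis using t(1) tp by blast
qed

lemma meager_covered:
  assumes r: "r \<in> conds P" and X: "sub_Cantor X P r"
    and nd: "\<And>n::nat. nowhere_dense (A n) P r"
    and cov: "(\<^bold>\<forall>z. mem z X \<^bold>\<longleftrightarrow> (\<^bold>\<exists>n. mem z (A n))) P r"
  obtains x f where "\<And>n. meas P (\<lambda>G. x G n)" "\<And>n. meas P (\<lambda>G. f G n)" "\<forall>\<^sub>F G in gen P. strict_mono (f G)"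
    "\<And>z q. q \<in> conds P \<Longrightarrow> leq P q r \<Longrightarrow> mem z X P q \<Longrightarrow>
      \<forall>\<^sub>F G in gen P. met P G q \<longrightarrow> total_name P G z \<and> fn P G z \<in> E_set (x G) (f G)"
proof -
  \<comment> \<open>The guard \<open>met P G r\<close> makes \<open>S\<close> trivially true along
    sequences that do not pass below \<open>r\<close>, so that \<open>cover_avoids\<close> applies
    along all generic sequences.\<close>
  define S where "S G u i \<longleftrightarrow> (met P G r \<longrightarrow> holds P G (avoids (A i) u))" for G u i
  have "bp P (\<lambda>G. \<exists>i. leq P (G i) r)"
    by (rule bp_open[OF P]) (use leq_trans[OF P] r in blast)
  then have "bp P (\<lambda>G. met P G r)" by (simp add: met_def)
  moreover have "bp P (\<lambda>G. holds P G (avoids (A i) u))" for i u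
    unfolding bp_def using repr_self[OF regular_avoids] by blast
  ultimately have bpS: "bp P (\<lambda>G. S G u i)" for u i unfolding S_def by (rule bp_imp[OF P])
  have nd': "nowhere_dense (A i) P q" if "q \<in> conds P" "leq P q r" for i q
    using nd[of i] that r leq_trans[OF P] unfolding nowhere_dense_def fconj_def sub_Cantor_def fall_def fimp_def fneg_def
    by blast
  have "\<forall>\<^sub>F G in gen P. \<forall>u i. met P G r \<longrightarrow> (\<exists>k. G k \<in> {q. \<exists>w. avoids (A i) (u @ w) P q})"
    by (intro eventually_gen_all eventually_dense_below[OF P r])
      (use nowhere_dense_avoids nd' in blast)
  with eventually_descending[of P]
  have SS: "\<forall>\<^sub>F G in gen P. (\<forall>u w i. S G u i \<longrightarrow> S G (u @ w) i) \<and> (\<forall>u i. \<exists>w. S G (u @ w) i)"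
  proof eventually_elim
    case (elim G)
    have "avoids (A i) (u @ w) P (G k)" if "avoids (A i) u P (G k)" for i u w k
      using elim(1) by (intro avoids_weaken[OF _ that]) (auto simp: descending_def nth_append)
    then have "\<forall>u w i. S G u i \<longrightarrow> S G (u @ w) i" unfolding S_def holds_def by blast
    moreover have "\<forall>u i. \<exists>w. S G (u @ w) i" using elim(2) unfolding S_def holds_def by blast
    ultimately show ?case by blast
  qed
  let ?x = "\<lambda>G. cover_x (S G)" and ?f = "\<lambda>G. cover_f (S G)"
  have sm: "\<forall>\<^sub>F G in gen P. strict_mono (?f G)"
    using SS by eventually_elim (rule cover_avoids(1), blast+)
  have cv: "\<forall>\<^sub>F G in gen P. met P G q \<longrightarrow> total_name P G z \<and> fn P G z \<in> E_set (?x G) (?f G)"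
    if q: "q \<in> conds P" "leq P q r" "mem z X P q" for z q
  proof -
    have "is_fun z P q" using X q unfolding sub_Cantor_def in_Cantor_def fall_def fimp_def by blast
    note tz = this[unfolded repr_forces[OF P repr_is_fun[OF P] q(1)]]
    have "(\<^bold>\<exists>n. mem z (A n)) P q" using cov q unfolding fall_def fiff_def fconj_def fimp_def by blast
    moreover have "repr P (\<^bold>\<exists>n. mem z (A n)) (\<lambda>G. \<exists>n. holds P G (mem z (A n)))"
      by (intro repr_ex[OF P] repr_self regular_mem[OF P])
    ultimately have mz: "\<forall>\<^sub>F G in gen P. met P G q \<longrightarrow> (\<exists>n. holds P G (mem z (A n)))"
      using repr_forces[OF P _ q(1)] by blast
    have ex: "\<forall>\<^sub>F G in gen P. \<forall>s. holds P G (extends z s) \<longleftrightarrow> (\<forall>j. j < length s \<longrightarrow> ev P G z j (s ! j))"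
      using repr_extends[OF P, of z] unfolding repr_def by (intro eventually_gen_all) blast
    from tz mz ex SS eventually_descending[of P] show ?thesis
    proof eventually_elim
      case (elim G)
      show ?case
      proof
        assume mq: "met P G q"
        have c: "G i \<in> conds P" for i using elim(5) by (simp add: descending_def)
        have mr: "met P G r" using mq leq_trans[OF P _ q(2) c q(1) r] unfolding met_def by blast
        have t: "total_name P G z" using elim(1) mq by blast
        obtain n where n: "holds P G (mem z (A n))" using elim(2) mq by blast
        \<comment> \<open>A member of the \<open>n\<close>-th set has no initial segment that avoids
          this set.\<close>
        have "\<not> S G (map (fn P G z) [0..<m]) n" for m
        proof
          let ?s = "map (fn P G z) [0..<m]"
          assume "S G ?s n"
          then have "holds P G (avoids (A n) ?s)" using mr by (simp add: S_def)
          then obtain i where i: "mem z (A n) P (G i)" "avoids (A n) ?s P (G i)"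
            using holds_common[OF P elim(5) regular_mem[OF P] regular_avoids n] by blast
          have "holds P G (extends z ?s)" using elim(3) t by (simp add: fn_iff)
          then obtain j where j: "extends z ?s P (G j)" by (auto simp: holds_def)
          let ?k = "max i j"
          have reg: "regular P (extends z ?s)" using repr_extends[OF P, of z ?s] by (simp add: repr_def)
          have le: "leq P (G ?k) (G i)" "leq P (G ?k) (G j)" using descending_le[OF P elim(5)] by simp_all
          have "mem z (A n) P (G ?k)" by (rule mem_mono[OF P i(1) le(1) c c])
          moreover have "extends z ?s P (G ?k)" by (rule regular_mono[OF P reg j le(2) c c])
          ultimately show False
            using i(2) le(1) c leq_refl[OF P c] unfolding avoids_def fall_def fimp_def fneg_def by blast
        qed
        then show "total_name P G z \<and> fn P G z \<in> E_set (?x G) (?f G)"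
          using t cover_avoids(2)[of "S G" "fn P G z" n] elim(4) by blast
      qed
    qed
  qed
  show ?thesis
    by (rule that[of ?x ?f, OF meas_cover(2)[OF P, of S, OF bpS] meas_cover(1)[OF P, of S, OF bpS] sm cv])
qed

end

section \<open>Bounds for countable subsets of \<open>Q\<close>\<close>

context
  fixes R :: "'a::order set"
  assumes bounded: "\<And>A :: 'a set. countable A \<Longrightarrow> \<exists>b. \<forall>a\<in>A. a < b"
    and R: "wfp_on R (<)" and cofinal: "\<forall>a. \<exists>b\<in>R. a \<le> b"
begin

text \<open>An upper bound in \<open>Q\<close> need not have larger rank. Going up to
  \<open>b\<close> and then to \<open>c\<close> within \<open>R\<close> helps, because ranks
  increase strictly along \<open>R\<close>.\<close>

lemma El_bounded: "\<exists>b. {y. y < a} \<subseteq> Qbelow R (El b)"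
proof -
  obtain b where b: "b \<in> R" "a \<le> b" using cofinal by blast
  obtain b1 where "b < b1" using bounded[of "{b}"] by auto
  then obtain c where c: "c \<in> R" "b < c" using cofinal by (meson less_le_trans)
  have "y \<in> Qbelow R (El c)" if "y < a" for y
  proof -
    have "El y < El b" using that b(2) by simp
    then have "rank R (El y) \<le> rank R (El b)" by (rule rank_mono[OF R])
    also have "\<dots> < rank R (El c)" using b c by (intro rank_less_Rstar[OF R]) (simp_all add: Rstar_def)
    finally show ?thesis using that b(2) c(2) by (simp add: Qbelow_def ll_def)
  qed
  then show ?thesis by blast
qed

lemma countable_bounded: "countable A \<Longrightarrow> \<exists>b. A \<subseteq> Qbelow R (El b)"
proof -
  assume "countable A"
  then obtain a where "\<forall>y\<in>A. y < a" using bounded by blast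
  moreover obtain b where "{y. y < a} \<subseteq> Qbelow R (El b)" using El_bounded by blast
  ultimately show ?thesis by blast
qed

text \<open>Some element of \<open>Q\<close> has larger rank than \<open>a\<close>, and
  \<open>Whole\<close> is above that element.\<close>

lemma Qbelow_Whole: "a \<in> Qbelow R Whole"
proof -
  obtain b where "a \<in> Qbelow R (El b)" using countable_bounded[of "{a}"] by auto
  then have "rank R (El a) < rank R (El b)" by (simp add: Qbelow_def ll_def)
  also have "\<dots> \<le> rank R Whole" by (rule rank_mono[OF R]) simp
  finally show ?thesis by (simp add: Qbelow_def ll_def)
qed

end

theorem theorem2p8:
  fixes R :: "'a::order set"
  assumes bounded: "\<And>A :: 'a set. countable A \<Longrightarrow> \<exists>b. \<forall>a\<in>A. a < b"
    and R_wf: "wfp_on R (<)"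
    and R_cofinal: "\<forall>a. \<exists>b\<in>R. a \<le> b"
    and index: "infinite (UNIV :: 'i set)"
  shows "let P = (\<P> R Whole :: ('a, 'i) cond forcing); E = E_gen R P in
    forcing_notion P \<and> ccc P \<and>
    forced P (\<^bold>\<forall>a. meager (E a)) \<and>
    forced P (\<^bold>\<forall>X. meager X \<^bold>\<longrightarrow> (\<^bold>\<exists>a. sub X (E a))) \<and>
    forced P (\<^bold>\<forall>a b. sub (E a) (E b) \<^bold>\<longleftrightarrow> ground (a \<le> b))"
proof -
  let ?P = "\<P> R Whole :: ('a, 'i) cond forcing"
  let ?E = "E_gen R ?P" and ?c = "\<lambda>a. c_name R ?P (rank R (El a))" and ?d = "\<lambda>a. d_name ?P a"
  note P = forcing_notion_P[OF R_wf, of Whole] and ccc = ccc_P[OF R_wf index, of Whole]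
  have whole: "a \<in> Qbelow R Whole" for a by (rule Qbelow_Whole[OF _ R_wf R_cofinal]) (rule bounded)
  have bnd: "\<exists>b. A \<subseteq> Qbelow R (El b)" if "countable A" for A :: "'a set"
    by (rule countable_bounded[OF _ R_wf R_cofinal that]) (rule bounded)
  have c: "\<forall>\<^sub>F G in gen ?P. total_name ?P G (?c a)" for a
    by (rule eventually_mono[OF generic_c[OF R_wf index whole[of a]]]) simp
  have d: "\<forall>\<^sub>F G in gen ?P. total_name ?P G (?d a) \<and> strict_mono (fn ?P G (?d a))" for a
    by (rule eventually_mono[OF generic_d[OF R_wf index whole[of a]]]) simp
  have d': "\<forall>\<^sub>F G in gen ?P. total_name ?P G (?d a)" for a by (rule eventually_mono[OF d[of a]]) simp
  have mem_E: "mem z (?E a) ?P q \<longleftrightarrow> (\<forall>\<^sub>F G in gen ?P. met ?P G q \<longrightarrow>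
      total_name ?P G z \<and> fn ?P G z \<in> E_set (fn ?P G (?c a)) (fn ?P G (?d a)))" if "q \<in> conds ?P" for z a q
    unfolding E_gen_def mem_E_name[OF P that] by (rule forces_in_E[OF P that c d'])
  have "forced ?P (\<^bold>\<forall>a. meager (?E a))"
    unfolding forced_def forces_def fall_def E_gen_def using E_name_meager[OF P ccc c d] by blast
  \<comment> \<open>Set names and elements of \<open>Q\<close> do not form countable types, so these
    quantifiers are treated by their forcing clauses.\<close>
  moreover have "forced ?P (\<^bold>\<forall>X. meager X \<^bold>\<longrightarrow> (\<^bold>\<exists>a. sub X (?E a)))"
    unfolding forced_def forces_def fall_def fimp_def fex_def[of "\<lambda>a. sub _ (?E a)"] dense_below_def
  proof (intro ballI allI impI)
    fix p X q q'
    assume q: "q \<in> conds ?P" "meager X ?P q" and q': "q' \<in> conds ?P" "leq ?P q' q"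
    have sX: "sub_Cantor X ?P q" using q(2) by (simp add: meager_def fconj_def)
    have "(\<^bold>\<exists>A. (\<^bold>\<forall>n::nat. nowhere_dense (A n)) \<^bold>\<and> (\<^bold>\<forall>z. mem z X \<^bold>\<longleftrightarrow> (\<^bold>\<exists>n. mem z (A n)))) ?P q"
      using q(2) by (simp add: meager_def fconj_def[of "sub_Cantor X"])
    then obtain r and A :: "nat \<Rightarrow> _" where r: "r \<in> conds ?P" "leq ?P r q'"
      "((\<^bold>\<forall>n::nat. nowhere_dense (A n)) \<^bold>\<and> (\<^bold>\<forall>z. mem z X \<^bold>\<longleftrightarrow> (\<^bold>\<exists>n. mem z (A n)))) ?P r"
      by (rule fexE[OF P _ q'])
    have rq: "leq ?P r q" by (rule leq_trans[OF P r(2) q'(2) r(1) q'(1) q(1)])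
    have "sub_Cantor X ?P r"
      using sX leq_trans[OF P _ rq _ r(1) q(1)] unfolding sub_Cantor_def fall_def fimp_def by blast
    moreover have "nowhere_dense (A n) ?P r" for n using r(3) by (simp add: fconj_def fall_def)
    moreover have "(\<^bold>\<forall>z. mem z X \<^bold>\<longleftrightarrow> (\<^bold>\<exists>n. mem z (A n))) ?P r" using r(3) by (simp add: fconj_def)
    ultimately obtain x f where xf: "\<And>n. meas ?P (\<lambda>G. x G n)" "\<And>n. meas ?P (\<lambda>G. f G n)"
      "\<forall>\<^sub>F G in gen ?P. strict_mono (f G)"
      "\<And>z q. q \<in> conds ?P \<Longrightarrow> leq ?P q r \<Longrightarrow> mem z X ?P q \<Longrightarrow>
        \<forall>\<^sub>F G in gen ?P. met ?P G q \<longrightarrow> total_name ?P G z \<and> fn ?P G z \<in> E_set (x G) (f G)"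
      using meager_covered[OF P r(1), of X A] by blast
    have "\<exists>b. \<forall>\<^sub>F G in gen ?P. E_set (x G) (f G) \<subseteq> E_set (fn ?P G (?c b)) (fn ?P G (?d b))"
      by (rule real_covered[OF R_wf index]) (rule bnd whole xf(1) xf(2) xf(3), assumption?)+
    then obtain b where b: "\<forall>\<^sub>F G in gen ?P. E_set (x G) (f G) \<subseteq> E_set (fn ?P G (?c b)) (fn ?P G (?d b))"
      by blast
    have "sub X (?E b) ?P r" unfolding sub_def fall_def fimp_def
    proof (intro allI ballI impI)
      fix z s assume s: "s \<in> conds ?P" "leq ?P s r" "mem z X ?P s"
      from xf(4)[OF s] b show "mem z (?E b) ?P s" unfolding mem_E[OF s(1)]
        by eventually_elim blast
    qed
    then show "\<exists>r\<in>conds ?P. leq ?P r q' \<and> (\<exists>a. sub X (?E a) ?P r)" using r by blast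
  qed
  moreover have "forced ?P (\<^bold>\<forall>a b. sub (?E a) (?E b) \<^bold>\<longleftrightarrow> ground (a \<le> b))"
  proof -
    \<comment> \<open>Every condition decides the inclusion in the same way, so the equivalence is
      forced outright.\<close>
    have "sub (?E a) (?E b) ?P q \<longleftrightarrow> a \<le> b" if q: "q \<in> conds ?P" for a b q
    proof
      assume ab: "a \<le> b"
      show "sub (?E a) (?E b) ?P q" unfolding sub_def fall_def fimp_def
      proof (intro allI ballI impI)
        fix z r assume r: "r \<in> conds ?P" "leq ?P r q" "mem z (?E a) ?P r"
        from r(3)[unfolded mem_E[OF r(1)]] generic_sub[OF R_wf index whole ab]
        show "mem z (?E b) ?P r" unfolding mem_E[OF r(1)] by eventually_elim blast
      qed
    next
      assume sub: "sub (?E a) (?E b) ?P q"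
      show "a \<le> b"
      proof (rule ccontr)
        assume ab: "\<not> a \<le> b"
        \<comment> \<open>The diagonal real is a measurable functional of the generic sequence, so
          it has a name.\<close>
        let ?V = "\<lambda>G. diag (fn ?P G (?c a)) (fn ?P G (?d a)) (fn ?P G (?c b)) (fn ?P G (?d b))"
        have "meas ?P (\<lambda>G. ?V G j)" for j
          by (rule meas_diag[OF P meas_fn[OF P c] meas_fn[OF P d'] meas_fn[OF P c] meas_fn[OF P d']])
        then obtain z where z: "\<forall>\<^sub>F G in gen ?P. \<forall>n v. ev ?P G z n v \<longleftrightarrow> ?V G n = v"
          using name_exists[OF P ccc, of ?V] by blast
        from z d[of a] d[of b] generic_incomparable[OF R_wf index whole whole ab]
        have zE: "\<forall>\<^sub>F G in gen ?P. total_name ?P G z \<and> fn ?P G z \<in> E_set (fn ?P G (?c a)) (fn ?P G (?d a)) \<and>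
          fn ?P G z \<notin> E_set (fn ?P G (?c b)) (fn ?P G (?d b))"
        proof eventually_elim
          case (elim G)
          have "fn ?P G z = ?V G" by (rule ext, rule fn_eqI) (use elim(1) in blast)
          moreover have "total_name ?P G z" using elim(1) by (simp add: total_name_def)
          ultimately show ?case using diag_separates[of "fn ?P G (?d a)" "fn ?P G (?d b)"] elim(2-4) by simp
        qed
        have "mem z (?E a) ?P q" unfolding mem_E[OF q] by (rule eventually_mono[OF zE]) simp
        then have "mem z (?E b) ?P q" using sub q leq_refl[OF P q] unfolding sub_def fall_def fimp_def by blast
        from eventually_conj[OF this[unfolded mem_E[OF q]] zE]
        have "\<forall>\<^sub>F G in gen ?P. met ?P G q \<longrightarrow> False" by (rule eventually_mono) blast
        from generic_below[OF P q this] show False by blast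
      qed
    qed
    then show ?thesis
      unfolding forced_def forces_def fall_def fiff_def fconj_def fimp_def ground_def by blast
  qed
  ultimately show ?thesis using P ccc by (simp add: Let_def)
qed

end
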